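(* Let $p=2$ and let $g\in C^1([0,\infty))$ satisfy: $(g_1)$ $\lim_{s\to 0^+} g(s)/s$ exists and belongs to $[0,1)$; $(g_2)$ $\liminf_{s\to\infty} g(s)/s>1$; $(g_3')$ there exists a constant $u_0>0$ such that $g(u_0)=u_0$ and $g'(u_0)>\lambda_2^{\mathrm{rad}}$. Then the problem $-\Delta u+u=g(u)$ in $B$, $u>0$ in $B$, $\partial_\nu u=0$ on $\partial B$ admits an increasing (nonconstant) radial solution. Moreover, if $u_{0,1},\dots,u_{0,n}$ are $n$ distinct positive constants each satisfying $g(u_{0,i})=u_{0,i}$ and $g'(u_{0,i})>\lambda_2^{\mathrm{rad}}$, then the problem admits $n$ distinct increasing radial solutions.
   Context: $B$ is the open unit ball of $\mathbb R^N$, $N\ge1$, $\nu$ the outer unit normal on $\partial B$. $\lambda_2^{\mathrm{rad}}$ denotes the second eigenvalue of the operator $-\Delta+\mathbb I$ on $B$ with homogeneous Neumann boundary conditions restricted to radial functions (i.e. the second radial Neumann eigenvalue of $-\Delta u+u=\lambda u$ in $B$). Solutions are weak solutions in $H^1(B)$. *)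

theory Defs
  imports "HOL-Analysis.Analysis"
begin

abbreviation unit_ball :: "'a::euclidean_space set" where
  "unit_ball \<equiv> ball 0 1"

definition C1_grad :: "('a::euclidean_space \<Rightarrow> real) \<Rightarrow> ('a \<Rightarrow> 'a) \<Rightarrow> bool" where
  "C1_grad \<phi> D\<phi> \<longleftrightarrow>
     (\<forall>x. (\<phi> has_derivative (\<lambda>h. D\<phi> x \<bullet> h)) (at x)) \<and> continuous_on UNIV D\<phi>"

definition H1_ball :: "('a::euclidean_space \<Rightarrow> real) \<Rightarrow> ('a \<Rightarrow> 'a) \<Rightarrow> bool" where
  "H1_ball u G \<longleftrightarrow>
     set_borel_measurable lebesgue unit_ball u \<and>
     set_borel_measurable lebesgue unit_ball G \<and>
     set_integrable lebesgue unit_ball (\<lambda>x. (u x)\<^sup>2) \<and>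
     set_integrable lebesgue unit_ball (\<lambda>x. (norm (G x))\<^sup>2) \<and>
     (\<forall>\<phi> D\<phi> K. C1_grad \<phi> D\<phi> \<and> compact K \<and> K \<subseteq> unit_ball \<and> (\<forall>x. x \<notin> K \<longrightarrow> \<phi> x = 0) \<longrightarrow>
        (LINT x:unit_ball|lebesgue. u x *\<^sub>R D\<phi> x) = - (LINT x:unit_ball|lebesgue. \<phi> x *\<^sub>R G x))"

definition neumann_weak_sol :: "('a::euclidean_space \<Rightarrow> real) \<Rightarrow> ('a \<Rightarrow> real) \<Rightarrow> bool" where
  "neumann_weak_sol f u \<longleftrightarrow>
     (\<exists>G. H1_ball u G \<and> set_integrable lebesgue unit_ball f \<and>
       (\<forall>\<phi> D\<phi>. C1_grad \<phi> D\<phi> \<longrightarrow>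
          (LINT x:unit_ball|lebesgue. G x \<bullet> D\<phi> x + u x * \<phi> x)
            = (LINT x:unit_ball|lebesgue. f x * \<phi> x)))"

definition radial :: "('a::euclidean_space \<Rightarrow> real) \<Rightarrow> bool" where
  "radial u \<longleftrightarrow> (\<forall>x\<in>unit_ball. \<forall>y\<in>unit_ball. norm x = norm y \<longrightarrow> u x = u y)"

definition radial_neumann_eigenvalues :: "'a::euclidean_space itself \<Rightarrow> real set" where
  "radial_neumann_eigenvalues _ =
     {\<mu>. \<exists>u::'a \<Rightarrow> real. radial u \<and> \<not> (AE x in lebesgue. x \<in> unit_ball \<longrightarrow> u x = 0) \<and>
          neumann_weak_sol (\<lambda>x. \<mu> * u x) u}"

text \<open>Second radial Neumann eigenvalue (radial eigenvalues are simple).\<close>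
definition lambda2_rad :: "'a::euclidean_space itself \<Rightarrow> real" where
  "lambda2_rad T = Inf {\<mu> \<in> radial_neumann_eigenvalues T. \<mu> > Inf (radial_neumann_eigenvalues T)}"

definition incr_radial_sol :: "(real \<Rightarrow> real) \<Rightarrow> ('a::euclidean_space \<Rightarrow> real) \<Rightarrow> bool" where
  "incr_radial_sol g u \<longleftrightarrow>
     neumann_weak_sol (\<lambda>x. g (u x)) u \<and>
     (\<forall>x\<in>unit_ball. u x > 0) \<and>
     (\<exists>v. (\<forall>x\<in>unit_ball. u x = v (norm x)) \<and> mono_on {0..<1} v) \<and>
     \<not> (\<exists>c. AE x in lebesgue. x \<in> unit_ball \<longrightarrow> u x = c)"

end

theory Submission
  imports Defs
begin


text \<open>
  For radial functions the problem becomes \<open>u'' + (n - 1) u' / r = - f u\<close>, \<open>u' 0 = u' 1 = 0\<close>, where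
  \<open>f s = g s - s\<close>. Let \<open>b\<close> be the given fixed point of \<open>g\<close> and \<open>a < b\<close> the largest zero of
  \<open>f\<close> below \<open>b\<close>, and shoot from \<open>u 0 = d\<close> with \<open>a < d < b\<close>. For \<open>d\<close> near \<open>a\<close> the
  solution stays in \<open>(a, b)\<close>, where \<open>f < 0\<close>, and is strictly increasing on \<open>(0, 1]\<close>. For \<open>d\<close> near
  \<open>b\<close> it cannot be, by Sturm comparison of \<open>u - b\<close> with a radial eigenfunction whose eigenvalue is
  below \<open>g' b\<close>. At the supremum \<open>d\<close> of the parameters with strictly increasing solutions, \<open>u' \<ge> 0\<close>
  and \<open>u'\<close> has a zero, which uniqueness for the initial value problem forces to be at \<open>r = 1\<close>.
  The energy \<open>u'\<^sup>2 / 2 + F u\<close>, where \<open>F' = f\<close>, decreases, so \<open>u\<close> stays in a bounded range and \<open>f\<close> may be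
  truncated to a Lipschitz function. Different fixed points give solutions with different values at \<open>0\<close>.

  The weak eigenvalues are identified with the classical ones by duality: if the solution of the eigenvalue
  equation that is regular at \<open>0\<close> violates the boundary condition, then for every \<open>h\<close> the inhomogeneous
  equation has a regular Neumann solution, which shows that a weak eigenfunction is orthogonal to \<open>h\<close>.
\<close>

section \<open>The radial equation\<close>

text \<open>Writing \<open>u' = r q\<close> does more than regularize the origin. Every solution has
  \<open>u' 0 = 0\<close>, so positivity of \<open>u'\<close> on (0, 1] is not stable under
  uniformly small perturbations, whereas \<open>q > 0\<close> on the compact interval [0, 1] is. The
  shooting set is defined by the latter. The weak formulation offers no trace on the sphere: the
  gradient in \<open>H1_ball\<close> is tested with compactly supported functions only. The duality
  argument therefore needs a Green formula obtained with cutoffs, and the cutoff term disappears in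
  the limit because \<open>q 1 = 0\<close> makes \<open>q\<close> vanish linearly at the sphere.
  \<open>lambda2_rad\<close> is an infimum of reals and carries information only once its set is
  known to be nonempty; an eigenvalue above 1 is produced by scaling a zero of a Bessel-type
  solution to radius 1. Solutions for different fixed points differ because each \<open>u 0\<close>
  lies in an interval (a, b) that contains no fixed point and ends at one, and two such intervals
  with different right ends are disjoint.\<close>

text \<open>The equation \<open>u'' + (n - 1) u' / r = - w\<close> with \<open>u' 0 = 0\<close>, written for \<open>q r = u' r / r\<close>,
  which stays regular at \<open>r = 0\<close>; its gradient form is \<open>\<nabla> u = q x\<close>.\<close>

definition radial_ode ::
    "nat \<Rightarrow> (real \<Rightarrow> real) \<Rightarrow> (real \<Rightarrow> real) \<Rightarrow> (real \<Rightarrow> real) \<Rightarrow> bool" where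
  "radial_ode n u q w \<longleftrightarrow>
     continuous_on {0..} q \<and> continuous_on {0..} w \<and> q 0 = - w 0 / real n \<and>
     (\<forall>r\<ge>0. (u has_real_derivative r * q r) (at r within {0..})) \<and>
     (\<forall>r>0. (q has_real_derivative (- w r - real n * q r) / r) (at r))"

lemma radial_odeD:
  assumes "radial_ode n u q w"
  shows "continuous_on {0..} q" "continuous_on {0..} w" "q 0 = - w 0 / real n"
    "\<And>r. r \<ge> 0 \<Longrightarrow> (u has_real_derivative r * q r) (at r within {0..})"
    "\<And>r. r > 0 \<Longrightarrow> (q has_real_derivative (- w r - real n * q r) / r) (at r)"
    "\<And>r. r > 0 \<Longrightarrow> (u has_real_derivative r * q r) (at r)"
    "continuous_on {0..} u"
proof -
  show 1: "continuous_on {0..} q" "continuous_on {0..} w" "q 0 = - w 0 / real n"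
    "\<And>r. r \<ge> 0 \<Longrightarrow> (u has_real_derivative r * q r) (at r within {0..})"
    "\<And>r. r > 0 \<Longrightarrow> (q has_real_derivative (- w r - real n * q r) / r) (at r)"
    using assms unfolding radial_ode_def by auto
  show "(u has_real_derivative r * q r) (at r)" if "r > 0" for r
    using 1(4)[of r] that by (simp add: at_within_interior[of r "{0..}"])
  show "continuous_on {0..} u"
    using 1(4) by (meson DERIV_continuous atLeast_iff continuous_on_eq_continuous_within)
qed

lemma radial_ode_cong:
  assumes "radial_ode n u q w" "\<And>r. r \<ge> 0 \<Longrightarrow> w r = w' r"
  shows "radial_ode n u q w'"
proof -
  have "continuous_on {0..} w'"
    by (rule continuous_on_eq[OF radial_odeD(2)[OF assms(1)]]) (use assms(2) in auto)
  then show ?thesis using assms unfolding radial_ode_def by auto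
qed

text \<open>The right-hand side is an argument of its own, so the relation is linear in the triple
  even where \<open>w\<close> depends nonlinearly on \<open>u\<close>. Differences of solutions and
  shifts by constants come from here with \<open>c = -1\<close>.\<close>

lemma radial_ode_add_scaled:
  assumes "radial_ode n u1 q1 w1" "radial_ode n u2 q2 w2"
  shows "radial_ode n (\<lambda>r. u1 r + c * u2 r) (\<lambda>r. q1 r + c * q2 r) (\<lambda>r. w1 r + c * w2 r)"
proof -
  note 1 = radial_odeD[OF assms(1)] and 2 = radial_odeD[OF assms(2)]
  show ?thesis unfolding radial_ode_def
  proof (intro conjI allI impI)
    fix r :: real assume "r \<ge> 0"
    then show "((\<lambda>r. u1 r + c * u2 r) has_real_derivative r * (q1 r + c * q2 r)) (at r within {0..})"
      by (auto intro!: derivative_eq_intros 1(4) 2(4) simp: algebra_simps)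
  next
    fix r :: real assume "r > 0"
    then show "((\<lambda>r. q1 r + c * q2 r) has_real_derivative
        (- (w1 r + c * w2 r) - real n * (q1 r + c * q2 r)) / r) (at r)"
      by (auto intro!: derivative_eq_intros 1(5) 2(5) simp: field_simps)
  qed (auto intro!: continuous_intros 1(1,2) 2(1,2) simp: 1(3) 2(3) add_divide_distrib diff_divide_distrib)
qed

lemma radial_ode_const:
  assumes "n > 0"
  shows "radial_ode n (\<lambda>_. c) (\<lambda>_. 0) (\<lambda>_. 0)"
  unfolding radial_ode_def by auto

text \<open>Scaling turns a zero \<open>k\<close> of \<open>q\<close> into the boundary condition at
  1; the factor \<open>k\<^sup>2\<close> on the right-hand side then becomes the eigenvalue.\<close>

lemma radial_ode_rescale:
  assumes "radial_ode n u q w" "k > 0"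
  shows "radial_ode n (\<lambda>r. u (k * r)) (\<lambda>r. k\<^sup>2 * q (k * r)) (\<lambda>r. k\<^sup>2 * w (k * r))"
proof -
  note 1 = radial_odeD[OF assms(1)]
  have c: "continuous_on {0..} (\<lambda>r. k\<^sup>2 * F (k * r))" if "continuous_on {0..} F" for F :: "real \<Rightarrow> real"
    using assms(2) by (intro continuous_intros continuous_on_compose2[OF that]) auto
  show ?thesis unfolding radial_ode_def
  proof (intro conjI allI impI)
    fix r :: real assume r: "r \<ge> 0"
    have "((\<lambda>r. k * r) has_real_derivative k) (at r within {0..})"
      by (auto intro!: derivative_eq_intros)
    moreover have "(u has_real_derivative k * r * q (k * r)) (at (k * r) within (\<lambda>r. k * r) ` {0..})"
      using 1(4)[of "k * r"] r assms(2) by (intro DERIV_subset[OF 1(4)]) auto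
    ultimately have "((u \<circ> (\<lambda>r. k * r)) has_real_derivative k * r * q (k * r) * k) (at r within {0..})"
      by (rule DERIV_image_chain[rotated])
    then show "((\<lambda>r. u (k * r)) has_real_derivative r * (k\<^sup>2 * q (k * r))) (at r within {0..})"
      by (simp add: o_def power2_eq_square algebra_simps)
  next
    fix r :: real assume r: "r > 0"
    have "((\<lambda>r. q (k * r)) has_real_derivative (- w (k * r) - real n * q (k * r)) / (k * r) * k) (at r)"
      using r assms(2) by (intro DERIV_chain2[where f=q] 1(5)) (auto intro!: derivative_eq_intros)
    then show "((\<lambda>r. k\<^sup>2 * q (k * r)) has_real_derivative
        (- (k\<^sup>2 * w (k * r)) - real n * (k\<^sup>2 * q (k * r))) / r) (at r)"
      using r assms(2)
      by (auto intro!: derivative_eq_intros simp: field_simps power2_eq_square)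
  qed (use c 1(1,2,3) in \<open>auto\<close>)
qed

text \<open>\<open>r ^ n * q r\<close> is \<open>r ^ (n - 1) * u' r\<close>: this is the divergence
  form of the equation, without a first-order term. Signs of \<open>w\<close> become monotonicity of
  a flux that vanishes at 0.\<close>

lemma radial_ode_flux:
  assumes "radial_ode n u q w" "n > 0" "r > 0"
  shows "((\<lambda>r. r ^ n * q r) has_real_derivative - (r ^ (n - 1) * w r)) (at r)"
proof -
  have "((\<lambda>r. r ^ n * q r) has_real_derivative
      real n * r ^ (n - 1) * q r + (- w r - real n * q r) / r * r ^ n) (at r)"
    using DERIV_mult'[OF DERIV_pow[of n r UNIV] radial_odeD(5)[OF assms(1,3)]] by (simp add: mult.commute add.commute)
  moreover have "r ^ n = r * r ^ (n - 1)" using assms(2) by (metis power_eq_if neq0_conv)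
  ultimately show ?thesis using assms(3) by (simp add: field_simps)
qed

text \<open>Comparison with the constant source \<open>A\<close>, whose solution has
  \<open>q = - A / n\<close>: the difference of the two fluxes vanishes at 0 and is
  nondecreasing.\<close>

lemma radial_ode_lower_bound:
  assumes ode: "radial_ode n u q w" and n: "n > 0"
    and w: "\<And>t. 0 \<le> t \<Longrightarrow> t \<le> r \<Longrightarrow> w t \<le> A" and r: "r \<ge> 0"
  shows "q r \<ge> - A / real n"
proof (cases "r = 0")
  case True
  then show ?thesis using radial_odeD(3)[OF ode] w[of 0] by (auto simp: divide_right_mono)
next
  case False
  with r have r: "r > 0" by simp
  define h where "h t = t ^ n * q t + A / real n * t ^ n" for t
  have "h 0 \<le> h r"
  proof (rule DERIV_nonneg_imp_increasing_open[where f=h])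
    show "continuous_on {0..r} h" unfolding h_def
      by (intro continuous_intros continuous_on_subset[OF radial_odeD(1)[OF ode]]) auto
    fix t assume t: "0 < t" "t < r"
    have "(h has_real_derivative - (t ^ (n - 1) * w t) + A / real n * (real n * t ^ (n - 1))) (at t)"
      unfolding h_def using n t
      by (intro DERIV_add radial_ode_flux[OF ode] DERIV_cmult) (auto intro!: derivative_eq_intros)
    then have "(h has_real_derivative t ^ (n - 1) * (A - w t)) (at t)"
      using n by (simp add: algebra_simps)
    moreover have "t ^ (n - 1) * (A - w t) \<ge> 0" using w[of t] t by auto
    ultimately show "\<exists>y. (h has_real_derivative y) (at t) \<and> 0 \<le> y" by blast
  qed (use r in auto)
  then have "0 \<le> r ^ n * (q r + A / real n)" using n by (auto simp: h_def zero_power algebra_simps)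
  then have "q r + A / real n \<ge> 0" using zero_less_power[OF r, of n] by (simp add: zero_le_mult_iff not_le)
  then show ?thesis by simp
qed

lemma radial_ode_uminus:
  assumes "radial_ode n u q w" "n > 0"
  shows "radial_ode n (\<lambda>r. - u r) (\<lambda>r. - q r) (\<lambda>r. - w r)"
  using radial_ode_add_scaled[OF radial_ode_const[OF assms(2), of 0] assms(1), of "-1"] by simp

lemma radial_ode_abs_bound:
  assumes ode: "radial_ode n u q w" and n: "n > 0"
    and w: "\<And>t. 0 \<le> t \<Longrightarrow> t \<le> r \<Longrightarrow> \<bar>w t\<bar> \<le> A" and r: "r \<ge> 0"
  shows "\<bar>q r\<bar> \<le> A / real n"
proof -
  have "q r \<ge> - A / real n"
    using w by (intro radial_ode_lower_bound[OF ode n _ r]) (auto simp: abs_le_iff)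
  moreover have "- q r \<ge> - A / real n"
    using w by (intro radial_ode_lower_bound[OF radial_ode_uminus[OF ode n] n _ r]) (auto simp: abs_le_iff)
  ultimately show ?thesis by auto
qed

text \<open>Strictness comes from compactness: the maximum of \<open>w\<close> on [0, r] is still
  negative and can be taken as the constant source.\<close>

lemma radial_ode_pos:
  assumes ode: "radial_ode n u q w" and n: "n > 0"
    and w: "\<And>t. 0 \<le> t \<Longrightarrow> t \<le> r \<Longrightarrow> w t < 0" and r: "r \<ge> 0"
  shows "q r > 0"
proof -
  have "continuous_on {0..r} w" by (rule continuous_on_subset[OF radial_odeD(2)[OF ode]]) auto
  then obtain s where s: "s \<in> {0..r}" "\<And>t. t \<in> {0..r} \<Longrightarrow> w t \<le> w s"
    using continuous_attains_sup[of "{0..r}" w] r by auto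
  have "q r \<ge> - w s / real n" using s by (intro radial_ode_lower_bound[OF ode n _ r]) auto
  moreover have "- w s / real n > 0" using w[of s] s n by (auto simp: divide_neg_pos)
  ultimately show ?thesis by linarith
qed

section \<open>Energy estimates: growth and uniqueness\<close>

lemma radial_ode_energy_deriv:
  assumes ode: "radial_ode n u q w" and r: "r > 0"
  shows "((\<lambda>r. (u r)\<^sup>2 + (r * q r)\<^sup>2) has_real_derivative
     2 * u r * (r * q r) + 2 * (1 - real n) * r * (q r)\<^sup>2 - 2 * (r * q r) * w r) (at r)"
  using r by (auto intro!: derivative_eq_intros radial_odeD(5,6)[OF ode] simp: field_simps power2_eq_square)

lemma abs_prod_le_sum_squares:
  fixes a p w K :: real
  assumes "\<bar>w\<bar> \<le> K * \<bar>a\<bar>" "K \<ge> 0"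
  shows "\<bar>2 * a * p - 2 * p * w\<bar> \<le> (1 + K) * (a\<^sup>2 + p\<^sup>2)"
proof -
  have "\<bar>2 * a * p - 2 * p * w\<bar> = \<bar>2 * p * (a - w)\<bar>" by (simp add: algebra_simps)
  also have "\<dots> = 2 * \<bar>p\<bar> * \<bar>a - w\<bar>" by (simp add: abs_mult)
  also have "\<dots> \<le> 2 * \<bar>p\<bar> * ((1 + K) * \<bar>a\<bar>)"
    using assms by (intro mult_left_mono) (auto simp: algebra_simps intro: order_trans[OF abs_triangle_ineq4])
  also have "\<dots> = (1 + K) * (2 * \<bar>a\<bar> * \<bar>p\<bar>)" by simp
  also have "\<dots> \<le> (1 + K) * (a\<^sup>2 + p\<^sup>2)"
    using assms(2) sum_squares_bound[of "\<bar>a\<bar>" "\<bar>p\<bar>"] by (intro mult_left_mono) auto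
  finally show ?thesis .
qed

lemma radial_ode_growth:
  assumes ode: "radial_ode n u q w" and n: "n > 0"
    and w: "\<And>t. 0 \<le> t \<Longrightarrow> t \<le> r \<Longrightarrow> \<bar>w t\<bar> \<le> K * \<bar>u t\<bar>" and r: "r \<ge> 0" and K: "K \<ge> 0"
  shows "\<bar>u r\<bar> \<le> \<bar>u 0\<bar> * exp ((1 + K) * r)"
proof -
  define E where "E t = (u t)\<^sup>2 + (t * q t)\<^sup>2" for t
  have "E 0 * exp (- ((1 + K) * 0)) \<ge> E r * exp (- ((1 + K) * r))"
  proof (rule DERIV_nonpos_imp_decreasing_open[OF r])
    show "continuous_on {0..r} (\<lambda>t. E t * exp (- ((1 + K) * t)))" unfolding E_def
      by (intro continuous_intros continuous_on_subset[OF radial_odeD(1)[OF ode]]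
         continuous_on_subset[OF radial_odeD(7)[OF ode]]) auto
    fix t assume t: "0 < t" "t < r"
    define D where "D = 2 * u t * (t * q t) + 2 * (1 - real n) * t * (q t)\<^sup>2 - 2 * (t * q t) * w t"
    have "((\<lambda>t. E t * exp (- ((1 + K) * t))) has_real_derivative
       (D - (1 + K) * E t) * exp (- ((1 + K) * t))) (at t)"
      using radial_ode_energy_deriv[OF ode t(1)] unfolding E_def[symmetric] D_def[symmetric]
      by (auto intro!: derivative_eq_intros simp: algebra_simps)
    moreover have "D \<le> (1 + K) * E t"
    proof -
      have "2 * (real n - 1) * t * (q t)\<^sup>2 \<ge> 0"
        using n t by (intro mult_nonneg_nonneg) auto
      then have "2 * (1 - real n) * t * (q t)\<^sup>2 \<le> 0" by (simp add: algebra_simps)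
      moreover have "2 * u t * (t * q t) - 2 * (t * q t) * w t \<le> (1 + K) * E t"
        unfolding E_def using abs_prod_le_sum_squares[OF w[of t] K, of "t * q t"] t by linarith
      ultimately show ?thesis unfolding D_def by linarith
    qed
    ultimately show "\<exists>y. ((\<lambda>t. E t * exp (- ((1 + K) * t))) has_real_derivative y) (at t) \<and> y \<le> 0"
      by (meson diff_le_0_iff_le exp_ge_zero mult_nonpos_nonneg)
  qed
  then have "E r \<le> (u 0)\<^sup>2 * exp ((1 + K) * r)"
    by (simp add: E_def exp_minus pos_divide_le_eq flip: divide_inverse)
  then have "(u r)\<^sup>2 \<le> (u 0)\<^sup>2 * exp ((1 + K) * r)"
    using zero_le_power2[of "r * q r"] unfolding E_def by linarith
  \<comment> \<open>The exponential is squared only to make the right-hand side a perfect square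
    before roots are taken.\<close>
  also have "\<dots> \<le> (u 0)\<^sup>2 * (exp ((1 + K) * r))\<^sup>2"
    using r K by (intro mult_left_mono) (auto simp: power2_eq_square)
  finally have "(u r)\<^sup>2 \<le> (\<bar>u 0\<bar> * exp ((1 + K) * r))\<^sup>2" by (simp add: power_mult_distrib)
  then show ?thesis by (metis abs_le_square_iff abs_of_nonneg abs_ge_zero exp_ge_zero mult_nonneg_nonneg)
qed

text \<open>Going inward, the damping term has the wrong sign and a coefficient of order 1 / r.
  Gronwall still works on [e, r] with a constant depending on \<open>e\<close>, which gives
  \<open>q = 0\<close> on (0, r); the value at 0 follows by continuity.\<close>

lemma radial_ode_backward_unique:
  assumes ode: "radial_ode n u q w" and n: "n > 0"
    and w: "\<And>t. 0 \<le> t \<Longrightarrow> t \<le> r \<Longrightarrow> \<bar>w t\<bar> \<le> K * \<bar>u t\<bar>" and K: "K \<ge> 0"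
    and r: "r > 0" and z: "u r = 0" "q r = 0"
  shows "q 0 = 0"
proof -
  define E where "E t = (u t)\<^sup>2 + (t * q t)\<^sup>2" for t
  have q0: "q e = 0" if e: "0 < e" "e < r" for e
  proof -
    define C where "C = 1 + K + 2 * real n / e"
    have "E e * exp (C * e) \<le> E r * exp (C * r)"
    proof (rule DERIV_nonneg_imp_increasing_open[where f="\<lambda>t. E t * exp (C * t)"])
      show "continuous_on {e..r} (\<lambda>t. E t * exp (C * t))" unfolding E_def
        using e
        by (intro continuous_intros continuous_on_subset[OF radial_odeD(1)[OF ode]]
         continuous_on_subset[OF radial_odeD(7)[OF ode]]) auto
      fix t assume t: "e < t" "t < r"
      then have t0: "t > 0" using e by simp
      define D where "D = 2 * u t * (t * q t) + 2 * (1 - real n) * t * (q t)\<^sup>2 - 2 * (t * q t) * w t"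
      have "((\<lambda>t. E t * exp (C * t)) has_real_derivative (D + C * E t) * exp (C * t)) (at t)"
        using radial_ode_energy_deriv[OF ode t0] unfolding E_def[symmetric] D_def[symmetric]
        by (auto intro!: derivative_eq_intros simp: algebra_simps)
      moreover have "D + C * E t \<ge> 0"
      proof -
        have "2 * (1 - real n) * t * (q t)\<^sup>2 \<ge> - (2 * real n / t * (t * q t)\<^sup>2)"
          using t0 by (auto simp: field_simps power2_eq_square)
        moreover have "2 * real n / t * (t * q t)\<^sup>2 \<le> 2 * real n / e * E t"
          using t e by (intro mult_mono divide_left_mono) (auto simp: E_def)
        moreover have "2 * u t * (t * q t) - 2 * (t * q t) * w t \<ge> - ((1 + K) * E t)"
          unfolding E_def using abs_prod_le_sum_squares[OF w[of t] K, of "t * q t"] t t0 by linarith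
        ultimately show ?thesis unfolding D_def C_def by (simp add: algebra_simps)
      qed
      ultimately show "\<exists>y. ((\<lambda>t. E t * exp (C * t)) has_real_derivative y) (at t) \<and> 0 \<le> y"
        by (meson exp_ge_zero mult_nonneg_nonneg)
    qed (use e in auto)
    then have "E e \<le> 0" using z by (simp add: E_def mult_le_0_iff)
    then have "(e * q e)\<^sup>2 = 0" unfolding E_def
      by (metis add_nonneg_eq_0_iff add_nonneg_nonneg antisym zero_le_power2)
    then show ?thesis using e by simp
  qed
  have "(q \<longlongrightarrow> q 0) (at 0 within {0..})"
    using radial_odeD(1)[OF ode] by (simp add: continuous_on_def)
  then have "(q \<longlongrightarrow> q 0) (at_right 0)" by (rule tendsto_within_subset) auto
  moreover have "\<forall>\<^sub>F x in at_right 0. q x = 0"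
    using r q0 by (auto simp: eventually_at_right)
  ultimately have "((\<lambda>_. 0) \<longlongrightarrow> q 0) (at_right (0::real))"
    by (rule Lim_transform_eventually)
  then show ?thesis by (simp add: tendsto_const_iff)
qed


section \<open>The initial value problem\<close>

text \<open>This is minus the integral of \<open>s ^ (n - 1) * w s\<close> over [0, t], divided by
  \<open>t ^ n\<close>, after substituting \<open>t * s\<close> for \<open>s\<close>. In this form
  nothing is divided by \<open>t\<close>, and continuity at 0 is visible.\<close>

definition radial_flux :: "nat \<Rightarrow> (real \<Rightarrow> real) \<Rightarrow> real \<Rightarrow> real" where
  "radial_flux n w t = - integral {0..1} (\<lambda>s. s ^ (n - 1) * w (t * s))"

definition radial_potential :: "nat \<Rightarrow> (real \<Rightarrow> real) \<Rightarrow> real \<Rightarrow> real" where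
  "radial_potential n w r = integral {0..r} (\<lambda>t. t * radial_flux n w t)"

lemma integrable_radial_flux:
  assumes "continuous_on UNIV w"
  shows "(\<lambda>s. s ^ (n - 1) * w (t * s)) integrable_on {0..1::real}"
  by (intro integrable_continuous_interval continuous_intros continuous_on_compose2[OF assms]) auto

lemma continuous_radial_flux:
  assumes "continuous_on UNIV w"
  shows "continuous_on UNIV (radial_flux n w)"
proof -
  have "continuous_on UNIV (\<lambda>t. integral (cbox 0 1) (\<lambda>s::real. s ^ (n - 1) * w (t * s)))"
    unfolding case_prod_beta
    by (intro integral_continuous_on_param[where f="\<lambda>t s. s ^ (n - 1) * w (t * s)"])
      (auto simp: case_prod_beta intro!: continuous_intros continuous_on_compose2[OF assms])
  then show ?thesis unfolding radial_flux_def by (auto intro!: continuous_intros)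
qed

text \<open>Undoing the substitution for positive \<open>t\<close> exposes an integral with variable
  upper limit, which the fundamental theorem can differentiate.\<close>

lemma radial_flux_eq:
  assumes w: "continuous_on UNIV w" and t: "t > 0" and n: "n > 0"
  shows "t ^ n * radial_flux n w t = - integral {0..t} (\<lambda>s. s ^ (n - 1) * w s)"
proof -
  define F where "F x = integral {0..x} (\<lambda>s. s ^ (n - 1) * w s)" for x
  have F: "(F has_real_derivative x ^ (n - 1) * w x) (at x within {0..t})" if "x \<in> {0..t}" for x
    unfolding F_def has_real_derivative_iff_has_vector_derivative
    by (rule integral_has_vector_derivative[OF _ that])
      (intro continuous_intros continuous_on_subset[OF w], auto)
  have "((\<lambda>s. t ^ n * (s ^ (n - 1) * w (t * s))) has_integral (F (t * 1) - F (t * 0))) {0..1}"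
  proof (rule fundamental_theorem_of_calculus[where f="\<lambda>s. F (t * s)"])
    fix s :: real assume s: "s \<in> {0..1}"
    have "((\<lambda>s. t * s) has_real_derivative t) (at s within {0..1})"
      by (auto intro!: derivative_eq_intros)
    moreover have "(F has_real_derivative (t * s) ^ (n - 1) * w (t * s)) (at (t * s) within (\<lambda>s. t * s) ` {0..1})"
      using s t by (intro DERIV_subset[OF F]) (auto simp: mult_left_le)
    ultimately have "((F \<circ> (\<lambda>s. t * s)) has_real_derivative (t * s) ^ (n - 1) * w (t * s) * t) (at s within {0..1})"
      by (rule DERIV_image_chain[rotated])
    moreover have "(t * s) ^ (n - 1) * w (t * s) * t = t ^ n * (s ^ (n - 1) * w (t * s))"
      using n by (cases n) (auto simp: power_mult_distrib)
    ultimately show "((\<lambda>s. F (t * s)) has_vector_derivative t ^ n * (s ^ (n - 1) * w (t * s))) (at s within {0..1})"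
      by (simp only: o_def has_real_derivative_iff_has_vector_derivative)
  qed auto
  moreover have "((\<lambda>s. t ^ n * (s ^ (n - 1) * w (t * s))) has_integral t ^ n * integral {0..1} (\<lambda>s. s ^ (n - 1) * w (t * s))) {0..1}"
    by (intro has_integral_mult_right integrable_integral integrable_radial_flux[OF w])
  ultimately have "F (t * 1) - F (t * 0) = t ^ n * integral {0..1} (\<lambda>s. s ^ (n - 1) * w (t * s))"
    by (rule has_integral_unique)
  then show ?thesis by (simp add: radial_flux_def F_def)
qed

lemma radial_ode_potential:
  assumes w: "continuous_on UNIV w" and n: "n > 0"
  shows "radial_ode n (\<lambda>r. d + radial_potential n w r) (radial_flux n w) w"
  unfolding radial_ode_def
proof (intro conjI allI impI)
  note c = continuous_radial_flux[OF w, of n]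
  show "continuous_on {0..} (radial_flux n w)" "continuous_on {0..} w"
    by (auto intro: continuous_on_subset[OF c] continuous_on_subset[OF w])
  have "((\<lambda>s::real. s ^ (n - 1)) has_integral (1 ^ n / real n - 0 ^ n / real n)) {0..1}"
    using n by (intro fundamental_theorem_of_calculus)
      (auto intro!: derivative_eq_intros simp: has_real_derivative_iff_has_vector_derivative[symmetric])
  then have "integral {0..1} (\<lambda>s::real. s ^ (n - 1)) = 1 / real n"
    using n by (auto simp: zero_power)
  then show "radial_flux n w 0 = - w 0 / real n"
    by (simp add: radial_flux_def)
  fix r :: real
  {
    assume r: "r \<ge> 0"
    have "((\<lambda>x. integral {0..x} (\<lambda>t. t * radial_flux n w t)) has_vector_derivative r * radial_flux n w r)
       (at r within {0..r + 1})"
      using r by (intro integral_has_vector_derivative continuous_intros continuous_on_subset[OF c]) auto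
    then have "(radial_potential n w has_real_derivative r * radial_flux n w r) (at r within {0..r + 1})"
      unfolding radial_potential_def has_real_derivative_iff_has_vector_derivative .
    moreover have "at r within {0..r + 1} = at r within {0..}"
      by (rule at_within_nhd[of _ "{..<r + 1}"]) auto
    ultimately show "((\<lambda>r. d + radial_potential n w r) has_real_derivative r * radial_flux n w r) (at r within {0..})"
      by (auto intro!: derivative_eq_intros)
  next
    assume r: "r > 0"
    define F where "F x = integral {0..x} (\<lambda>s. s ^ (n - 1) * w s)" for x
    have "(F has_real_derivative r ^ (n - 1) * w r) (at r within {0..r + 1})"
      unfolding F_def has_real_derivative_iff_has_vector_derivative
      using r by (intro integral_has_vector_derivative continuous_intros continuous_on_subset[OF w]) auto
    then have F: "(F has_real_derivative r ^ (n - 1) * w r) (at r)"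
      using r by (simp add: at_within_interior[of r "{0..r + 1}"])
    have eq: "radial_flux n w x = - F x / x ^ n" if "x > 0" for x
      using radial_flux_eq[OF w that n] that by (simp add: F_def field_simps)
    have m: "r ^ n = r * r ^ (n - 1)" using n by (metis power_eq_if neq0_conv)
    have "((\<lambda>x. - F x / x ^ n) has_real_derivative
        (- (r ^ (n - 1) * w r) * r ^ n - (- F r) * (real n * r ^ (n - 1))) / (r ^ n * r ^ n)) (at r)"
      using r by (intro DERIV_divide DERIV_minus F) (auto intro!: derivative_eq_intros)
    moreover have "(- (r ^ (n - 1) * w r) * r ^ n - (- F r) * (real n * r ^ (n - 1))) / (r ^ n * r ^ n)
        = (- w r - real n * radial_flux n w r) / r"
      using r unfolding eq[OF r] m by (simp add: field_simps)
    ultimately have "((\<lambda>x. - F x / x ^ n) has_real_derivative (- w r - real n * radial_flux n w r) / r) (at r)"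
      by simp
    then show "(radial_flux n w has_real_derivative (- w r - real n * radial_flux n w r) / r) (at r)"
      by (rule has_field_derivative_transform_within_open[of _ _ _ "{0<..}"]) (use r eq in auto)
  }
qed

text \<open>The reason for a Gaussian weight: the factor \<open>t\<close> in the potential is, up to
  \<open>2 * K\<close>, the derivative of the exponent, so the weight reproduces itself and a factor
  \<open>1 / (2 * K)\<close> is gained.\<close>

lemma radial_potential_bound:
  assumes w: "continuous_on UNIV w" and r: "r \<ge> 0" and K: "K > 0"
    and b: "\<And>t. t \<ge> 0 \<Longrightarrow> \<bar>w t\<bar> \<le> A * exp (K * t\<^sup>2)"
  shows "\<bar>radial_potential n w r\<bar> \<le> A / (2 * K) * exp (K * r\<^sup>2)"
proof -
  have A: "A \<ge> 0" using b[of 0] by simp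
  have q: "\<bar>radial_flux n w t\<bar> \<le> A * exp (K * t\<^sup>2)" if "t \<ge> 0" for t
  proof -
    have "norm (integral {0..1} (\<lambda>s. s ^ (n - 1) * w (t * s))) \<le> integral {0..1} (\<lambda>s::real. A * exp (K * t\<^sup>2))"
    proof (rule integral_norm_bound_integral[OF integrable_radial_flux[OF w]])
      fix s :: real assume s: "s \<in> {0..1}"
      have "\<bar>s ^ (n - 1)\<bar> * \<bar>w (t * s)\<bar> \<le> 1 * (A * exp (K * (t * s)\<^sup>2))"
        using s that b[of "t * s"] by (intro mult_mono) (auto simp: power_le_one)
      also have "\<dots> \<le> A * exp (K * t\<^sup>2)"
        using s A that K by (auto intro!: mult_left_mono power_mono simp: mult_left_le)
      finally show "norm (s ^ (n - 1) * w (t * s)) \<le> A * exp (K * t\<^sup>2)" by (simp add: abs_mult)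
    qed auto
    then show ?thesis by (simp add: radial_flux_def)
  qed
  have I: "((\<lambda>t. t * (A * exp (K * t\<^sup>2))) has_integral
      (A / (2 * K) * exp (K * r\<^sup>2) - A / (2 * K) * exp (K * 0\<^sup>2))) {0..r}"
    using r K
    by (intro fundamental_theorem_of_calculus)
      (auto intro!: derivative_eq_intros simp: has_real_derivative_iff_has_vector_derivative[symmetric] field_simps)
  have "norm (integral {0..r} (\<lambda>t. t * radial_flux n w t)) \<le> integral {0..r} (\<lambda>t. t * (A * exp (K * t\<^sup>2)))"
  proof (rule integral_norm_bound_integral)
    show "(\<lambda>t. t * radial_flux n w t) integrable_on {0..r}"
      by (intro integrable_continuous_interval continuous_intros continuous_on_subset[OF continuous_radial_flux[OF w]]) auto
    show "(\<lambda>t. t * (A * exp (K * t\<^sup>2))) integrable_on {0..r}"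
      using I by blast
    fix t assume "t \<in> {0..r}"
    then show "norm (t * radial_flux n w t) \<le> t * (A * exp (K * t\<^sup>2))"
      using q[of t] by (auto simp: abs_mult intro!: mult_left_mono)
  qed
  also have "\<dots> \<le> A / (2 * K) * exp (K * r\<^sup>2)"
    using A K by (subst integral_unique[OF I]) auto
  finally show ?thesis by (simp add: radial_potential_def)
qed

lemma radial_potential_diff:
  assumes v: "continuous_on UNIV v" and w: "continuous_on UNIV w"
  shows "radial_potential n v r - radial_potential n w r = radial_potential n (\<lambda>t. v t - w t) r"
proof -
  have f: "radial_flux n v t - radial_flux n w t = radial_flux n (\<lambda>t. v t - w t) t" for t
    using Henstock_Kurzweil_Integration.integral_diff[OF integrable_radial_flux[OF v, of n t] integrable_radial_flux[OF w, of n t]]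
    by (simp add: radial_flux_def algebra_simps)
  have i: "(\<lambda>t. t * radial_flux n x t) integrable_on {0..r}" if "continuous_on UNIV x" for x
    by (intro integrable_continuous_interval continuous_intros continuous_on_subset[OF continuous_radial_flux[OF that]]) auto
  show ?thesis unfolding radial_potential_def f[symmetric]
    using Henstock_Kurzweil_Integration.integral_diff[OF i[OF v] i[OF w]] by (simp add: algebra_simps)
qed

text \<open>Banach's fixed point theorem for the integral form of the equation, in the weighted norm
  \<open>sup \<bar>u r\<bar> exp (- K r\<^sup>2)\<close>.\<close>

lemma radial_ivp:
  fixes f h :: "real \<Rightarrow> real"
  assumes lip: "\<And>x y. \<bar>f x - f y\<bar> \<le> L * \<bar>x - y\<bar>" and n: "n > 0"
    and h: "continuous_on UNIV h" "\<And>x. \<bar>h x\<bar> \<le> H"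
  obtains u q where "radial_ode n u q (\<lambda>r. f (u r) - h r)" "u 0 = d"
proof -
  have L: "L \<ge> 0" using lip[of 0 1] by (simp add: order_trans[OF abs_ge_zero])
  \<comment> \<open>With this choice the contraction factor \<open>L / (2 * K)\<close> is at most 1
    / 2.\<close>
  define K where "K = L + 1"
  have K: "K > 0" using L by (simp add: K_def)
  have f: "continuous_on UNIV f"
    by (rule lipschitz_on_continuous_on[of L]) (auto simp: lipschitz_on_def dist_real_def L lip)
  \<comment> \<open>\<open>v\<close> is the weighted unknown
    \<open>exp (- K * r\<^sup>2) * u r\<close>, so the weighted norm becomes the sup norm of bounded
    continuous functions.\<close>
  define W where "W v t = f (exp (K * t\<^sup>2) * apply_bcontfun v t) - h t" for v :: "real \<Rightarrow>\<^sub>C real" and t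
  have Wc: "continuous_on UNIV (W v)" for v
    unfolding W_def by (intro continuous_intros continuous_on_compose2[OF f] h) (auto intro!: continuous_intros)
  \<comment> \<open>Bounded continuous functions live on the whole line; \<open>max 0 r\<close>
    extends the values constantly to negative radii.\<close>
  define S where "S v r = exp (- (K * (max 0 r)\<^sup>2)) * (d + radial_potential n (W v) (max 0 r))" for v r
  have Sb: "S v \<in> bcontfun" for v
  proof -
    obtain B where B: "\<And>x. norm (apply_bcontfun v x) \<le> B"
      using bounded_apply_bcontfun[of v] by (auto simp: bounded_iff)
    have B0: "B \<ge> 0" using B[of 0] by (rule order_trans[OF norm_ge_zero])
    define A where "A = \<bar>f 0\<bar> + L * B + H"
    have H0: "H \<ge> 0" using h(2)[of 0] by (rule order_trans[OF abs_ge_zero])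
    have "\<bar>W v t\<bar> \<le> A * exp (K * t\<^sup>2)" for t
    proof -
      have "\<bar>W v t\<bar> \<le> \<bar>f (exp (K * t\<^sup>2) * apply_bcontfun v t) - f 0\<bar> + \<bar>f 0\<bar> + H"
        unfolding W_def using h(2)[of t] by linarith
      also have "\<dots> \<le> L * (exp (K * t\<^sup>2) * B) + \<bar>f 0\<bar> + H"
      proof -
        have "\<bar>f (exp (K * t\<^sup>2) * apply_bcontfun v t) - f 0\<bar> \<le> L * (exp (K * t\<^sup>2) * \<bar>apply_bcontfun v t\<bar>)"
          using lip[of "exp (K * t\<^sup>2) * apply_bcontfun v t" 0] by (simp add: abs_mult)
        also have "\<dots> \<le> L * (exp (K * t\<^sup>2) * B)"
          using B[of t] L by (intro mult_left_mono) auto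
        finally show ?thesis by simp
      qed
      also have "\<dots> \<le> L * (exp (K * t\<^sup>2) * B) + (\<bar>f 0\<bar> + H) * exp (K * t\<^sup>2)"
        using H0 K mult_left_mono[of 1 "exp (K * t\<^sup>2)" "\<bar>f 0\<bar> + H"] by auto
      finally show ?thesis by (simp add: A_def algebra_simps)
    qed
    then have P: "\<bar>radial_potential n (W v) r\<bar> \<le> A / (2 * K) * exp (K * r\<^sup>2)" if "r \<ge> 0" for r
      using that by (intro radial_potential_bound[OF Wc _ K]) auto
    have "norm (S v r) \<le> \<bar>d\<bar> + A / (2 * K)" for r
    proof -
      define x where "x = max 0 r"
      have "\<bar>S v r\<bar> = exp (- (K * x\<^sup>2)) * \<bar>d + radial_potential n (W v) x\<bar>"
        by (simp add: S_def x_def abs_mult)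
      also have "\<dots> \<le> exp (- (K * x\<^sup>2)) * (\<bar>d\<bar> + A / (2 * K) * exp (K * x\<^sup>2))"
        using P[of x] by (intro mult_left_mono) (auto simp: x_def)
      also have "\<dots> = exp (- (K * x\<^sup>2)) * \<bar>d\<bar> + A / (2 * K)"
        by (simp add: algebra_simps flip: exp_add)
      also have "\<dots> \<le> \<bar>d\<bar> + A / (2 * K)" using K mult_right_mono[of "exp (- (K * x\<^sup>2))" 1 "\<bar>d\<bar>"] by auto
      finally show ?thesis by simp
    qed
    moreover have "continuous_on UNIV (S v)"
      unfolding S_def
      by (intro continuous_intros continuous_on_compose2[OF radial_odeD(7)[OF radial_ode_potential[OF Wc n, of d v]]]) auto
    ultimately show ?thesis
      by (auto simp: bcontfun_def bounded_iff)
  qed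
  define T where "T v = Bcontfun (S v)" for v
  have T: "apply_bcontfun (T v) = S v" for v
    unfolding T_def using Sb by (rule Bcontfun_inverse)
  have contr: "dist (T v1) (T v2) \<le> 1 / 2 * dist v1 v2" for v1 v2
  proof (rule dist_bound)
    fix r :: real
    define x where "x = max 0 r"
    have "\<bar>W v1 t - W v2 t\<bar> \<le> L * dist v1 v2 * exp (K * t\<^sup>2)" for t
    proof -
      have "\<bar>W v1 t - W v2 t\<bar> \<le> L * (exp (K * t\<^sup>2) * \<bar>apply_bcontfun v1 t - apply_bcontfun v2 t\<bar>)"
        unfolding W_def using lip[of "exp (K * t\<^sup>2) * apply_bcontfun v1 t" "exp (K * t\<^sup>2) * apply_bcontfun v2 t"]
        by (simp add: abs_mult flip: right_diff_distrib)
      also have "\<dots> \<le> L * (exp (K * t\<^sup>2) * dist v1 v2)"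
        using dist_bounded[of v1 t v2] L by (intro mult_left_mono) (auto simp: dist_real_def)
      finally show ?thesis by (simp add: algebra_simps)
    qed
    then have "\<bar>radial_potential n (\<lambda>t. W v1 t - W v2 t) x\<bar> \<le> L * dist v1 v2 / (2 * K) * exp (K * x\<^sup>2)"
      by (intro radial_potential_bound[OF _ _ K]) (auto intro!: continuous_intros Wc simp: x_def)
    then have "exp (- (K * x\<^sup>2)) * \<bar>radial_potential n (\<lambda>t. W v1 t - W v2 t) x\<bar>
        \<le> exp (- (K * x\<^sup>2)) * (L * dist v1 v2 / (2 * K) * exp (K * x\<^sup>2))"
      by (intro mult_left_mono) auto
    also have "\<dots> = L * dist v1 v2 / (2 * K)" by (simp add: algebra_simps flip: exp_add)
    also have "\<dots> \<le> 1 / 2 * dist v1 v2"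
      using L by (simp add: K_def field_simps)
    finally have "exp (- (K * x\<^sup>2)) * \<bar>radial_potential n (W v1) x - radial_potential n (W v2) x\<bar>
        \<le> 1 / 2 * dist v1 v2"
      by (simp only: radial_potential_diff[OF Wc Wc])
    moreover have "S v1 r - S v2 r
        = exp (- (K * x\<^sup>2)) * (radial_potential n (W v1) x - radial_potential n (W v2) x)"
      unfolding S_def x_def[symmetric] by (simp add: algebra_simps)
    ultimately show "dist (apply_bcontfun (T v1) r) (apply_bcontfun (T v2) r) \<le> 1 / 2 * dist v1 v2"
      unfolding T dist_real_def by (simp only: abs_mult abs_exp_cancel)
  qed
  have "\<exists>!v. T v = v"
    by (rule banach_fix_type[where c="1/2"]) (use contr in auto)
  then obtain v where v: "T v = v" by blast
  define u where "u r = d + radial_potential n (W v) r" for r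
  have "W v r = f (u r) - h r" if "r \<ge> 0" for r
  proof -
    have "apply_bcontfun v r = exp (- (K * r\<^sup>2)) * u r"
      using T[of v] that by (simp add: v S_def u_def max_def)
    then have "exp (K * r\<^sup>2) * apply_bcontfun v r = u r"
      by (simp add: exp_minus)
    then show ?thesis by (simp add: W_def)
  qed
  then have "radial_ode n u (radial_flux n (W v)) (\<lambda>r. f (u r) - h r)"
    unfolding u_def by (intro radial_ode_cong[OF radial_ode_potential[OF Wc n]]) auto
  moreover have "u 0 = d" by (simp add: u_def radial_potential_def)
  ultimately show ?thesis using that by blast
qed


section \<open>Radial weak solutions\<close>

lemma C1_gradD:
  assumes "C1_grad f D"
  shows "(f has_derivative (\<lambda>h. D x \<bullet> h)) (at x)" "continuous_on UNIV D" "continuous_on UNIV f"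
  using assms unfolding C1_grad_def
  by (auto intro!: continuous_at_imp_continuous_on has_derivative_continuous)

lemma C1_grad_mult:
  assumes "C1_grad f Df" "C1_grad g Dg"
  shows "C1_grad (\<lambda>x. f x * g x) (\<lambda>x. f x *\<^sub>R Dg x + g x *\<^sub>R Df x)"
  unfolding C1_grad_def
  by (auto intro!: derivative_eq_intros continuous_intros C1_gradD[OF assms(1)] C1_gradD[OF assms(2)]
      simp: inner_add_left algebra_simps)

lemma filterlim_norm_at_0: "filterlim norm (at 0 within {0..}) (at (0::'a::real_normed_vector))"
  unfolding filterlim_at
  by (auto intro!: tendsto_eq_intros simp: eventually_at_filter)

lemma continuous_norm_compose:
  assumes "continuous_on {0..} f"
  shows "continuous_on S (\<lambda>x. f (norm x))"
  by (rule continuous_on_compose2[OF assms]) (auto intro: continuous_intros)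

lemma has_derivative_radial_at_nonzero:
  fixes x :: "'a::real_inner"
  assumes "(f has_real_derivative D) (at (norm x))" "x \<noteq> 0"
  shows "((\<lambda>x. f (norm x)) has_derivative (\<lambda>h. (D / norm x) *\<^sub>R x \<bullet> h)) (at x)"
proof -
  have "((f \<circ> norm) has_derivative (\<lambda>h. D * h) \<circ> (\<lambda>h. h \<bullet> sgn x)) (at x)"
    using assms has_derivative_norm[OF assms(2)]
    by (intro diff_chain_at) (auto simp: has_field_derivative_def)
  then show ?thesis by (simp add: o_def sgn_div_norm inner_commute divide_inverse mult_ac)
qed

lemma C1_grad_radial:
  assumes ode: "radial_ode n u q w"
  shows "C1_grad (\<lambda>x::'a::euclidean_space. u (norm x)) (\<lambda>x. q (norm x) *\<^sub>R x)"
  unfolding C1_grad_def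
proof (intro conjI allI)
  show "continuous_on UNIV (\<lambda>x::'a. q (norm x) *\<^sub>R x)"
    by (intro continuous_intros continuous_norm_compose radial_odeD(1)[OF ode])
  fix x :: 'a
  show "((\<lambda>x. u (norm x)) has_derivative (\<lambda>h. q (norm x) *\<^sub>R x \<bullet> h)) (at x)"
  proof (cases "x = 0")
    case True
    \<comment> \<open>The one-sided derivative at 0 is \<open>0 * q 0 = 0\<close>; composed with the
      norm it becomes the difference quotient at the origin.\<close>
    have "((\<lambda>r. (u r - u 0) / r) \<longlongrightarrow> 0) (at 0 within {0..})"
      using radial_odeD(4)[OF ode, of 0] by (simp add: has_field_derivative_iff)
    from filterlim_compose[OF this filterlim_norm_at_0]
    have "((\<lambda>y::'a. (u (norm y) - u 0) / norm y) \<longlongrightarrow> 0) (at 0)" .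
    then have "((\<lambda>y::'a. norm (u (norm y) - u 0) / norm y) \<longlongrightarrow> 0) (at 0)"
      by (drule_tac tendsto_norm_zero) (simp add: abs_divide)
    then show ?thesis using True by (simp add: has_derivative_at)
  next
    case False
    have "((\<lambda>x. u (norm x)) has_derivative (\<lambda>h. ((norm x * q (norm x)) / norm x) *\<^sub>R x \<bullet> h)) (at x)"
      using False by (intro has_derivative_radial_at_nonzero radial_odeD(6)[OF ode]) auto
    then show ?thesis using False by simp
  qed
qed

text \<open>One component of the field \<open>q x\<close>, to be used as a test function. The
  delicate point is the origin: the last term of the gradient is at most
  \<open>\<bar>p r\<bar>\<close> times \<open>norm e\<close>, where
  \<open>p r = - w r - n * q r\<close>, and it tends to 0 because the prescribed value of
  \<open>q 0\<close> gives \<open>p 0 = 0\<close>.\<close>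

lemma C1_grad_radial_flux:
  fixes e :: "'a::euclidean_space"
  assumes ode: "radial_ode n u q w" and n: "n > 0"
  shows "C1_grad (\<lambda>x. q (norm x) * (x \<bullet> e))
    (\<lambda>x. q (norm x) *\<^sub>R e + ((- w (norm x) - real n * q (norm x)) / (norm x)\<^sup>2 * (x \<bullet> e)) *\<^sub>R x)"
  unfolding C1_grad_def
proof (intro conjI allI)
  define p where "p r = - w r - real n * q r" for r
  have p: "continuous_on {0..} p" unfolding p_def
    by (intro continuous_intros radial_odeD(1,2)[OF ode])
  have p0: "p 0 = 0" using n radial_odeD(3)[OF ode] by (simp add: p_def)
  have "isCont (\<lambda>x::'a. (p (norm x) / (norm x)\<^sup>2 * (x \<bullet> e)) *\<^sub>R x) x" for x
  proof (cases "x = 0")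
    case True
    have "((\<lambda>x::'a. (p (norm x) / (norm x)\<^sup>2 * (x \<bullet> e)) *\<^sub>R x) \<longlongrightarrow> 0) (at 0)"
    proof (rule Lim_null_comparison)
      have "continuous_on UNIV (\<lambda>x::'a. p (norm x))" by (rule continuous_norm_compose[OF p])
      then have "((\<lambda>x::'a. p (norm x)) \<longlongrightarrow> 0) (at 0)"
        by (auto simp: continuous_on_eq_continuous_at isCont_def p0 dest: spec[of _ 0])
      then show "((\<lambda>x::'a. \<bar>p (norm x)\<bar> * norm e) \<longlongrightarrow> 0) (at 0)"
        by (auto intro!: tendsto_eq_intros)
      show "\<forall>\<^sub>F x in at 0. norm ((p (norm x) / (norm x)\<^sup>2 * (x \<bullet> e)) *\<^sub>R x) \<le> \<bar>p (norm x)\<bar> * norm e"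
      proof (rule always_eventually, rule allI)
        fix x :: 'a
        show "norm ((p (norm x) / (norm x)\<^sup>2 * (x \<bullet> e)) *\<^sub>R x) \<le> \<bar>p (norm x)\<bar> * norm e"
        proof (cases "x = 0")
          case False
          have "norm ((p (norm x) / (norm x)\<^sup>2 * (x \<bullet> e)) *\<^sub>R x) = \<bar>p (norm x)\<bar> / norm x * \<bar>x \<bullet> e\<bar>"
            using False by (simp add: abs_mult power2_eq_square)
          also have "\<dots> \<le> \<bar>p (norm x)\<bar> / norm x * (norm x * norm e)"
            by (intro mult_left_mono Cauchy_Schwarz_ineq2) auto
          finally show ?thesis using False by simp
        qed auto
      qed
    qed
    then show ?thesis using True by (simp add: isCont_def)
  next
    case False
    have "continuous_on (- {0}) (\<lambda>x::'a. (p (norm x) / (norm x)\<^sup>2 * (x \<bullet> e)) *\<^sub>R x)"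
      by (intro continuous_intros continuous_norm_compose[OF p]) auto
    then show ?thesis using False by (simp add: continuous_on_eq_continuous_at open_Compl)
  qed
  then have "continuous_on UNIV (\<lambda>x::'a. (p (norm x) / (norm x)\<^sup>2 * (x \<bullet> e)) *\<^sub>R x)"
    by (simp add: continuous_at_imp_continuous_on)
  moreover have "continuous_on UNIV (\<lambda>x::'a. q (norm x) *\<^sub>R e)"
    by (intro continuous_intros continuous_norm_compose radial_odeD(1)[OF ode])
  ultimately show "continuous_on UNIV (\<lambda>x. q (norm x) *\<^sub>R e +
      ((- w (norm x) - real n * q (norm x)) / (norm x)\<^sup>2 * (x \<bullet> e)) *\<^sub>R x)"
    unfolding p_def by (rule continuous_on_add[rotated])
  fix x :: 'a
  show "((\<lambda>x. q (norm x) * (x \<bullet> e)) has_derivative (\<lambda>h. (q (norm x) *\<^sub>R e +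
      ((- w (norm x) - real n * q (norm x)) / (norm x)\<^sup>2 * (x \<bullet> e)) *\<^sub>R x) \<bullet> h)) (at x)"
  proof (cases "x = 0")
    case True
    have "((\<lambda>y::'a. norm (q (norm y) * (y \<bullet> e) - q 0 * (e \<bullet> y)) / norm y) \<longlongrightarrow> 0) (at 0)"
    proof (rule Lim_null_comparison)
      have "continuous_on UNIV (\<lambda>x::'a. q (norm x))" by (rule continuous_norm_compose[OF radial_odeD(1)[OF ode]])
      then have "((\<lambda>x::'a. q (norm x)) \<longlongrightarrow> q 0) (at 0)"
        by (auto simp: continuous_on_eq_continuous_at isCont_def dest: spec[of _ 0])
      then show "((\<lambda>x::'a. \<bar>q (norm x) - q 0\<bar> * norm e) \<longlongrightarrow> 0) (at 0)"
        by (auto intro!: tendsto_eq_intros)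
      show "\<forall>\<^sub>F y in at 0. norm (norm (q (norm y) * (y \<bullet> e) - q 0 * (e \<bullet> y)) / norm y) \<le> \<bar>q (norm y) - q 0\<bar> * norm e"
      proof (rule always_eventually, rule allI)
        fix y :: 'a
        have "norm (q (norm y) * (y \<bullet> e) - q 0 * (e \<bullet> y)) = \<bar>q (norm y) - q 0\<bar> * \<bar>y \<bullet> e\<bar>"
          by (metis abs_mult inner_commute left_diff_distrib real_norm_def)
        also have "\<dots> \<le> \<bar>q (norm y) - q 0\<bar> * (norm y * norm e)"
          by (intro mult_left_mono Cauchy_Schwarz_ineq2) auto
        finally show "norm (norm (q (norm y) * (y \<bullet> e) - q 0 * (e \<bullet> y)) / norm y) \<le> \<bar>q (norm y) - q 0\<bar> * norm e"
          by (cases "y = 0") (auto simp: field_simps)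
      qed
    qed
    then show ?thesis using True
      by (simp add: has_derivative_at bounded_linear_const_mult bounded_linear_inner_right)
  next
    case False
    have "((\<lambda>x. q (norm x)) has_derivative (\<lambda>h. ((- w (norm x) - real n * q (norm x)) / norm x / norm x) *\<^sub>R x \<bullet> h)) (at x)"
      using False by (intro has_derivative_radial_at_nonzero radial_odeD(5)[OF ode]) auto
    moreover have "((\<lambda>x. x \<bullet> e) has_derivative (\<lambda>h. h \<bullet> e)) (at x)"
      by (intro derivative_eq_intros) auto
    ultimately have "((\<lambda>x. q (norm x) * (x \<bullet> e)) has_derivative (\<lambda>h. q (norm x) * (h \<bullet> e) +
        (((- w (norm x) - real n * q (norm x)) / norm x / norm x) *\<^sub>R x \<bullet> h) * (x \<bullet> e))) (at x)"
      by (rule has_derivative_mult)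
    then show ?thesis
      by (rule has_derivative_eq_rhs)
        (simp add: fun_eq_iff inner_add_left power2_eq_square inner_commute[of _ e])
  qed
qed

section \<open>Integration over the unit ball and the divergence theorem\<close>

lemma set_integrable_unit_ball:
  fixes f :: "'a::euclidean_space \<Rightarrow> 'b::euclidean_space"
  assumes "continuous_on UNIV f"
  shows "set_integrable lebesgue unit_ball f"
proof (rule set_integrable_subset)
  show "set_integrable lebesgue (cbox (-One) One) f"
    by (intro absolutely_integrable_continuous continuous_on_subset[OF assms]) auto
  show "(unit_ball :: 'a set) \<subseteq> cbox (- One) One"
  proof
    fix x :: 'a assume x: "x \<in> unit_ball"
    have "\<bar>x \<bullet> i\<bar> \<le> 1" if "i \<in> Basis" for i
      using Basis_le_norm[OF that, of x] x by simp
    then show "x \<in> cbox (- One) One" by (auto simp: mem_box abs_le_iff)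
  qed
qed auto

lemma lebesgue_integral_translate:
  fixes f :: "'a::euclidean_space \<Rightarrow> real"
  assumes f: "f \<in> borel_measurable borel"
  shows "(LINT x|lebesgue. f (c + x)) = (LINT x|lebesgue. f x)"
proof -
  have "(LINT x|lebesgue. f x) = integral\<^sup>L (distr lborel borel ((+) c)) f"
    using f by (simp add: integral_completion lborel_distr_plus)
  also have "\<dots> = (LINT x|lborel. f (c + x))"
    using f by (intro integral_distr) auto
  also have "\<dots> = (LINT x|lebesgue. f (c + x))"
    using f by (intro integral_completion[symmetric]) auto
  finally show ?thesis by simp
qed

text \<open>A segment from inside to outside meets the sphere, where \<open>k\<close> vanishes. The
  mean value bound on the convex closed ball, applied up to the crossing point, then covers pairs on
  different sides.\<close>

lemma indicator_C1_lipschitz: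
  fixes k :: "'a::euclidean_space \<Rightarrow> real"
  assumes k: "C1_grad k D" and z: "\<And>x. norm x = 1 \<Longrightarrow> k x = 0"
  obtains C where "C \<ge> 0" "\<And>x y. \<bar>indicator unit_ball x * k x - indicator unit_ball y * k y\<bar> \<le> C * norm (x - y)"
proof -
  have "compact (D ` cball 0 1)"
    by (intro compact_continuous_image continuous_on_subset[OF C1_gradD(2)[OF k]]) auto
  then have "bounded (D ` cball 0 1)" by (rule compact_imp_bounded)
  then obtain C where "\<forall>y\<in>D ` cball 0 1. norm y \<le> C" by (auto simp only: bounded_iff)
  then have C: "norm (D x) \<le> C" if "x \<in> cball 0 1" for x using that by blast
  have C0: "C \<ge> 0" by (rule order_trans[OF norm_ge_zero C[of 0]]) simp
  have in_ball: "\<bar>k x - k y\<bar> \<le> C * norm (x - y)" if "x \<in> cball 0 1" "y \<in> cball 0 1" for x y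
  proof -
    have "norm (k x - k y) \<le> C * norm (x - y)"
    proof (rule differentiable_bound[OF convex_cball])
      fix x :: 'a assume x: "x \<in> cball 0 1"
      show "(k has_derivative (\<lambda>h. D x \<bullet> h)) (at x within cball 0 1)"
        by (rule has_derivative_at_withinI[OF C1_gradD(1)[OF k]])
      have "norm (D x \<bullet> h) \<le> C * norm h" for h
        using order_trans[OF Cauchy_Schwarz_ineq2[of "D x" h] mult_right_mono[OF C[OF x] norm_ge_zero]]
        by simp
      then show "onorm (\<lambda>h. D x \<bullet> h) \<le> C" by (rule onorm_le)
    qed (use that in auto)
    then show ?thesis by simp
  qed
  have cross: "\<bar>k x\<bar> \<le> C * norm (x - y)" if x: "norm x < 1" and y: "norm y \<ge> 1" for x y
  proof -
    have "\<exists>t\<ge>0. t \<le> 1 \<and> norm (x + t *\<^sub>R (y - x)) = 1"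
      by (rule IVT'[where f="\<lambda>t. norm (x + t *\<^sub>R (y - x))"]) (use x y in \<open>auto intro!: continuous_intros\<close>)
    then obtain t where t: "0 \<le> t" "t \<le> 1" "norm (x + t *\<^sub>R (y - x)) = 1" by auto
    have "\<bar>k x\<bar> \<le> C * norm (x - (x + t *\<^sub>R (y - x)))"
      using in_ball[of x "x + t *\<^sub>R (y - x)"] z[OF t(3)] x t(3) by auto
    also have "\<dots> = C * (t * norm (x - y))"
      using t by (simp add: norm_minus_commute)
    also have "\<dots> \<le> C * (1 * norm (x - y))"
      using t C0 by (intro mult_left_mono mult_right_mono) auto
    finally show ?thesis by simp
  qed
  have "\<bar>indicator unit_ball x * k x - indicator unit_ball y * k y\<bar> \<le> C * norm (x - y)" for x y
    using in_ball[of x y] cross[of x y] cross[of y x] C0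
    by (auto simp: indicator_def norm_minus_commute)
  with C0 show ?thesis using that by blast
qed

lemma C1_grad_difference_quotient:
  assumes k: "C1_grad k D"
  shows "(\<lambda>m. (k (x + inverse (real (Suc m)) *\<^sub>R e) - k x) / inverse (real (Suc m))) \<longlonglongrightarrow> D x \<bullet> e"
proof -
  have "((k \<circ> (\<lambda>t. x + t *\<^sub>R e)) has_derivative (\<lambda>h. D x \<bullet> h) \<circ> (\<lambda>t. t *\<^sub>R e)) (at (0::real))"
    by (intro diff_chain_at) (auto intro!: derivative_eq_intros C1_gradD(1)[OF k, of x, simplified])
  then have "((\<lambda>t. k (x + t *\<^sub>R e)) has_real_derivative D x \<bullet> e) (at 0)"
    by (simp add: has_field_derivative_def o_def mult.commute[of _ "D x \<bullet> e"])
  then have "((\<lambda>t. (k (x + t *\<^sub>R e) - k x) / t) \<longlongrightarrow> D x \<bullet> e) (at 0)"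
    by (simp add: DERIV_def)
  moreover have "filterlim (\<lambda>m. inverse (real (Suc m))) (at 0) sequentially"
    by (intro filterlim_atI LIMSEQ_inverse_real_of_nat) auto
  ultimately show ?thesis by (rule filterlim_compose)
qed

text \<open>The divergence theorem with vanishing boundary term: extended by zero, \<open>k\<close> is Lipschitz, and the
  integrals of its difference quotients vanish by translation invariance.\<close>

lemma integral_gradient_eq_0:
  fixes k :: "'a::euclidean_space \<Rightarrow> real"
  assumes k: "C1_grad k D" and z: "\<And>x. norm x = 1 \<Longrightarrow> k x = 0"
  shows "(LINT x:unit_ball|lebesgue. D x) = 0"
proof (rule euclidean_eqI)
  fix e :: 'a assume e: "e \<in> Basis"
  define kt where "kt x = indicator unit_ball x * k x" for x
  obtain C where C: "C \<ge> 0" "\<And>x y. \<bar>kt x - kt y\<bar> \<le> C * norm (x - y)"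
    unfolding kt_def using indicator_C1_lipschitz[OF k z] by blast
  have ktm: "kt \<in> borel_measurable borel"
    unfolding kt_def using borel_measurable_continuous_onI[OF C1_gradD(3)[OF k]]
    by (intro borel_measurable_times borel_measurable_indicator) auto
  have kti: "integrable lebesgue kt"
    using set_integrable_unit_ball[OF C1_gradD(3)[OF k]] unfolding set_integrable_def kt_def by simp
  define F where "F m x = (kt (inverse (real (Suc m)) *\<^sub>R e + x) - kt x) / inverse (real (Suc m))" for m x
  have Fm: "F m \<in> borel_measurable borel" for m
    unfolding F_def using ktm by measurable
  have int0: "(LINT x|lebesgue. F m x) = 0" for m
  proof -
    define c where "c = inverse (real (Suc m)) *\<^sub>R e"
    have "integrable lborel kt"
      using kti ktm by (simp add: integrable_completion)
    then have "integrable (distr lborel borel ((+) c)) kt" by (simp add: lborel_distr_plus)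
    then have "integrable lborel (\<lambda>x. kt (c + x))"
      by (rule integrable_distr[rotated]) auto
    then have "integrable lebesgue (\<lambda>x. kt (c + x))"
      using ktm by (subst integrable_completion) auto
    then have "(LINT x|lebesgue. kt (c + x) - kt x) = 0"
      using kti lebesgue_integral_translate[OF ktm, of c] by (subst Bochner_Integration.integral_diff) auto
    then show ?thesis unfolding F_def c_def[symmetric] by simp
  qed
  \<comment> \<open>The Lipschitz bound supplies the majorant \<open>C\<close>, and as the steps
    have length at most 1, all quotients vanish outside the ball of radius 2. The sphere, where the
    zero extension may fail to be differentiable, is a null set.\<close>
  have lim: "(\<lambda>m. LINT x|lebesgue. F m x) \<longlonglongrightarrow> (LINT x|lebesgue. indicator unit_ball x * (D x \<bullet> e))"
  proof (rule integral_dominated_convergence[where w="\<lambda>x. C * indicator (cball 0 2) x"])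
    show "(\<lambda>x. indicator unit_ball x * (D x \<bullet> e)) \<in> borel_measurable lebesgue"
    proof -
      have "(\<lambda>x. D x \<bullet> e) \<in> borel_measurable borel"
        by (intro borel_measurable_continuous_onI continuous_intros C1_gradD(2)[OF k])
      then have "(\<lambda>x. indicator unit_ball x * (D x \<bullet> e)) \<in> borel_measurable borel"
        by (intro borel_measurable_times borel_measurable_indicator) auto
      then show ?thesis by (simp add: measurable_completion)
    qed
    show "F m \<in> borel_measurable lebesgue" for m using Fm[of m] by (simp add: measurable_completion)
    show "integrable lebesgue (\<lambda>x. C * indicator (cball (0::'a) 2) x)"
      using emeasure_bounded_finite[OF bounded_cball, of "0::'a" 2]
      by (intro integrable_mult_right integrable_real_indicator) auto
    have "AE x in lebesgue. x \<notin> sphere (0::'a) 1"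
      using negligible_sphere[of "0::'a" 1] by (intro AE_not_in) (simp add: negligible_iff_null_sets)
    then show "AE x in lebesgue. (\<lambda>m. F m x) \<longlonglongrightarrow> indicator unit_ball x * (D x \<bullet> e)"
    proof (rule AE_mp, intro AE_I2 impI)
      fix x :: 'a assume x: "x \<notin> sphere 0 1"
      have t: "(\<lambda>m. inverse (real (Suc m)) *\<^sub>R e + x) \<longlonglongrightarrow> x"
        using tendsto_add[OF tendsto_scaleR[OF LIMSEQ_inverse_real_of_nat tendsto_const[of e]] tendsto_const[of x]] by simp
      show "(\<lambda>m. F m x) \<longlonglongrightarrow> indicator unit_ball x * (D x \<bullet> e)"
      proof (cases "norm x < 1")
        case True
        have "\<forall>\<^sub>F m in sequentially. inverse (real (Suc m)) *\<^sub>R e + x \<in> ball 0 1"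
          using True by (intro topological_tendstoD[OF t open_ball]) simp
        then have "\<forall>\<^sub>F m in sequentially. (k (x + inverse (real (Suc m)) *\<^sub>R e) - k x) / inverse (real (Suc m)) = F m x"
          by eventually_elim (use True in \<open>auto simp: F_def kt_def add.commute\<close>)
        with C1_grad_difference_quotient[OF k, of x e] have "(\<lambda>m. F m x) \<longlonglongrightarrow> D x \<bullet> e"
          by (rule Lim_transform_eventually)
        then show ?thesis using True by simp
      next
        case False
        then have "x \<in> - cball 0 1" using x by auto
        then have "\<forall>\<^sub>F m in sequentially. inverse (real (Suc m)) *\<^sub>R e + x \<in> - cball 0 1"
          by (intro topological_tendstoD[OF t]) auto
        then have "\<forall>\<^sub>F m in sequentially. 0 = F m x"
          by eventually_elim (use False in \<open>auto simp: F_def kt_def indicator_def\<close>)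
        from Lim_transform_eventually[OF tendsto_const this] show ?thesis using False by simp
      qed
    qed
    fix m
    show "AE x in lebesgue. norm (F m x) \<le> C * indicator (cball 0 2) x"
    proof (rule AE_I2)
      fix x :: 'a
      have inv: "inverse (real (Suc m)) > 0" "inverse (real (Suc m)) \<le> 1" by (auto simp: field_simps)
      have "\<bar>kt (inverse (real (Suc m)) *\<^sub>R e + x) - kt x\<bar> \<le> C * inverse (real (Suc m))"
        using C(2)[of "inverse (real (Suc m)) *\<^sub>R e + x" x] e by simp
      then have "norm (F m x) \<le> C"
        unfolding F_def using inv by (simp add: divide_le_eq)
      moreover have "F m x = 0" if "x \<notin> cball 0 2"
      proof -
        have "norm x \<le> norm (inverse (real (Suc m)) *\<^sub>R e + x) + norm (inverse (real (Suc m)) *\<^sub>R e)"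
          using norm_triangle_ineq4[of "inverse (real (Suc m)) *\<^sub>R e + x" "inverse (real (Suc m)) *\<^sub>R e"]
          by (simp only: add_diff_cancel_left')
        then have "norm (inverse (real (Suc m)) *\<^sub>R e + x) \<ge> 1" using that e inv by auto
        then show ?thesis using that by (auto simp: F_def kt_def indicator_def)
      qed
      ultimately show "norm (F m x) \<le> C * indicator (cball 0 2) x" by (cases "x \<in> cball 0 2") auto
    qed
  qed
  then have "(LINT x|lebesgue. indicator unit_ball x * (D x \<bullet> e)) = 0"
    unfolding int0 by (simp only: LIMSEQ_const_iff)
  moreover have "(LINT x|lebesgue. indicator unit_ball x *\<^sub>R D x) \<bullet> e = (LINT x|lebesgue. (indicator unit_ball x *\<^sub>R D x) \<bullet> e)"
    using set_integrable_unit_ball[OF C1_gradD(2)[OF k]] unfolding set_integrable_def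
    by (intro integral_inner_left[symmetric]) auto
  ultimately show "(LINT x:unit_ball|lebesgue. D x) \<bullet> e = 0 \<bullet> e"
    unfolding set_lebesgue_integral_def by simp
qed


section \<open>Classical radial solutions as weak solutions\<close>

lemma set_borel_measurable_unit_ball:
  fixes f :: "'a::euclidean_space \<Rightarrow> 'b::euclidean_space"
  assumes "continuous_on UNIV f"
  shows "set_borel_measurable lebesgue unit_ball f"
  using set_integrable_unit_ball[OF assms] unfolding set_integrable_def set_borel_measurable_def
  by (rule borel_measurable_integrable)

lemma H1_ball_radial:
  assumes ode: "radial_ode n u q w"
  shows "H1_ball (\<lambda>x::'a::euclidean_space. u (norm x)) (\<lambda>x. q (norm x) *\<^sub>R x)"
proof -
  note C1 = C1_gradD[OF C1_grad_radial[OF ode, where ?'a='a]]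
  show ?thesis unfolding H1_ball_def
  proof (intro conjI allI impI)
    show "set_borel_measurable lebesgue unit_ball (\<lambda>x::'a. u (norm x))"
      by (rule set_borel_measurable_unit_ball[OF C1(3)])
    show "set_borel_measurable lebesgue unit_ball (\<lambda>x::'a. q (norm x) *\<^sub>R x)"
      by (rule set_borel_measurable_unit_ball[OF C1(2)])
    show "set_integrable lebesgue unit_ball (\<lambda>x::'a. (u (norm x))\<^sup>2)"
      by (intro set_integrable_unit_ball continuous_on_power C1(3))
    show "set_integrable lebesgue unit_ball (\<lambda>x::'a. (norm (q (norm x) *\<^sub>R x))\<^sup>2)"
      by (intro set_integrable_unit_ball continuous_on_power continuous_on_norm C1(2))
    fix \<phi> :: "'a \<Rightarrow> real" and D K
    assume *: "C1_grad \<phi> D \<and> compact K \<and> K \<subseteq> unit_ball \<and> (\<forall>x. x \<notin> K \<longrightarrow> \<phi> x = 0)"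
    then have \<phi>: "C1_grad \<phi> D" by simp
    have "(LINT x:unit_ball|lebesgue. u (norm x) *\<^sub>R D x + \<phi> x *\<^sub>R (q (norm x) *\<^sub>R x)) = 0"
      by (rule integral_gradient_eq_0[OF C1_grad_mult[OF C1_grad_radial[OF ode] \<phi>]])
        (use * in \<open>force\<close>)
    moreover have "set_integrable lebesgue unit_ball (\<lambda>x. u (norm x) *\<^sub>R D x)"
      by (intro set_integrable_unit_ball continuous_on_scaleR C1(3) C1_gradD[OF \<phi>])
    moreover have "set_integrable lebesgue unit_ball (\<lambda>x. \<phi> x *\<^sub>R (q (norm x) *\<^sub>R x))"
      by (intro set_integrable_unit_ball continuous_on_scaleR[of _ \<phi>] C1(2) C1_gradD[OF \<phi>])
    ultimately show "(LINT x:unit_ball|lebesgue. u (norm x) *\<^sub>R D x) =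
        - (LINT x:unit_ball|lebesgue. \<phi> x *\<^sub>R (q (norm x) *\<^sub>R x))"
      by (simp add: set_integral_add eq_neg_iff_add_eq_0)
  qed
qed

text \<open>The divergence of \<open>q x\<close> is \<open>n * q + r * q'\<close>, which the
  equation turns into \<open>- w\<close>.\<close>

lemma radial_flux_divergence:
  fixes x :: "'a::euclidean_space"
  assumes ode: "radial_ode DIM('a) u q w"
  shows "(\<Sum>e\<in>Basis. e \<bullet> (q (norm x) *\<^sub>R e +
     ((- w (norm x) - real DIM('a) * q (norm x)) / (norm x)\<^sup>2 * (x \<bullet> e)) *\<^sub>R x)) = - w (norm x)"
proof -
  define m where "m = (- w (norm x) - real DIM('a) * q (norm x)) / (norm x)\<^sup>2"
  have "(\<Sum>e\<in>Basis. e \<bullet> (q (norm x) *\<^sub>R e + (m * (x \<bullet> e)) *\<^sub>R x))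
      = (\<Sum>e\<in>(Basis::'a set). q (norm x) + m * ((x \<bullet> e) * (x \<bullet> e)))"
    by (intro sum.cong) (auto simp: inner_add_right inner_commute)
  also have "\<dots> = real DIM('a) * q (norm x) + m * (x \<bullet> x)"
    by (simp add: sum.distrib sum_distrib_left[symmetric] euclidean_inner[of x x])
  \<comment> \<open>At the origin \<open>m\<close> is 0 by division by zero, and the prescribed
    value of \<open>q 0\<close> supplies \<open>- w 0\<close> directly.\<close>
  also have "\<dots> = - w (norm x)"
    using radial_odeD(3)[OF ode] by (cases "x = 0") (auto simp: m_def power2_norm_eq_inner)
  finally show ?thesis unfolding m_def .
qed

text \<open>The divergence theorem and the weak gradient give one vector-valued identity per
  direction \<open>e\<close>; a divergence is the sum of the \<open>e\<close>-components of
  these.\<close>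

lemma integral_sum_inner_Basis:
  fixes F :: "'a::euclidean_space \<Rightarrow> 'a \<Rightarrow> 'a"
  assumes "\<And>e. e \<in> Basis \<Longrightarrow> set_integrable lebesgue unit_ball (F e)"
  shows "(LINT x:unit_ball|lebesgue. (\<Sum>e\<in>Basis. e \<bullet> F e x))
    = (\<Sum>e\<in>Basis. e \<bullet> (LINT x:unit_ball|lebesgue. F e x))"
proof -
  have "(LINT x:unit_ball|lebesgue. (\<Sum>e\<in>Basis. e \<bullet> F e x))
     = (LINT x|lebesgue. (\<Sum>e\<in>Basis. e \<bullet> (indicator unit_ball x *\<^sub>R F e x)))"
    unfolding set_lebesgue_integral_def by (simp add: sum_distrib_left)
  also have "\<dots> = (\<Sum>e\<in>Basis. LINT x|lebesgue. e \<bullet> (indicator unit_ball x *\<^sub>R F e x))"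
    using assms unfolding set_integrable_def
    by (intro Bochner_Integration.integral_sum integrable_inner_right) auto
  also have "\<dots> = (\<Sum>e\<in>Basis. e \<bullet> (LINT x|lebesgue. indicator unit_ball x *\<^sub>R F e x))"
    using assms unfolding set_integrable_def by (intro sum.cong integral_inner_right) auto
  finally show ?thesis unfolding set_lebesgue_integral_def .
qed

text \<open>Since \<open>q 1 = 0\<close>, each component of \<open>q x\<close> times
  \<open>\<phi>\<close> vanishes on the sphere whatever \<open>\<phi>\<close> does there, so the
  divergence theorem applies without a boundary term.\<close>

lemma radial_weak_form:
  fixes \<phi> :: "'a::euclidean_space \<Rightarrow> real"
  assumes ode: "radial_ode DIM('a) u q w" and q1: "q 1 = 0" and \<phi>: "C1_grad \<phi> D"
  shows "(LINT x:unit_ball|lebesgue. (q (norm x) *\<^sub>R x) \<bullet> D x) = (LINT x:unit_ball|lebesgue. w (norm x) * \<phi> x)"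
proof -
  define X where "X e x = q (norm x) *\<^sub>R e +
     ((- w (norm x) - real DIM('a) * q (norm x)) / (norm x)\<^sup>2 * (x \<bullet> e)) *\<^sub>R x" for e x :: 'a
  define k where "k e x = (q (norm x) * (x \<bullet> e)) *\<^sub>R D x + \<phi> x *\<^sub>R X e x" for e x
  have C1: "C1_grad (\<lambda>x. (q (norm x) * (x \<bullet> e)) * \<phi> x) (k e)" for e :: 'a
    unfolding k_def X_def by (intro C1_grad_mult C1_grad_radial_flux[OF ode] \<phi>) auto
  have "(LINT x:unit_ball|lebesgue. k e x) = 0" for e
    by (rule integral_gradient_eq_0[OF C1]) (simp add: q1)
  then have "(LINT x:unit_ball|lebesgue. (\<Sum>e\<in>Basis. e \<bullet> k e x)) = 0"
    by (subst integral_sum_inner_Basis) (auto intro: set_integrable_unit_ball C1_gradD[OF C1])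
  moreover have "(\<Sum>e\<in>Basis. e \<bullet> k e x) = (q (norm x) *\<^sub>R x) \<bullet> D x - w (norm x) * \<phi> x" for x
  proof -
    have "(\<Sum>e\<in>Basis. e \<bullet> k e x) = (\<Sum>e\<in>Basis. q (norm x) * ((x \<bullet> e) * (D x \<bullet> e)) + \<phi> x * (e \<bullet> X e x))"
      unfolding k_def by (intro sum.cong) (auto simp: inner_add_right inner_commute)
    also have "\<dots> = q (norm x) * (\<Sum>e\<in>Basis. (x \<bullet> e) * (D x \<bullet> e)) + \<phi> x * (\<Sum>e\<in>Basis. e \<bullet> X e x)"
      by (simp only: sum.distrib sum_distrib_left)
    also have "\<dots> = q (norm x) * (x \<bullet> D x) + \<phi> x * - w (norm x)"
      by (simp only: X_def radial_flux_divergence[OF ode] euclidean_inner[of x "D x"])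
    finally show ?thesis by simp
  qed
  ultimately have "(LINT x:unit_ball|lebesgue. (q (norm x) *\<^sub>R x) \<bullet> D x - w (norm x) * \<phi> x) = 0"
    by (simp only:)
  moreover have "set_integrable lebesgue unit_ball (\<lambda>x. (q (norm x) *\<^sub>R x) \<bullet> D x)"
    by (intro set_integrable_unit_ball continuous_on_inner C1_gradD[OF \<phi>] C1_gradD[OF C1_grad_radial[OF ode]])
  moreover have "set_integrable lebesgue unit_ball (\<lambda>x. w (norm x) * \<phi> x)"
    by (intro set_integrable_unit_ball continuous_on_mult C1_gradD[OF \<phi>] continuous_norm_compose radial_odeD[OF ode])
  ultimately show ?thesis by (simp add: set_integral_diff)
qed

lemma neumann_weak_sol_radial:
  fixes f :: "'a::euclidean_space \<Rightarrow> real"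
  assumes ode: "radial_ode DIM('a) u q w" and q1: "q 1 = 0"
    and f: "\<And>x. x \<in> unit_ball \<Longrightarrow> f x = w (norm x) + u (norm x)"
  shows "neumann_weak_sol f (\<lambda>x. u (norm x))"
  unfolding neumann_weak_sol_def
proof (intro exI conjI allI impI)
  show "H1_ball (\<lambda>x::'a. u (norm x)) (\<lambda>x. q (norm x) *\<^sub>R x)" by (rule H1_ball_radial[OF ode])
  have cu: "continuous_on UNIV (\<lambda>x::'a. u (norm x))" and cw: "continuous_on UNIV (\<lambda>x::'a. w (norm x))"
    by (intro continuous_norm_compose radial_odeD[OF ode])+
  have "set_integrable lebesgue unit_ball (\<lambda>x::'a. w (norm x) + u (norm x))"
    by (intro set_integrable_unit_ball continuous_on_add cu cw)
  then show "set_integrable lebesgue unit_ball f"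
    by (rule iffD1[OF set_integrable_cong, rotated -1]) (auto simp: f)
  fix \<phi> :: "'a \<Rightarrow> real" and D assume \<phi>: "C1_grad \<phi> D"
  have iu: "set_integrable lebesgue unit_ball (\<lambda>x. u (norm x) * \<phi> x)"
    by (intro set_integrable_unit_ball continuous_on_mult cu C1_gradD[OF \<phi>])
  have iw: "set_integrable lebesgue unit_ball (\<lambda>x. w (norm x) * \<phi> x)"
    by (intro set_integrable_unit_ball continuous_on_mult cw C1_gradD[OF \<phi>])
  have iq: "set_integrable lebesgue unit_ball (\<lambda>x. (q (norm x) *\<^sub>R x) \<bullet> D x)"
    by (intro set_integrable_unit_ball continuous_on_inner C1_gradD[OF \<phi>] C1_gradD[OF C1_grad_radial[OF ode]])
  have "(LINT x:unit_ball|lebesgue. (q (norm x) *\<^sub>R x) \<bullet> D x + u (norm x) * \<phi> x)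
     = (LINT x:unit_ball|lebesgue. w (norm x) * \<phi> x + u (norm x) * \<phi> x)"
    using iu iw iq radial_weak_form[OF ode q1 \<phi>] by (simp add: set_integral_add)
  also have "\<dots> = (LINT x:unit_ball|lebesgue. f x * \<phi> x)"
    by (intro set_lebesgue_integral_cong) (auto simp: f algebra_simps)
  finally show "(LINT x:unit_ball|lebesgue. (q (norm x) *\<^sub>R x) \<bullet> D x + u (norm x) * \<phi> x)
     = (LINT x:unit_ball|lebesgue. f x * \<phi> x)" .
qed


section \<open>Weak radial eigenvalues\<close>

lemma continuous_bounded_unit_ball:
  fixes c :: "'a::euclidean_space \<Rightarrow> 'b::real_normed_vector"
  assumes "continuous_on UNIV c"
  obtains C where "C \<ge> 0" "\<And>x. x \<in> unit_ball \<Longrightarrow> norm (c x) \<le> C"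
proof -
  have "compact (c ` cball 0 1)"
    by (intro compact_continuous_image continuous_on_subset[OF assms]) auto
  then have "bounded (c ` cball 0 1)" by (rule compact_imp_bounded)
  then obtain C where C: "\<forall>y\<in>c ` cball 0 1. norm y \<le> C" by (auto simp only: bounded_iff)
  show ?thesis
  proof (rule that[of "\<bar>C\<bar>"])
    fix x :: 'a assume "x \<in> unit_ball"
    then have "norm (c x) \<le> C" using C by auto
    then show "norm (c x) \<le> \<bar>C\<bar>" by simp
  qed simp
qed

lemma set_integrable_bilinear_continuous:
  fixes f :: "'a::euclidean_space \<Rightarrow> 'b::euclidean_space" and c :: "'a \<Rightarrow> 'c::euclidean_space"
    and pr :: "'b \<Rightarrow> 'c \<Rightarrow> 'd::euclidean_space"
  assumes pr: "bounded_bilinear pr" and f: "set_integrable lebesgue unit_ball f" and c: "continuous_on UNIV c"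
  shows "set_integrable lebesgue unit_ball (\<lambda>x. pr (f x) (c x))"
proof -
  obtain C where C: "C \<ge> 0" "\<And>x. x \<in> unit_ball \<Longrightarrow> norm (c x) \<le> C"
    using continuous_bounded_unit_ball[OF c] by blast
  obtain K where K: "K \<ge> 0" "\<And>a b. norm (pr a b) \<le> norm a * norm b * K"
    using bounded_bilinear.nonneg_bounded[OF pr] by blast
  have fi: "integrable lebesgue (\<lambda>x. indicator unit_ball x *\<^sub>R f x)"
    using f unfolding set_integrable_def .
  have cm: "c \<in> borel_measurable lebesgue"
    using borel_measurable_continuous_onI[OF c] by (simp add: measurable_completion)
  have "integrable lebesgue (\<lambda>x. pr (indicator unit_ball x *\<^sub>R f x) (c x))"
  proof (rule Bochner_Integration.integrable_bound)
    show "integrable lebesgue (\<lambda>x. (C * K) *\<^sub>R norm (indicator unit_ball x *\<^sub>R f x))"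
      by (intro integrable_scaleR_right integrable_norm fi)
    show "(\<lambda>x. pr (indicator unit_ball x *\<^sub>R f x) (c x)) \<in> borel_measurable lebesgue"
      by (intro borel_measurable_continuous_Pair[OF borel_measurable_integrable[OF fi] cm]
          bounded_bilinear.continuous_on[OF pr] continuous_intros)
    show "AE x in lebesgue. norm (pr (indicator unit_ball x *\<^sub>R f x) (c x))
        \<le> norm ((C * K) *\<^sub>R norm (indicator unit_ball x *\<^sub>R f x))"
    proof (rule AE_I2)
      fix x :: 'a
      show "norm (pr (indicator unit_ball x *\<^sub>R f x) (c x))
        \<le> norm ((C * K) *\<^sub>R norm (indicator unit_ball x *\<^sub>R f x))"
      proof (cases "x \<in> unit_ball")
        case True
        have "norm (pr (f x) (c x)) \<le> norm (f x) * norm (c x) * K" by (rule K)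
        also have "\<dots> \<le> norm (f x) * C * K"
          using C(2)[OF True] K(1) by (intro mult_right_mono mult_left_mono) auto
        finally show ?thesis using True C(1) K(1) by (simp add: abs_mult mult_ac)
      qed (simp add: bounded_bilinear.zero_left[OF pr])
    qed
  qed
  then show ?thesis unfolding set_integrable_def
    by (simp only: bounded_bilinear.scaleR_left[OF pr])
qed

lemma set_integrable_of_square:
  fixes f :: "'a::euclidean_space \<Rightarrow> 'b::euclidean_space"
  assumes "set_borel_measurable lebesgue unit_ball f" "set_integrable lebesgue unit_ball (\<lambda>x. (norm (f x))\<^sup>2)"
  shows "set_integrable lebesgue unit_ball f"
  unfolding set_integrable_def
proof (rule Bochner_Integration.integrable_bound)
  have "set_integrable lebesgue unit_ball (\<lambda>x. 1 + (norm (f x))\<^sup>2)"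
    by (intro set_integral_add assms(2) set_integrable_unit_ball continuous_on_const)
  then show "integrable lebesgue (\<lambda>x. indicator unit_ball x *\<^sub>R (1 + (norm (f x))\<^sup>2))"
    unfolding set_integrable_def .
  show "(\<lambda>x. indicator unit_ball x *\<^sub>R f x) \<in> borel_measurable lebesgue"
    using assms(1) unfolding set_borel_measurable_def .
  have "norm y \<le> 1 + (norm y)\<^sup>2" for y :: 'b
    using sum_squares_bound[of 1 "norm y"] norm_ge_zero[of y] by (simp del: norm_ge_zero)
  then show "AE x in lebesgue. norm (indicator unit_ball x *\<^sub>R f x) \<le> norm (indicator unit_ball x *\<^sub>R (1 + (norm (f x))\<^sup>2))"
    by (intro AE_I2) (auto simp: indicator_def abs_of_nonneg add_nonneg_nonneg)
qed

lemma unit_ball_dominated_convergence: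
  fixes f :: "'a::euclidean_space \<Rightarrow> real"
  assumes f: "set_integrable lebesgue unit_ball f"
    and c: "\<And>k. continuous_on UNIV (c k)"
    and b: "\<And>k x. x \<in> unit_ball \<Longrightarrow> \<bar>c k x\<bar> \<le> C"
    and l: "\<And>x. x \<in> unit_ball \<Longrightarrow> (\<lambda>k. c k x) \<longlonglongrightarrow> c' x"
  shows "(\<lambda>k. LINT x:unit_ball|lebesgue. f x * c k x) \<longlonglongrightarrow> (LINT x:unit_ball|lebesgue. f x * c' x)"
    and "set_integrable lebesgue unit_ball (\<lambda>x. f x * c' x)"
proof -
  define w where "w x = C * norm (indicator unit_ball x *\<^sub>R f x)" for x
  have fi: "integrable lebesgue (\<lambda>x. indicator unit_ball x *\<^sub>R f x)"
    using f unfolding set_integrable_def .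
  have wi: "integrable lebesgue w"
    unfolding w_def by (intro integrable_mult_right integrable_norm fi)
  have m: "(\<lambda>x. indicator unit_ball x *\<^sub>R (f x * c k x)) \<in> borel_measurable lebesgue" for k
    using set_integrable_bilinear_continuous[OF bounded_bilinear_mult f c[of k]]
    unfolding set_integrable_def by (rule borel_measurable_integrable)
  have lim: "(\<lambda>k. indicator unit_ball x *\<^sub>R (f x * c k x)) \<longlonglongrightarrow> indicator unit_ball x *\<^sub>R (f x * c' x)" for x
    using l[of x] by (cases "x \<in> unit_ball") (auto intro!: tendsto_intros)
  have m': "(\<lambda>x. indicator unit_ball x *\<^sub>R (f x * c' x)) \<in> borel_measurable lebesgue"
    by (rule borel_measurable_LIMSEQ_metric[OF m lim])
  have bd: "norm (indicator unit_ball x *\<^sub>R (f x * c k x)) \<le> w x" for k x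
  proof (cases "x \<in> unit_ball")
    case True
    then have "\<bar>f x\<bar> * \<bar>c k x\<bar> \<le> \<bar>f x\<bar> * C" by (intro mult_left_mono b) auto
    then show ?thesis using True by (simp add: w_def abs_mult mult.commute)
  qed (simp add: w_def)
  show "(\<lambda>k. LINT x:unit_ball|lebesgue. f x * c k x) \<longlonglongrightarrow> (LINT x:unit_ball|lebesgue. f x * c' x)"
    unfolding set_lebesgue_integral_def
    by (rule integral_dominated_convergence[where w=w]) (intro m' m wi AE_I2 lim bd)+
  show "set_integrable lebesgue unit_ball (\<lambda>x. f x * c' x)"
    unfolding set_integrable_def
    by (rule integrable_dominated_convergence[where w=w and s="\<lambda>k x. indicator unit_ball x *\<^sub>R (f x * c k x)"])
      (intro m' m wi AE_I2 lim bd)+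
qed

text \<open>A rational C1 step, zero on the left half-line and tending to 1. Composed with
  \<open>k * (1 - x \<bullet> x) - 1\<close> it cuts off near the sphere, ever closer as
  \<open>k\<close> grows. Squaring \<open>max 0 s\<close> makes the derivative continuous at 0, and
  this derivative decays like \<open>1 / s ^ 3\<close>.\<close>

definition cutoff :: "real \<Rightarrow> real" where
  "cutoff s = (max 0 s)\<^sup>2 / (1 + (max 0 s)\<^sup>2)"

definition cutoff' :: "real \<Rightarrow> real" where
  "cutoff' s = 2 * max 0 s / (1 + (max 0 s)\<^sup>2)\<^sup>2"

lemma DERIV_max_square: "((\<lambda>s. (max 0 s)\<^sup>2) has_real_derivative 2 * max 0 s) (at (s::real))"
proof -
  consider "s < 0" | "s = 0" | "s > 0" by linarith
  then show ?thesis
  proof cases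
    case 1
    have "((\<lambda>s::real. 0) has_real_derivative 2 * max 0 s) (at s)" using 1 by auto
    then show ?thesis
      by (rule has_field_derivative_transform_within_open[of _ _ _ "{..<0}"]) (use 1 in auto)
  next
    case 2
    have "((\<lambda>h::real. ((max 0 (0 + h))\<^sup>2 - (max 0 0)\<^sup>2) / h) \<longlongrightarrow> 0) (at 0)"
    proof (rule Lim_null_comparison)
      show "((\<lambda>h::real. \<bar>h\<bar>) \<longlongrightarrow> 0) (at 0)" by (auto intro!: tendsto_eq_intros)
      show "\<forall>\<^sub>F h in at 0. norm (((max 0 (0 + h))\<^sup>2 - (max 0 0)\<^sup>2) / h) \<le> \<bar>h::real\<bar>"
        by (intro always_eventually) (auto simp: max_def power2_eq_square)
    qed
    then show ?thesis using 2 by (simp add: DERIV_def)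
  next
    case 3
    have "((\<lambda>s::real. s\<^sup>2) has_real_derivative 2 * max 0 s) (at s)"
      using 3 by (auto intro!: derivative_eq_intros)
    then show ?thesis
      by (rule has_field_derivative_transform_within_open[of _ _ _ "{0<..}"]) (use 3 in auto)
  qed
qed

lemma DERIV_cutoff: "(cutoff has_real_derivative cutoff' s) (at s)"
proof -
  have nz: "1 + (max 0 t)\<^sup>2 \<noteq> 0" for t :: real
    by (metis add.commute power_one sum_power2_eq_zero_iff zero_neq_one)
  have "((\<lambda>s. (max 0 s)\<^sup>2 / (1 + (max 0 s)\<^sup>2)) has_real_derivative
     (2 * max 0 s * (1 + (max 0 s)\<^sup>2) - (max 0 s)\<^sup>2 * (0 + 2 * max 0 s)) /
     ((1 + (max 0 s)\<^sup>2) * (1 + (max 0 s)\<^sup>2))) (at s)"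
    by (intro DERIV_divide DERIV_add DERIV_const DERIV_max_square nz)
  then show ?thesis unfolding cutoff_def[abs_def] cutoff'_def
    by (simp add: power2_eq_square algebra_simps)
qed

lemma continuous_cutoff': "continuous_on UNIV cutoff'"
proof -
  have nz: "1 + (max 0 t)\<^sup>2 \<noteq> 0" for t :: real
    by (metis add.commute power_one sum_power2_eq_zero_iff zero_neq_one)
  show ?thesis unfolding cutoff'_def[abs_def] by (intro continuous_intros) (use nz in auto)
qed

lemma cutoff_bounds: "0 \<le> cutoff s" "cutoff s \<le> 1" "s \<le> 0 \<Longrightarrow> cutoff s = 0"
proof -
  have "1 + (max 0 s)\<^sup>2 > 0" by (simp add: add_pos_nonneg)
  then show "0 \<le> cutoff s" "cutoff s \<le> 1" "s \<le> 0 \<Longrightarrow> cutoff s = 0"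
    by (auto simp: cutoff_def divide_le_eq)
qed

text \<open>In the application \<open>s + 1\<close> is \<open>k * (1 - x \<bullet> x)\<close>, so
  the second bound controls the derivative of the cutoff, weighted with
  \<open>1 - x \<bullet> x\<close>, both uniformly and in the limit. The 8 is 4 times the 2 in
  \<open>s\<^sup>2 + s \<le> 2 * (1 + s\<^sup>2)\<close>.\<close>

lemma cutoff'_bounds: "0 \<le> cutoff' s" "2 * (s + 1) * cutoff' s \<le> 8 / (1 + s\<^sup>2)"
proof -
  show "0 \<le> cutoff' s" unfolding cutoff'_def by auto
  have p: "1 + s\<^sup>2 > 0" by (simp add: add_pos_nonneg)
  show "2 * (s + 1) * cutoff' s \<le> 8 / (1 + s\<^sup>2)"
  proof (cases "s \<le> 0")
    case True
    then have "cutoff' s = 0" by (simp add: cutoff'_def)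
    then show ?thesis using p by simp
  next
    case False
    have cancel: "4 * (2 * a) / a\<^sup>2 = 8 / a" if "a > 0" for a :: real
      using that by (simp add: power2_eq_square)
    define y where "y = s\<^sup>2"
    have "2 * s \<le> y + 1" "0 \<le> y" using sum_squares_bound[of s 1] by (simp_all add: y_def)
    then have "y + s \<le> 2 * (1 + y)" by argo
    then have "s\<^sup>2 + s \<le> 2 * (1 + s\<^sup>2)" by (simp only: y_def)
    moreover have "(s + 1) * s = s\<^sup>2 + s" by (simp add: power2_eq_square algebra_simps)
    ultimately have "(s + 1) * s \<le> 2 * (1 + s\<^sup>2)" by (simp only:)
    then have "4 * ((s + 1) * s) / (1 + s\<^sup>2)\<^sup>2 \<le> 4 * (2 * (1 + s\<^sup>2)) / (1 + s\<^sup>2)\<^sup>2"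
      by (intro divide_right_mono) auto
    also have "\<dots> = 8 / (1 + s\<^sup>2)" by (rule cancel[OF p])
    finally show ?thesis using False by (simp add: cutoff'_def mult_ac)
  qed
qed

lemma cutoff_tendsto: "(cutoff \<longlongrightarrow> 1) at_top"
proof -
  have "((\<lambda>s::real. 1 - inverse (1 + s\<^sup>2)) \<longlongrightarrow> 1 - 0) at_top"
    by (intro tendsto_diff tendsto_const tendsto_inverse_0_at_top filterlim_tendsto_add_at_top
        filterlim_pow_at_top filterlim_ident) auto
  moreover have "\<forall>\<^sub>F s in at_top. 1 - inverse (1 + s\<^sup>2) = cutoff s"
  proof (rule eventually_mono[OF eventually_gt_at_top[of 0]])
    fix s :: real assume "s > 0"
    then show "1 - inverse (1 + s\<^sup>2) = cutoff s"
      using add_pos_nonneg[of 1 "s\<^sup>2"] by (simp add: cutoff_def field_simps)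
  qed
  ultimately show ?thesis using Lim_transform_eventually by fastforce
qed

lemma C1_grad_cutoff:
  "C1_grad (\<lambda>x::'a::euclidean_space. cutoff (k * (1 - x \<bullet> x) - 1))
     (\<lambda>x. (- 2 * k * cutoff' (k * (1 - x \<bullet> x) - 1)) *\<^sub>R x)"
  unfolding C1_grad_def
proof (intro conjI allI)
  show "continuous_on UNIV (\<lambda>x::'a. (- 2 * k * cutoff' (k * (1 - x \<bullet> x) - 1)) *\<^sub>R x)"
    by (intro continuous_intros continuous_on_compose2[OF continuous_cutoff']) auto
  fix x :: 'a
  have "((\<lambda>x. k * (1 - x \<bullet> x) - 1) has_derivative (\<lambda>h. - 2 * k * (x \<bullet> h))) (at x)"
    by (auto intro!: derivative_eq_intros simp: inner_commute)
  moreover have "(cutoff has_derivative (\<lambda>h. cutoff' (k * (1 - x \<bullet> x) - 1) * h)) (at (k * (1 - x \<bullet> x) - 1))"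
    using DERIV_cutoff by (simp add: has_field_derivative_def)
  ultimately have "(cutoff \<circ> (\<lambda>x. k * (1 - x \<bullet> x) - 1) has_derivative
      (\<lambda>h. cutoff' (k * (1 - x \<bullet> x) - 1) * h) \<circ> (\<lambda>h. - 2 * k * (x \<bullet> h))) (at x)"
    by (rule diff_chain_at)
  then show "((\<lambda>x. cutoff (k * (1 - x \<bullet> x) - 1)) has_derivative
      (\<lambda>h. ((- 2 * k * cutoff' (k * (1 - x \<bullet> x) - 1)) *\<^sub>R x) \<bullet> h)) (at x)"
    by (simp add: o_def mult_ac)
qed

text \<open>Near the sphere \<open>q\<close> has a bounded derivative and vanishes at 1. Below 1 /
  2, where the formula for the derivative divides by a small \<open>r\<close>, boundedness suffices
  because \<open>1 \<le> 2 * (1 - r\<^sup>2)\<close>; hence the summand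
  \<open>2 * C2\<close>.\<close>

lemma radial_flux_linear_bound:
  assumes ode: "radial_ode n u q w" and q1: "q 1 = 0"
  obtains C where "C \<ge> 0" "\<And>r. 0 \<le> r \<Longrightarrow> r \<le> 1 \<Longrightarrow> \<bar>q r\<bar> \<le> C * (1 - r\<^sup>2)"
proof -
  have bdd: "\<exists>C\<ge>0. \<forall>r\<in>{a..1}. \<bar>F r\<bar> \<le> C" if "continuous_on {a..1} F" for F :: "real \<Rightarrow> real" and a :: real
  proof -
    have "bounded (F ` {a..1})" by (intro compact_imp_bounded compact_continuous_image that) auto
    then obtain C where "\<forall>y\<in>F ` {a..1}. norm y \<le> C" by (auto simp only: bounded_iff)
    then have "\<forall>r\<in>{a..1}. \<bar>F r\<bar> \<le> \<bar>C\<bar>" by (intro ballI order_trans[OF _ abs_ge_self]) auto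
    then show ?thesis by (intro exI[of _ "\<bar>C\<bar>"]) auto
  qed
  note c = continuous_on_subset[OF radial_odeD(1)[OF ode]] continuous_on_subset[OF radial_odeD(2)[OF ode]]
  obtain C1 where C1: "C1 \<ge> 0" "\<forall>r\<in>{1/2..1}. \<bar>(- w r - real n * q r) / r\<bar> \<le> C1"
    using bdd[of "1/2" "\<lambda>r. (- w r - real n * q r) / r"]
    by (force intro!: continuous_intros c)
  obtain C2 where C2: "C2 \<ge> 0" "\<forall>r\<in>{0..1}. \<bar>q r\<bar> \<le> C2"
    using bdd[of 0 q] by (force intro!: c)
  show ?thesis
  proof (rule that[of "C1 + 2 * C2"])
    show "C1 + 2 * C2 \<ge> 0" using C1 C2 by simp
    fix r :: real assume r: "0 \<le> r" "r \<le> 1"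
    have r2: "1 - r\<^sup>2 \<ge> 0" using r by (simp add: power_le_one)
    show "\<bar>q r\<bar> \<le> (C1 + 2 * C2) * (1 - r\<^sup>2)"
    proof (cases "r < 1/2")
      case True
      have "r\<^sup>2 \<le> (1/2)\<^sup>2" using r True by (intro power_mono) auto
      then have "C2 * 1 \<le> C2 * (2 * (1 - r\<^sup>2))" using C2(1) by (intro mult_left_mono) (auto simp: power2_eq_square)
      moreover have "\<bar>q r\<bar> \<le> C2" using C2(2) r by auto
      moreover have "C1 * (1 - r\<^sup>2) \<ge> 0" using C1 r2 by simp
      moreover have "(C1 + 2 * C2) * (1 - r\<^sup>2) = C1 * (1 - r\<^sup>2) + C2 * (2 * (1 - r\<^sup>2))"
        by (simp add: algebra_simps)
      ultimately show ?thesis by linarith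
    next
      case False
      have "norm (q r - q 1) \<le> C1 * norm (r - 1)"
      proof (rule field_differentiable_bound[where f=q and f'="\<lambda>z. (- w z - real n * q z) / z" and S="{1/2..1}"])
        fix z :: real assume z: "z \<in> {1/2..1}"
        then show "(q has_field_derivative (- w z - real n * q z) / z) (at z within {1/2..1})"
          using has_field_derivative_at_within[OF radial_odeD(5)[OF ode]] by simp
        show "norm ((- w z - real n * q z) / z) \<le> C1"
          unfolding real_norm_def by (rule bspec[OF C1(2) z])
      qed (use r False in auto)
      then have "\<bar>q r\<bar> \<le> C1 * (1 - r)" using r(2) by (simp add: q1)
      also have "\<dots> \<le> C1 * (1 - r\<^sup>2)"
        using r C1 by (intro mult_left_mono) (auto simp: power2_eq_square mult_left_le)
      also have "\<dots> \<le> (C1 + 2 * C2) * (1 - r\<^sup>2)"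
        using r2 C2 by (intro mult_right_mono) auto
      finally show ?thesis .
    qed
  qed
qed


lemma H1_ball_integrable:
  assumes "H1_ball u G"
  shows "set_integrable lebesgue unit_ball u" "set_integrable lebesgue unit_ball G"
proof -
  have *: "set_borel_measurable lebesgue unit_ball u" "set_borel_measurable lebesgue unit_ball G"
     "set_integrable lebesgue unit_ball (\<lambda>x. (u x)\<^sup>2)" "set_integrable lebesgue unit_ball (\<lambda>x. (norm (G x))\<^sup>2)"
    using assms unfolding H1_ball_def by blast+
  show "set_integrable lebesgue unit_ball u"
    by (rule set_integrable_of_square[OF *(1)]) (use *(3) in simp)
  show "set_integrable lebesgue unit_ball G"
    by (rule set_integrable_of_square[OF *(2) *(4)])
qed

text \<open>The weak gradient of \<open>u\<close> is tested with the components of the cut-off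
  field, and the results are summed over the directions. The bracket on the left is minus the
  divergence of that field; its second term comes from differentiating the cutoff.\<close>

lemma cutoff_flux_identity:
  fixes u :: "'a::euclidean_space \<Rightarrow> real"
  assumes H: "H1_ball u G" and ode: "radial_ode DIM('a) \<psi> q w" and k: "k \<ge> 1"
  shows "(LINT x:unit_ball|lebesgue. u x * (cutoff (k * (1 - x \<bullet> x) - 1) * w (norm x)
        + 2 * k * cutoff' (k * (1 - x \<bullet> x) - 1) * q (norm x) * (x \<bullet> x)))
    = (LINT x:unit_ball|lebesgue. ((q (norm x) *\<^sub>R x) \<bullet> G x) * cutoff (k * (1 - x \<bullet> x) - 1))"
proof -
  define \<eta> where "\<eta> x = cutoff (k * (1 - x \<bullet> x) - 1)" for x :: 'a
  define \<eta>' where "\<eta>' x = cutoff' (k * (1 - x \<bullet> x) - 1)" for x :: 'a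
  define X where "X e x = q (norm x) *\<^sub>R e +
     ((- w (norm x) - real DIM('a) * q (norm x)) / (norm x)\<^sup>2 * (x \<bullet> e)) *\<^sub>R x" for e x :: 'a
  define \<phi> where "\<phi> e x = q (norm x) * (x \<bullet> e) * \<eta> x" for e x
  define D where "D e x = (q (norm x) * (x \<bullet> e)) *\<^sub>R ((- 2 * k * \<eta>' x) *\<^sub>R x) + \<eta> x *\<^sub>R X e x" for e x
  have C1: "C1_grad (\<phi> e) (D e)" for e
    unfolding \<phi>_def[abs_def] D_def[abs_def] X_def \<eta>_def \<eta>'_def
    by (intro C1_grad_mult C1_grad_radial_flux[OF ode] C1_grad_cutoff) auto
  \<comment> \<open>The shift by 1 inside the cutoff is what makes this set compact in the open
    ball.\<close>
  define K where "K = {x::'a. 1 \<le> k * (1 - x \<bullet> x)}"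
  have Kb: "K \<subseteq> unit_ball"
  proof
    fix x :: 'a assume "x \<in> K"
    then have "0 < k * (1 - x \<bullet> x)" by (simp add: K_def)
    then have "x \<bullet> x < 1" using k by (simp add: zero_less_mult_iff)
    then show "x \<in> unit_ball" by (simp add: norm_eq_sqrt_inner)
  qed
  have "closed K" unfolding K_def by (intro closed_Collect_le continuous_intros)
  then have "compact K" using Kb bounded_subset[OF bounded_ball] by (simp add: compact_eq_bounded_closed)
  moreover have "\<phi> e x = 0" if "x \<notin> K" for e x
    using that cutoff_bounds(3)[of "k * (1 - x \<bullet> x) - 1"] by (simp add: K_def \<phi>_def \<eta>_def)
  ultimately have weak: "(LINT x:unit_ball|lebesgue. u x *\<^sub>R D e x) = - (LINT x:unit_ball|lebesgue. \<phi> e x *\<^sub>R G x)" for e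
    using H C1[of e] Kb unfolding H1_ball_def by blast
  have ui: "set_integrable lebesgue unit_ball u" and Gi: "set_integrable lebesgue unit_ball G"
    using H1_ball_integrable[OF H] by simp_all
  have uD: "set_integrable lebesgue unit_ball (\<lambda>x. u x *\<^sub>R D e x)" for e
    by (rule set_integrable_bilinear_continuous[OF bounded_bilinear_scaleR ui C1_gradD(2)[OF C1]])
  have \<phi>G: "set_integrable lebesgue unit_ball (\<lambda>x. \<phi> e x *\<^sub>R G x)" for e
    using set_integrable_bilinear_continuous[OF bounded_bilinear.flip[OF bounded_bilinear_scaleR] Gi C1_gradD(3)[OF C1]] .
  have sumD: "(\<Sum>e\<in>Basis. e \<bullet> (u x *\<^sub>R D e x)) =
      - (u x * (\<eta> x * w (norm x) + 2 * k * \<eta>' x * q (norm x) * (x \<bullet> x)))" for x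
  proof -
    have "(\<Sum>e\<in>Basis. e \<bullet> (u x *\<^sub>R D e x)) =
      (\<Sum>e\<in>Basis. u x * (q (norm x) * (- 2 * k * \<eta>' x)) * ((x \<bullet> e) * (x \<bullet> e)) + u x * \<eta> x * (e \<bullet> X e x))"
      unfolding D_def by (intro sum.cong) (auto simp: inner_add_right inner_commute algebra_simps)
    also have "\<dots> = u x * (q (norm x) * (- 2 * k * \<eta>' x)) * (\<Sum>e\<in>Basis. (x \<bullet> e) * (x \<bullet> e))
        + u x * \<eta> x * (\<Sum>e\<in>Basis. e \<bullet> X e x)"
      by (simp only: sum.distrib sum_distrib_left)
    also have "\<dots> = u x * (q (norm x) * (- 2 * k * \<eta>' x)) * (x \<bullet> x) + u x * \<eta> x * - w (norm x)"
      by (simp only: X_def radial_flux_divergence[OF ode] euclidean_inner[of x x])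
    finally show ?thesis by (simp add: algebra_simps)
  qed
  have sum\<phi>: "(\<Sum>e\<in>Basis. e \<bullet> (\<phi> e x *\<^sub>R G x)) = ((q (norm x) *\<^sub>R x) \<bullet> G x) * \<eta> x" for x
  proof -
    have "(\<Sum>e\<in>Basis. e \<bullet> (\<phi> e x *\<^sub>R G x)) = (\<Sum>e\<in>Basis. (q (norm x) * \<eta> x) * ((x \<bullet> e) * (G x \<bullet> e)))"
      unfolding \<phi>_def by (intro sum.cong) (auto simp: inner_commute)
    also have "\<dots> = (q (norm x) * \<eta> x) * (x \<bullet> G x)"
      by (simp only: sum_distrib_left[symmetric] euclidean_inner[of x "G x"])
    finally show ?thesis by simp
  qed
  have "(LINT x:unit_ball|lebesgue. (\<Sum>e\<in>Basis. e \<bullet> (u x *\<^sub>R D e x)))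
     = - (LINT x:unit_ball|lebesgue. (\<Sum>e\<in>Basis. e \<bullet> (\<phi> e x *\<^sub>R G x)))"
    unfolding integral_sum_inner_Basis[OF uD] integral_sum_inner_Basis[OF \<phi>G] weak
    by (simp add: sum_negf)
  then have "- (LINT x:unit_ball|lebesgue. u x * (\<eta> x * w (norm x) + 2 * k * \<eta>' x * q (norm x) * (x \<bullet> x)))
    = - (LINT x:unit_ball|lebesgue. ((q (norm x) *\<^sub>R x) \<bullet> G x) * \<eta> x)"
    unfolding sumD sum\<phi> by (simp add: set_lebesgue_integral_def)
  then show ?thesis unfolding \<eta>_def \<eta>'_def by simp
qed

text \<open>Green's formula for an H1 function without a trace. The derivative of the cutoff brings
  a factor \<open>k\<close>, but the linear vanishing of \<open>q\<close> at the sphere bounds that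
  term by \<open>C * (8 / (1 + s\<^sup>2))\<close>, which is bounded and tends to 0 at each point of
  the ball.\<close>

lemma H1_ball_flux_integral:
  fixes u :: "'a::euclidean_space \<Rightarrow> real"
  assumes H: "H1_ball u G" and ode: "radial_ode DIM('a) \<psi> q w" and q1: "q 1 = 0"
  shows "(LINT x:unit_ball|lebesgue. u x * w (norm x)) = (LINT x:unit_ball|lebesgue. (q (norm x) *\<^sub>R x) \<bullet> G x)"
proof -
  define s where "s m x = (real m + 1) * (1 - x \<bullet> x) - 1" for m and x :: 'a
  define c where "c m x = cutoff (s m x) * w (norm x)
        + 2 * (real m + 1) * cutoff' (s m x) * q (norm x) * (x \<bullet> x)" for m and x :: 'a
  have eq: "(LINT x:unit_ball|lebesgue. u x * c m x)
      = (LINT x:unit_ball|lebesgue. ((q (norm x) *\<^sub>R x) \<bullet> G x) * cutoff (s m x))" for m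
    unfolding c_def s_def by (rule cutoff_flux_identity[OF H ode]) simp
  have ui: "set_integrable lebesgue unit_ball u" and Gi: "set_integrable lebesgue unit_ball G"
    using H1_ball_integrable[OF H] by simp_all
  have qG: "set_integrable lebesgue unit_ball (\<lambda>x. (q (norm x) *\<^sub>R x) \<bullet> G x)"
    using set_integrable_bilinear_continuous[OF bounded_bilinear_inner Gi C1_gradD(2)[OF C1_grad_radial[OF ode]]]
    by (simp only: inner_commute)
  have cw: "continuous_on UNIV (\<lambda>x::'a. w (norm x))" and cq: "continuous_on UNIV (\<lambda>x::'a. q (norm x))"
    by (intro continuous_norm_compose radial_odeD[OF ode])+
  have cs: "continuous_on UNIV (s m)" for m
    unfolding s_def by (intro continuous_intros)
  have ccut: "continuous_on UNIV (\<lambda>x. cutoff (s m x))" for m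
    by (rule continuous_on_compose2[OF _ cs]) (auto intro: DERIV_continuous_on[OF DERIV_cutoff])
  have ccut': "continuous_on UNIV (\<lambda>x. cutoff' (s m x))" for m
    by (rule continuous_on_compose2[OF continuous_cutoff' cs]) auto
  have cc: "continuous_on UNIV (c m)" for m
    unfolding c_def by (intro continuous_intros ccut ccut' cw cq)
  have xx: "x \<bullet> x < 1" if "x \<in> unit_ball" for x :: 'a
    using that by (simp add: norm_eq_sqrt_inner)
  have s_inf: "filterlim (\<lambda>m. s m x) at_top sequentially" if x: "x \<in> unit_ball" for x
  proof -
    have "filterlim (\<lambda>m. - 1 + (1 - x \<bullet> x) * (1 + real m)) at_top sequentially"
      using xx[OF x]
      by (intro filterlim_tendsto_add_at_top[OF tendsto_const] filterlim_tendsto_pos_mult_at_top[OF tendsto_const]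
          filterlim_real_sequentially) auto
    then show ?thesis unfolding s_def by (simp add: algebra_simps)
  qed
  have cut1: "(\<lambda>m. cutoff (s m x)) \<longlonglongrightarrow> 1" if "x \<in> unit_ball" for x
    by (rule filterlim_compose[OF cutoff_tendsto s_inf[OF that]])
  obtain W where W: "W \<ge> 0" "\<And>x::'a. x \<in> unit_ball \<Longrightarrow> norm (w (norm x)) \<le> W"
    using continuous_bounded_unit_ball[OF cw] by blast
  obtain C where C: "C \<ge> 0" "\<And>r. 0 \<le> r \<Longrightarrow> r \<le> 1 \<Longrightarrow> \<bar>q r\<bar> \<le> C * (1 - r\<^sup>2)"
    using radial_flux_linear_bound[OF ode q1] by blast
  have second: "\<bar>2 * (real m + 1) * cutoff' (s m x) * q (norm x) * (x \<bullet> x)\<bar> \<le> C * (8 / (1 + (s m x)\<^sup>2))"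
    if x: "x \<in> unit_ball" for m x
  proof -
    have "\<bar>q (norm x)\<bar> * (x \<bullet> x) \<le> (C * (1 - x \<bullet> x)) * 1"
      using C(2)[of "norm x"] x xx[OF x] C(1)
      by (intro mult_mono) (auto simp: power2_norm_eq_inner)
    then have "2 * (real m + 1) * cutoff' (s m x) * (\<bar>q (norm x)\<bar> * (x \<bullet> x))
        \<le> 2 * (real m + 1) * cutoff' (s m x) * ((C * (1 - x \<bullet> x)) * 1)"
      using cutoff'_bounds(1)[of "s m x"] by (intro mult_left_mono) auto
    \<comment> \<open>\<open>(real m + 1) * (1 - x \<bullet> x)\<close> is \<open>s m x + 1\<close>,
      which brings the product into the shape of the bound on \<open>cutoff'\<close>.\<close>
    also have "\<dots> = C * (2 * (s m x + 1) * cutoff' (s m x))"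
      by (simp add: s_def algebra_simps)
    also have "\<dots> \<le> C * (8 / (1 + (s m x)\<^sup>2))"
      using C(1) by (intro mult_left_mono cutoff'_bounds)
    finally show ?thesis using cutoff'_bounds(1)[of "s m x"] by (simp add: abs_mult mult_ac)
  qed
  have lim0: "(\<lambda>m. 2 * (real m + 1) * cutoff' (s m x) * q (norm x) * (x \<bullet> x)) \<longlonglongrightarrow> 0"
    if x: "x \<in> unit_ball" for x
  proof (rule Lim_null_comparison)
    show "\<forall>\<^sub>F m in sequentially. norm (2 * (real m + 1) * cutoff' (s m x) * q (norm x) * (x \<bullet> x))
        \<le> C * (8 / (1 + (s m x)\<^sup>2))"
      using second[OF x] by (intro always_eventually) (simp only: real_norm_def, blast)
    have "((\<lambda>t::real. C * (8 * inverse (1 + t\<^sup>2))) \<longlongrightarrow> C * (8 * 0)) at_top"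
      by (intro tendsto_mult tendsto_const tendsto_inverse_0_at_top filterlim_tendsto_add_at_top
        filterlim_pow_at_top filterlim_ident) auto
    then have "((\<lambda>t::real. C * (8 / (1 + t\<^sup>2))) \<longlongrightarrow> 0) at_top"
      by (simp add: divide_inverse)
    then show "(\<lambda>m. C * (8 / (1 + (s m x)\<^sup>2))) \<longlonglongrightarrow> 0"
      by (rule filterlim_compose[OF _ s_inf[OF x]])
  qed
  have "(\<lambda>m. LINT x:unit_ball|lebesgue. u x * c m x) \<longlonglongrightarrow> (LINT x:unit_ball|lebesgue. u x * w (norm x))"
  proof (rule unit_ball_dominated_convergence(1)[OF ui cc])
    fix m and x :: 'a assume x: "x \<in> unit_ball"
    have "\<bar>cutoff (s m x) * w (norm x)\<bar> \<le> 1 * W"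
      unfolding abs_mult using W(2)[OF x] cutoff_bounds(1,2)[of "s m x"] by (intro mult_mono) auto
    moreover have "C * (8 / (1 + (s m x)\<^sup>2)) \<le> C * 8"
      using C(1) add_pos_nonneg[of 1 "(s m x)\<^sup>2"] by (intro mult_left_mono) (auto simp: divide_le_eq)
    ultimately show "\<bar>c m x\<bar> \<le> W + C * 8"
      using second[OF x, of m] unfolding c_def by linarith
  next
    fix x :: 'a assume x: "x \<in> unit_ball"
    show "(\<lambda>m. c m x) \<longlonglongrightarrow> w (norm x)"
      unfolding c_def using tendsto_add[OF tendsto_mult[OF cut1[OF x] tendsto_const[of "w (norm x)"]] lim0[OF x]] by simp
  qed
  moreover have "(\<lambda>m. LINT x:unit_ball|lebesgue. ((q (norm x) *\<^sub>R x) \<bullet> G x) * cutoff (s m x))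
     \<longlonglongrightarrow> (LINT x:unit_ball|lebesgue. ((q (norm x) *\<^sub>R x) \<bullet> G x) * 1)"
    by (rule unit_ball_dominated_convergence(1)[OF qG ccut, where C=1])
      (use cutoff_bounds in \<open>auto intro: cut1\<close>)
  ultimately show ?thesis unfolding eq
    by (simp add: LIMSEQ_unique)
qed

text \<open>If \<open>u\<close> were positive on a set of positive measure, that set would contain a
  compact \<open>T\<close> that is not null, and the radii of \<open>T\<close> would form a closed
  set \<open>N\<close>. By radiality \<open>u > 0\<close> on all spheres with radius in
  \<open>N\<close>, yet the integral of \<open>u\<close> over their union is 0, as a limit of
  integrals against continuous \<open>h\<close>.\<close>

lemma radial_orthogonal_nonpos:
  fixes u :: "'a::euclidean_space \<Rightarrow> real"
  assumes rad: "radial u" and ui: "set_integrable lebesgue unit_ball u"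
    and orth: "\<And>h. continuous_on UNIV h \<Longrightarrow> (\<And>r. \<bar>h r\<bar> \<le> 1) \<Longrightarrow>
       (LINT x:unit_ball|lebesgue. u x * h (norm x)) = 0"
  shows "AE x in lebesgue. x \<in> unit_ball \<longrightarrow> u x \<le> 0"
proof -
  define v where "v x = indicator unit_ball x *\<^sub>R u x" for x
  have vi: "integrable lebesgue v" using ui unfolding set_integrable_def v_def .
  define A where "A = {x. v x > 0}"
  have Am: "A \<in> sets lebesgue"
    using measurable_sets[OF borel_measurable_integrable[OF vi], of "{0<..}"]
    by (simp add: A_def vimage_def)
  have Ab: "A \<subseteq> unit_ball" by (auto simp: A_def v_def indicator_def split: if_splits)
  have "A \<in> null_sets lebesgue"
  proof (rule ccontr)
    assume nn: "A \<notin> null_sets lebesgue"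
    have Al: "A \<in> lmeasurable"
      using Am Ab bounded_subset[OF bounded_ball] by (intro bounded_set_imp_lmeasurable) auto
    then have pos: "measure lebesgue A > 0"
      using nn Am by (simp add: null_sets_def emeasure_eq_measure2 zero_less_measure_iff)
    \<comment> \<open>Taking the measure of \<open>A\<close> itself as tolerance prevents
      \<open>T\<close> from being null.\<close>
    obtain T where T: "closed T" "T \<subseteq> A" "A - T \<in> lmeasurable" "emeasure lebesgue (A - T) < ennreal (measure lebesgue A)"
      using sets_lebesgue_inner_closed[OF Am pos] by blast
    have Tc: "compact T"
      using T(1,2) Ab bounded_subset[OF bounded_ball, of T 0 1] by (auto simp: compact_eq_bounded_closed)
    have Tn: "T \<notin> null_sets lebesgue"
    proof
      assume T0: "T \<in> null_sets lebesgue"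
      then have "emeasure lebesgue (A - T) = emeasure lebesgue A"
        using Am by (rule emeasure_Diff_null_set)
      then show False using T(4) Al by (simp add: emeasure_eq_measure2)
    qed
    then have Tne: "T \<noteq> {}" by auto
    define N where "N = norm ` T"
    have Nc: "closed N" "N \<noteq> {}"
      using compact_continuous_image[OF continuous_on_norm[OF continuous_on_id] Tc] Tne
      by (auto simp: N_def compact_imp_closed)
    \<comment> \<open>Tents of slope \<open>m\<close> around \<open>N\<close>; they converge to its
      indicator because \<open>N\<close> is closed.\<close>
    define h where "h m r = max 0 (1 - real m * infdist r N)" for m :: nat and r :: real
    have hc: "continuous_on S (h m)" for m S unfolding h_def by (intro continuous_intros)
    have hb: "\<bar>h m r\<bar> \<le> 1" for m r
      unfolding h_def using infdist_nonneg[of r N] by (auto simp: max_def)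
    have hl: "(\<lambda>m. h m r) \<longlonglongrightarrow> indicator N r" for r
    proof (cases "r \<in> N")
      case True
      then show ?thesis by (simp add: h_def)
    next
      case False
      then have d: "infdist r N > 0" using infdist_pos_not_in_closed[OF Nc] by blast
      obtain m0 where m0: "1 / infdist r N < real m0" using reals_Archimedean2 by blast
      have "\<forall>\<^sub>F m in sequentially. 0 = h m r"
      proof (rule eventually_sequentiallyI[of m0])
        fix m assume "m0 \<le> m"
        then have "1 / infdist r N \<le> real m" using m0 by simp
        then have "1 \<le> real m * infdist r N" using d by (simp add: divide_le_eq)
        then show "0 = h m r" by (simp add: h_def)
      qed
      from Lim_transform_eventually[OF tendsto_const this] show ?thesis using False by simp
    qed
    have cn: "continuous_on UNIV (\<lambda>x::'a. h m (norm x))" for m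
      by (rule continuous_norm_compose[OF hc])
    have lim: "(\<lambda>m. LINT x:unit_ball|lebesgue. u x * h m (norm x)) \<longlonglongrightarrow>
        (LINT x:unit_ball|lebesgue. u x * indicator N (norm x))"
      by (rule unit_ball_dominated_convergence(1)[OF ui cn hb hl])
    have int: "set_integrable lebesgue unit_ball (\<lambda>x. u x * indicator N (norm x))"
      by (rule unit_ball_dominated_convergence(2)[OF ui cn hb hl])
    have "(LINT x:unit_ball|lebesgue. u x * h m (norm x)) = 0" for m
      by (rule orth[OF hc hb])
    with lim have "(LINT x:unit_ball|lebesgue. u x * indicator N (norm x)) = 0"
      by (simp add: LIMSEQ_const_iff)
    moreover have posN: "u x > 0" if "x \<in> unit_ball" "norm x \<in> N" for x
    proof -
      obtain y where y: "y \<in> T" "norm x = norm y" using \<open>norm x \<in> N\<close> by (auto simp: N_def)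
      then have "y \<in> A" using T(2) by blast
      then have "y \<in> unit_ball" "u y > 0" using Ab by (auto simp: A_def v_def)
      moreover have "u x = u y" using rad that y \<open>y \<in> unit_ball\<close> unfolding radial_def by blast
      ultimately show ?thesis by simp
    qed
    then have nonneg: "0 \<le> indicator unit_ball x *\<^sub>R (u x * indicator N (norm x))" for x :: 'a
      by (cases "x \<in> unit_ball"; cases "norm x \<in> N") (auto intro: less_imp_le)
    ultimately have "AE x in lebesgue. indicator unit_ball x *\<^sub>R (u x * indicator N (norm x)) = 0"
      using int unfolding set_lebesgue_integral_def set_integrable_def
      by (subst (asm) integral_nonneg_eq_0_iff_AE) auto
    then have "AE x in lebesgue. x \<notin> T"
    proof (rule AE_mp, intro AE_I2 impI notI)
      fix x assume 0: "indicator unit_ball x *\<^sub>R (u x * indicator N (norm x)) = 0" and x: "x \<in> T"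
      then have "x \<in> unit_ball" "norm x \<in> N" using T(2) Ab by (auto simp: N_def)
      with 0 posN[of x] show False by simp
    qed
    then have "T \<in> null_sets lebesgue"
      using T(1) by (subst AE_iff_null_sets) auto
    with Tn show False by simp
  qed
  then have "AE x in lebesgue. x \<notin> A" by (rule AE_not_in)
  then show ?thesis
    by (rule AE_mp) (auto intro!: AE_I2 simp: A_def v_def)
qed

lemma radial_orthogonal_eq_0:
  fixes u :: "'a::euclidean_space \<Rightarrow> real"
  assumes rad: "radial u" and ui: "set_integrable lebesgue unit_ball u"
    and orth: "\<And>h. continuous_on UNIV h \<Longrightarrow> (\<And>r. \<bar>h r\<bar> \<le> 1) \<Longrightarrow>
       (LINT x:unit_ball|lebesgue. u x * h (norm x)) = 0"
  shows "AE x in lebesgue. x \<in> unit_ball \<longrightarrow> u x = 0"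
proof -
  have "AE x in lebesgue. x \<in> unit_ball \<longrightarrow> u x \<le> 0"
    by (rule radial_orthogonal_nonpos[OF assms])
  moreover have "AE x in lebesgue. x \<in> unit_ball \<longrightarrow> - u x \<le> 0"
  proof (rule radial_orthogonal_nonpos[where u="\<lambda>x. - u x"])
    show "radial (\<lambda>x. - u x)" using rad unfolding radial_def neg_equal_iff_equal .
    show "set_integrable lebesgue unit_ball (\<lambda>x. - u x)"
      using ui unfolding set_integrable_def by simp
    fix h :: "real \<Rightarrow> real" assume "continuous_on UNIV h" "\<And>r. \<bar>h r\<bar> \<le> 1"
    from orth[OF this] show "(LINT x:unit_ball|lebesgue. - u x * h (norm x)) = 0"
      by (simp add: set_lebesgue_integral_def)
  qed
  ultimately show ?thesis by eventually_elim auto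
qed

text \<open>The shift by 1 separates the identity from the Laplacian. The eigenfunction is known
  only as an H1 function, so all second derivatives are put on the classical dual solution
  \<open>\<psi>\<close>.\<close>

lemma radial_eigenvalue_flux_eq_0:
  assumes ev: "\<mu> + 1 \<in> radial_neumann_eigenvalues TYPE('a::euclidean_space)"
    and ode: "radial_ode DIM('a) \<phi> q (\<lambda>r. \<mu> * \<phi> r)"
  shows "q 1 = 0"
proof (rule ccontr)
  assume q1: "q 1 \<noteq> 0"
  obtain u :: "'a \<Rightarrow> real" where u: "radial u" "\<not> (AE x in lebesgue. x \<in> unit_ball \<longrightarrow> u x = 0)"
      "neumann_weak_sol (\<lambda>x. (\<mu> + 1) * u x) u"
    using ev unfolding radial_neumann_eigenvalues_def by blast
  then obtain G where H: "H1_ball u G" and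
      weak: "\<And>\<phi> D\<phi>. C1_grad \<phi> D\<phi> \<Longrightarrow> (LINT x:unit_ball|lebesgue. G x \<bullet> D\<phi> x + u x * \<phi> x)
            = (LINT x:unit_ball|lebesgue. (\<mu> + 1) * u x * \<phi> x)"
    unfolding neumann_weak_sol_def by blast
  have ui: "set_integrable lebesgue unit_ball u" and Gi: "set_integrable lebesgue unit_ball G"
    using H1_ball_integrable[OF H] by simp_all
  have "(LINT x:unit_ball|lebesgue. u x * h (norm x)) = 0"
    if h: "continuous_on UNIV h" "\<And>r. \<bar>h r\<bar> \<le> 1" for h
  proof -
    obtain \<psi>0 q0 where \<psi>0: "radial_ode DIM('a) \<psi>0 q0 (\<lambda>r. \<mu> * \<psi>0 r - h r)"
    proof (rule radial_ivp[of "\<lambda>x. \<mu> * x" "\<bar>\<mu>\<bar>" "DIM('a)" h 1])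
      show "\<bar>\<mu> * x - \<mu> * y\<bar> \<le> \<bar>\<mu>\<bar> * \<bar>x - y\<bar>" for x y
        by (simp add: abs_mult flip: right_diff_distrib)
    qed (use h in auto)
    \<comment> \<open>The multiple of \<open>\<phi>\<close> that cancels the flux at
      \<open>r = 1\<close>; here the assumption \<open>q 1 \<noteq> 0\<close> enters.\<close>
    define c where "c = - q0 1 / q 1"
    define \<psi> where "\<psi> r = \<psi>0 r + c * \<phi> r" for r
    define p where "p r = q0 r + c * q r" for r
    have ode\<psi>: "radial_ode DIM('a) \<psi> p (\<lambda>r. \<mu> * \<psi> r - h r)"
      using radial_ode_add_scaled[OF \<psi>0 ode, of c]
      unfolding \<psi>_def p_def by (simp add: algebra_simps)
    have p1: "p 1 = 0" using q1 by (simp add: p_def c_def)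
    have c\<psi>: "continuous_on UNIV (\<lambda>x::'a. \<psi> (norm x))"
      by (intro continuous_norm_compose radial_odeD(7)[OF ode\<psi>])
    have ch: "continuous_on UNIV (\<lambda>x::'a. h (norm x))"
      by (intro continuous_norm_compose continuous_on_subset[OF h(1)]) auto
    have i\<psi>: "set_integrable lebesgue unit_ball (\<lambda>x. u x * \<psi> (norm x))"
      by (rule set_integrable_bilinear_continuous[OF bounded_bilinear_mult ui c\<psi>])
    have ih: "set_integrable lebesgue unit_ball (\<lambda>x. u x * h (norm x))"
      by (rule set_integrable_bilinear_continuous[OF bounded_bilinear_mult ui ch])
    have iG: "set_integrable lebesgue unit_ball (\<lambda>x. G x \<bullet> (p (norm x) *\<^sub>R x))"
      by (rule set_integrable_bilinear_continuous[OF bounded_bilinear_inner Gi C1_gradD(2)[OF C1_grad_radial[OF ode\<psi>]]])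
    define I where "I = (LINT x:unit_ball|lebesgue. u x * \<psi> (norm x))"
    \<comment> \<open>The integral of \<open>G\<close> against the gradient of \<open>\<psi>\<close>
      is \<open>\<mu> * I\<close> by the weak equation, and \<open>\<mu> * I\<close> minus the
      integral of \<open>u h\<close> by Green's formula.\<close>
    have "(LINT x:unit_ball|lebesgue. G x \<bullet> (p (norm x) *\<^sub>R x)) + I = (\<mu> + 1) * I"
      using weak[OF C1_grad_radial[OF ode\<psi>]] unfolding I_def
      by (simp only: set_integral_add[OF iG i\<psi>] mult.assoc set_integral_mult_right)
    moreover have "(LINT x:unit_ball|lebesgue. u x * (\<mu> * \<psi> (norm x) - h (norm x)))
        = (LINT x:unit_ball|lebesgue. G x \<bullet> (p (norm x) *\<^sub>R x))"
      using H1_ball_flux_integral[OF H ode\<psi> p1] by (simp only: inner_commute)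
    moreover have "(LINT x:unit_ball|lebesgue. u x * (\<mu> * \<psi> (norm x) - h (norm x)))
        = (LINT x:unit_ball|lebesgue. \<mu> * (u x * \<psi> (norm x)) - u x * h (norm x))"
      by (simp add: algebra_simps)
    moreover have "\<dots> = \<mu> * I - (LINT x:unit_ball|lebesgue. u x * h (norm x))"
      unfolding I_def by (subst set_integral_diff) (auto intro: i\<psi> ih)
    ultimately show ?thesis by (simp add: algebra_simps)
  qed
  from radial_orthogonal_eq_0[OF u(1) ui this] u(2) show False by blast
qed


section \<open>The two lowest radial eigenvalues\<close>

lemma radial_ode_flux_term_deriv:
  assumes ode: "radial_ode n u q w" and r: "r > 0"
  shows "((\<lambda>r. r * q r) has_real_derivative - w r - (real n - 1) * q r) (at r)"
  using r by (auto intro!: derivative_eq_intros radial_odeD(5)[OF ode] simp: field_simps)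

lemma continuous_nonzero_neg:
  fixes q :: "real \<Rightarrow> real"
  assumes "continuous_on {0..} q" "q 0 < 0" "\<And>r. 0 < r \<Longrightarrow> r \<le> R \<Longrightarrow> q r \<noteq> 0" "0 \<le> r" "r \<le> R"
  shows "q r < 0"
proof (rule ccontr)
  assume "\<not> q r < 0"
  then have "\<exists>x\<ge>0. x \<le> r \<and> q x = 0"
    using assms by (intro IVT') (auto intro: continuous_on_subset[OF assms(1)])
  then obtain x where "0 \<le> x" "x \<le> r" "q x = 0" by auto
  then show False using assms(2,3,5) by (cases "x = 0") auto
qed

lemma radial_ode_antimono:
  assumes ode: "radial_ode n u q w" and q: "\<And>t. a < t \<Longrightarrow> t < b \<Longrightarrow> q t \<le> 0" and ab: "0 \<le> a" "a \<le> b"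
  shows "u b \<le> u a"
proof (rule DERIV_nonpos_imp_decreasing_open[OF ab(2)])
  show "continuous_on {a..b} u" using ab by (intro continuous_on_subset[OF radial_odeD(7)[OF ode]]) auto
  fix t assume t: "a < t" "t < b"
  then show "\<exists>y. (u has_real_derivative y) (at t) \<and> y \<le> 0"
    using radial_odeD(6)[OF ode, of t] q[OF t] ab by (intro exI[of _ "t * q t"]) (auto intro: mult_nonneg_nonpos)
qed

lemma radial_ode_mono:
  assumes ode: "radial_ode n u q w" and n: "n > 0"
    and q: "\<And>t. a < t \<Longrightarrow> t < b \<Longrightarrow> q t \<ge> 0" and ab: "0 \<le> a" "a \<le> b"
  shows "u a \<le> u b"
  using radial_ode_antimono[OF radial_ode_uminus[OF ode n], of a b] q ab by simp

lemma radial_ode_strict_antimono: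
  assumes ode: "radial_ode n u q w" and q: "\<And>t. a < t \<Longrightarrow> t < b \<Longrightarrow> q t < 0" and ab: "0 \<le> a" "a < b"
  shows "u b < u a"
proof (rule DERIV_neg_imp_decreasing_open[OF ab(2)])
  show "continuous_on {a..b} u" using ab by (intro continuous_on_subset[OF radial_odeD(7)[OF ode]]) auto
  fix t assume t: "a < t" "t < b"
  then show "\<exists>y. (u has_real_derivative y) (at t) \<and> y < 0"
    using radial_odeD(6)[OF ode, of t] q[OF t] ab by (intro exI[of _ "t * q t"]) (auto intro: mult_pos_neg)
qed

text \<open>While \<open>\<phi>\<close> is positive and decreasing, \<open>y = - \<phi>' / \<phi>\<close> satisfies
  \<open>y' = 1 - (n - 1) y / r + y\<^sup>2 \<ge> (1 + y\<^sup>2) / 2\<close> for \<open>r \<ge> n\<close>, so it blows up in finite time.\<close>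

lemma bessel_nonpos_exists:
  assumes ode: "radial_ode n \<phi> q \<phi>" and n: "n > 0" and neg: "\<And>r. r \<ge> 0 \<Longrightarrow> q r < 0"
  shows "\<exists>r>0. \<phi> r \<le> 0"
proof (rule ccontr)
  assume "\<not> ?thesis"
  then have pos: "\<phi> r > 0" if "r > 0" for r using that by (meson not_le)
  define y where "y r = - (r * q r) / \<phi> r" for r
  \<comment> \<open>Monotonicity of \<open>h\<close> makes \<open>arctan (y r)\<close> grow by at
    least 4 on an interval of length 8, while its range has length \<open>pi < 4\<close>.\<close>
  define h where "h r = arctan (y r) - r / 2" for r
  have "h (real n) \<le> h (real n + 8)"
  proof (rule DERIV_nonneg_imp_nondecreasing[where f=h])
    fix r assume "real n \<le> r" "r \<le> real n + 8"
    then have r: "r > 0" "real n \<le> r" using n by auto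
    define Y where "Y = (- (- \<phi> r - (real n - 1) * q r) * \<phi> r - - (r * q r) * (r * q r)) / (\<phi> r * \<phi> r)"
    have dy: "(y has_real_derivative Y) (at r)"
      unfolding y_def Y_def using pos[OF r(1)]
      by (intro DERIV_divide DERIV_minus radial_ode_flux_term_deriv[OF ode r(1)] radial_odeD(6)[OF ode r(1)]) auto
    have dh: "(h has_real_derivative inverse (1 + (y r)\<^sup>2) * Y - 1 / 2) (at r)"
      unfolding h_def
      by (intro DERIV_diff DERIV_chain2[OF DERIV_arctan dy]) (auto intro!: derivative_eq_intros)
    have y0: "y r \<ge> 0" using neg[of r] r pos[OF r(1)]
      by (auto simp: y_def intro!: divide_nonpos_pos mult_nonneg_nonpos)
    have "Y = 1 - (real n - 1) / r * y r + (y r)\<^sup>2"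
      using pos[OF r(1)] r by (simp add: Y_def y_def field_simps power2_eq_square)
    moreover have "(real n - 1) / r * y r \<le> 1 * y r"
      using r y0 by (intro mult_right_mono) (auto simp: divide_le_eq)
    moreover have "2 * y r * 1 \<le> (y r)\<^sup>2 + 1\<^sup>2" by (rule sum_squares_bound)
    ultimately have "1 + (y r)\<^sup>2 \<le> 2 * Y" unfolding power_one by argo
    then have "inverse (1 + (y r)\<^sup>2) * Y - 1 / 2 \<ge> 0"
      using add_pos_nonneg[of 1 "(y r)\<^sup>2"] by (simp add: field_simps)
    with dh show "\<exists>y. (h has_real_derivative y) (at r) \<and> 0 \<le> y" by blast
  qed simp
  moreover have "arctan (y (real n + 8)) < pi / 2" "arctan (y (real n)) > - (pi / 2)"
    using arctan_ubound arctan_lbound by auto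
  ultimately show False using pi_less_4 unfolding h_def by argo
qed

text \<open>If \<open>q\<close> stayed negative, \<open>\<phi>\<close> would eventually be at most
  some \<open>- c < 0\<close>. From then on the derivative \<open>- \<phi> - (n - 1) * q\<close> of
  \<open>\<phi>' = r * q\<close> is at least \<open>c\<close>, so \<open>\<phi>'\<close> reaches 0
  in finite time.\<close>

lemma bessel_flux_zero_exists:
  assumes ode: "radial_ode n \<phi> q \<phi>" and n: "n > 0" and \<phi>0: "\<phi> 0 = 1"
  shows "\<exists>R>0. q R = 0"
proof (rule ccontr)
  assume "\<not> ?thesis"
  then have nz: "q R \<noteq> 0" if "R > 0" for R using that by blast
  have "q 0 < 0" using radial_odeD(3)[OF ode] \<phi>0 n by simp
  then have neg: "q r < 0" if "r \<ge> 0" for r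
    using continuous_nonzero_neg[OF radial_odeD(1)[OF ode], of r r] nz that by auto
  obtain \<rho> where \<rho>: "\<rho> > 0" "\<phi> \<rho> \<le> 0" using bessel_nonpos_exists[OF ode n neg] by blast
  define c where "c = - \<phi> (\<rho> + 1)"
  have "\<phi> (\<rho> + 1) < \<phi> \<rho>"
    using \<rho>(1) neg by (intro radial_ode_strict_antimono[OF ode]) auto
  then have c: "c > 0" using \<rho>(2) by (simp add: c_def)
  define p where "p r = r * q r - c * r" for r
  \<comment> \<open>At \<open>T\<close> a line of slope \<open>c\<close> that starts at
    \<open>(\<rho> + 1) * q (\<rho> + 1)\<close> has reached 0.\<close>
  define T where "T = \<rho> + 1 + \<bar>(\<rho> + 1) * q (\<rho> + 1)\<bar> / c"
  have T: "T \<ge> \<rho> + 1" using c by (simp add: T_def)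
  have "p (\<rho> + 1) \<le> p T"
  proof (rule DERIV_nonneg_imp_nondecreasing[OF T])
    fix r assume r: "\<rho> + 1 \<le> r" "r \<le> T"
    then have r0: "r > 0" using \<rho> by simp
    have "(p has_real_derivative (- \<phi> r - (real n - 1) * q r) - c * 1) (at r)"
      unfolding p_def by (intro DERIV_diff radial_ode_flux_term_deriv[OF ode r0] DERIV_cmult DERIV_ident)
    moreover have "\<phi> r \<le> \<phi> (\<rho> + 1)"
      using r \<rho> neg by (intro radial_ode_antimono[OF ode]) (auto intro: less_imp_le)
    moreover have "(real n - 1) * q r \<le> 0"
      using n neg[of r] r0 by (intro mult_nonneg_nonpos) auto
    ultimately show "\<exists>y. (p has_real_derivative y) (at r) \<and> 0 \<le> y"
      by (intro exI[of _ "(- \<phi> r - (real n - 1) * q r) - c * 1"]) (auto simp: c_def)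
  qed
  then have "T * q T \<ge> (\<rho> + 1) * q (\<rho> + 1) + c * (T - (\<rho> + 1))"
    by (simp add: p_def algebra_simps)
  also have "c * (T - (\<rho> + 1)) = \<bar>(\<rho> + 1) * q (\<rho> + 1)\<bar>" using c by (simp add: T_def)
  finally have "T * q T \<ge> 0" by (smt (verit) abs_ge_minus_self)
  moreover have "T * q T < 0" using T \<rho> neg[of T] by (intro mult_pos_neg) auto
  ultimately show False by simp
qed

lemma AE_unit_ball_continuous:
  fixes f g :: "'a::euclidean_space \<Rightarrow> real"
  assumes "AE x in lebesgue. x \<in> unit_ball \<longrightarrow> f x = g x" "continuous_on UNIV f" "continuous_on UNIV g" "x \<in> unit_ball"
  shows "f x = g x"
proof (rule ccontr)
  assume ne: "f x \<noteq> g x"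
  define S where "S = unit_ball \<inter> {x. f x \<noteq> g x}"
  have "open {x. f x \<noteq> g x}" by (intro open_Collect_neq assms)
  then have S: "open S" unfolding S_def by auto
  have "AE x in lebesgue. x \<notin> S" using assms(1) by eventually_elim (auto simp: S_def)
  then have "S \<in> null_sets lebesgue" using S by (subst AE_iff_null_sets) auto
  then have "negligible S" by (simp add: negligible_iff_null_sets)
  then have "S = {}" using open_not_negligible[OF S] by blast
  then show False using ne assms(4) by (auto simp: S_def)
qed

lemma radial_neumann_eigenvalueI:
  assumes ode: "radial_ode DIM('a::euclidean_space) u q (\<lambda>r. \<mu> * u r)" and "q 1 = 0" "u 0 \<noteq> 0"
  shows "\<mu> + 1 \<in> radial_neumann_eigenvalues TYPE('a)"
  unfolding radial_neumann_eigenvalues_def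
proof (intro CollectI exI conjI)
  show "radial (\<lambda>x::'a. u (norm x))" by (simp add: radial_def)
  show "neumann_weak_sol (\<lambda>x::'a. (\<mu> + 1) * u (norm x)) (\<lambda>x. u (norm x))"
    by (rule neumann_weak_sol_radial[OF ode assms(2)]) (simp add: algebra_simps)
  have cu: "continuous_on UNIV (\<lambda>x::'a. u (norm x))"
    by (intro continuous_norm_compose radial_odeD(7)[OF ode])
  show "\<not> (AE x::'a in lebesgue. x \<in> unit_ball \<longrightarrow> u (norm x) = 0)"
    using AE_unit_ball_continuous[OF _ cu continuous_on_const, of 0 0] assms(3) by auto
qed

lemma radial_linear_ivp:
  assumes "n > 0"
  obtains \<phi> q where "radial_ode n \<phi> q (\<lambda>r. \<mu> * \<phi> r)" "\<phi> 0 = 1"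
proof (rule radial_ivp[of "\<lambda>x. \<mu> * x" "\<bar>\<mu>\<bar>" n "\<lambda>_. 0" 0 1])
  show "\<bar>\<mu> * x - \<mu> * y\<bar> \<le> \<bar>\<mu>\<bar> * \<bar>x - y\<bar>" for x y
    by (simp add: abs_mult flip: right_diff_distrib)
qed (use assms that in auto)

text \<open>This makes the set behind \<open>lambda2_rad\<close> nonempty. A zero \<open>R\<close>
  of the flux for parameter 1 is scaled to radius 1, which yields parameter
  \<open>R\<^sup>2\<close>.\<close>

lemma radial_neumann_eigenvalue_gt_1: "\<exists>\<mu>>0. \<mu> + 1 \<in> radial_neumann_eigenvalues TYPE('a::euclidean_space)"
proof -
  have n: "DIM('a) > 0" by simp
  obtain \<phi> q where ode: "radial_ode DIM('a) \<phi> q (\<lambda>r. 1 * \<phi> r)" and \<phi>0: "\<phi> 0 = 1"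
    using radial_linear_ivp[OF n, of 1] by blast
  then have "radial_ode DIM('a) \<phi> q \<phi>" by simp
  from bessel_flux_zero_exists[OF this n \<phi>0] obtain R where R: "R > 0" "q R = 0" by blast
  have "R\<^sup>2 + 1 \<in> radial_neumann_eigenvalues TYPE('a)"
    using radial_ode_rescale[OF ode R(1)] R(2) \<phi>0
    by (intro radial_neumann_eigenvalueI[where u="\<lambda>r. \<phi> (R * r)" and q="\<lambda>r. R\<^sup>2 * q (R * r)"]) auto
  then show ?thesis using R(1) by (intro exI[of _ "R\<^sup>2"]) auto
qed

text \<open>Multiplying the equation by \<open>\<phi>\<close> shows that the flux times
  \<open>\<phi>\<close> is nondecreasing when \<open>\<mu> < 0\<close>. Hence
  \<open>\<phi>\<^sup>2\<close> grows from 1, \<open>\<phi>\<close> keeps its sign, and the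
  right-hand side stays negative.\<close>

lemma radial_ode_flux_pos_of_neg:
  assumes ode: "radial_ode n \<phi> q (\<lambda>r. \<mu> * \<phi> r)" and n: "n > 0" and \<mu>: "\<mu> < 0" and \<phi>0: "\<phi> 0 = 1"
  shows "q 1 > 0"
proof -
  have prod: "q r * \<phi> r \<ge> 0" if r: "r > 0" for r
  proof -
    define h where "h t = t ^ n * q t * \<phi> t" for t
    have "h 0 \<le> h r"
    proof (rule DERIV_nonneg_imp_increasing_open[where f=h])
      show "continuous_on {0..r} h" unfolding h_def
        by (intro continuous_intros continuous_on_subset[OF radial_odeD(1)[OF ode]]
            continuous_on_subset[OF radial_odeD(7)[OF ode]]) auto
      fix t assume t: "0 < t" "t < r"
      define y where "y = - (t ^ (n - 1) * (\<mu> * \<phi> t)) * \<phi> t + t * q t * (t ^ n * q t)"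
      have "(h has_real_derivative y) (at t)"
        unfolding h_def y_def
        by (intro DERIV_mult radial_ode_flux[OF ode n t(1)] radial_odeD(6)[OF ode t(1)])
      moreover have "y = t ^ (n - 1) * (- \<mu> * (\<phi> t)\<^sup>2) + t * (t ^ n * (q t)\<^sup>2)"
        by (simp add: y_def power2_eq_square algebra_simps)
      moreover have "\<dots> \<ge> 0"
        using t \<mu> by (intro add_nonneg_nonneg mult_nonneg_nonneg) auto
      ultimately show "\<exists>y. (h has_real_derivative y) (at t) \<and> 0 \<le> y" by auto
    qed (use r in auto)
    then have "0 \<le> r ^ n * (q r * \<phi> r)" using n by (simp add: h_def zero_power mult.assoc)
    then show ?thesis using zero_less_power[OF r, of n] by (simp add: zero_le_mult_iff not_le)
  qed
  have sq: "(\<phi> r)\<^sup>2 \<ge> 1" if r: "r \<ge> 0" for r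
  proof -
    have "(\<phi> 0)\<^sup>2 \<le> (\<phi> r)\<^sup>2"
    proof (rule DERIV_nonneg_imp_increasing_open[where f="\<lambda>t. (\<phi> t)\<^sup>2"])
      show "continuous_on {0..r} (\<lambda>t. (\<phi> t)\<^sup>2)"
        by (intro continuous_intros continuous_on_subset[OF radial_odeD(7)[OF ode]]) auto
      fix t assume t: "0 < t" "t < r"
      have "((\<lambda>t. (\<phi> t)\<^sup>2) has_real_derivative 2 * (t * (q t * \<phi> t))) (at t)"
        by (auto intro!: derivative_eq_intros radial_odeD(6)[OF ode t(1)])
      moreover have "2 * (t * (q t * \<phi> t)) \<ge> 0" using t prod[OF t(1)] by simp
      ultimately show "\<exists>y. ((\<lambda>t. (\<phi> t)\<^sup>2) has_real_derivative y) (at t) \<and> 0 \<le> y" by blast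
    qed (use r in auto)
    then show ?thesis using \<phi>0 by simp
  qed
  have pos: "\<phi> r > 0" if r: "r \<ge> 0" for r
  proof (rule ccontr)
    assume "\<not> \<phi> r > 0"
    then have "\<exists>x\<ge>0. x \<le> r \<and> \<phi> x = 0"
      using r \<phi>0 by (intro IVT2') (auto intro: continuous_on_subset[OF radial_odeD(7)[OF ode]])
    then show False using sq by force
  qed
  show ?thesis
    by (rule radial_ode_pos[OF ode n]) (use pos \<mu> in \<open>auto intro: mult_neg_pos\<close>)
qed

lemma radial_neumann_eigenvalue_ge_1:
  assumes "l \<in> radial_neumann_eigenvalues TYPE('a::euclidean_space)"
  shows "l \<ge> 1"
proof (rule ccontr)
  assume l: "\<not> l \<ge> 1"
  have n: "DIM('a) > 0" by simp
  obtain \<phi> q where ode: "radial_ode DIM('a) \<phi> q (\<lambda>r. (l - 1) * \<phi> r)" and \<phi>0: "\<phi> 0 = 1"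
    using radial_linear_ivp[OF n] by blast
  have "q 1 = 0" using assms by (intro radial_eigenvalue_flux_eq_0[OF _ ode]) simp
  then show False using radial_ode_flux_pos_of_neg[OF ode n _ \<phi>0] l by simp
qed

text \<open>The constants realize the lowest eigenvalue 1. The eigenvalue \<open>l\<close> supplied
  by the infimum is only a weak one; its classical eigenfunction is the solution of the initial
  value problem with the same parameter.\<close>

lemma lambda2_rad_less:
  assumes "lambda2_rad TYPE('a::euclidean_space) < m"
  obtains \<mu> \<phi> q where "\<mu> > 0" "\<mu> + 1 < m" "radial_ode DIM('a) \<phi> q (\<lambda>r. \<mu> * \<phi> r)" "\<phi> 0 = 1" "q 1 = 0"
proof -
  define S where "S = radial_neumann_eigenvalues TYPE('a)"
  have n: "DIM('a) > 0" by simp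
  have "0 + 1 \<in> S" unfolding S_def
    using radial_ode_const[OF n, of 1] by (intro radial_neumann_eigenvalueI[where u="\<lambda>_. 1" and q="\<lambda>_. 0"]) auto
  then have Inf: "Inf S = 1"
    using radial_neumann_eigenvalue_ge_1 by (intro cInf_eq_minimum) (auto simp: S_def)
  obtain \<mu>0 where "\<mu>0 > 0" "\<mu>0 + 1 \<in> S"
    using radial_neumann_eigenvalue_gt_1[where ?'a='a] unfolding S_def by blast
  then have "{l \<in> S. l > Inf S} \<noteq> {}" using Inf by force
  moreover have "Inf {l \<in> S. l > Inf S} < m" using assms unfolding lambda2_rad_def S_def .
  ultimately obtain l where l: "l \<in> S" "l > 1" "l < m"
    using cInf_lessD[of "{l \<in> S. l > Inf S}" m] Inf by auto
  obtain \<phi> q where ode: "radial_ode DIM('a) \<phi> q (\<lambda>r. (l - 1) * \<phi> r)" and \<phi>0: "\<phi> 0 = 1"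
    using radial_linear_ivp[OF n] by blast
  have "q 1 = 0" using l by (intro radial_eigenvalue_flux_eq_0[OF _ ode]) (simp add: S_def)
  then show ?thesis using that[of "l - 1"] l ode \<phi>0 by simp
qed


section \<open>Shooting\<close>

text \<open>\<open>R\<close> is the first critical point of \<open>\<phi>\<close> after 0. If
  \<open>\<phi> R \<ge> 0\<close>, then \<open>\<phi> > 0\<close> on (0, R), and the flux decreases
  strictly from 0, so it could not vanish at \<open>R\<close>.\<close>

lemma sturm_first_zero:
  assumes ode: "radial_ode n \<phi> q (\<lambda>r. \<mu> * \<phi> r)" and n: "n > 0" and \<mu>: "\<mu> > 0" and \<phi>0: "\<phi> 0 = 1" and q1: "q 1 = 0"
  obtains R where "0 < R" "R \<le> 1" "q R = 0" "\<And>r. 0 \<le> r \<Longrightarrow> r < R \<Longrightarrow> q r < 0" "\<phi> R < 0"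
proof -
  have q0: "q 0 < 0" using radial_odeD(3)[OF ode] \<phi>0 \<mu> n by simp
  define Z where "Z = {r \<in> {0..1}. q r = 0}"
  have "closed Z" unfolding Z_def
    by (intro continuous_closed_preimage_constant continuous_on_subset[OF radial_odeD(1)[OF ode]]) auto
  moreover have Z1: "1 \<in> Z" and bdd: "bdd_below Z" using q1 by (auto simp: Z_def intro: bdd_belowI[of _ 0])
  ultimately have RZ: "Inf Z \<in> Z" using closed_contains_Inf by blast
  define R where "R = Inf Z"
  have R: "0 \<le> R" "R \<le> 1" "q R = 0" using RZ by (auto simp: Z_def R_def)
  have R0: "R > 0" using R q0 by (cases "R = 0") auto
  have nz: "q r \<noteq> 0" if "0 \<le> r" "r < R" for r
    using that cInf_lower[OF _ bdd, of r] R by (auto simp: Z_def R_def)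
  have neg: "q r < 0" if r: "0 \<le> r" "r < R" for r
    using continuous_nonzero_neg[OF radial_odeD(1)[OF ode] q0, of r r] nz r by auto
  have "\<phi> R < 0"
  proof (rule ccontr)
    assume "\<not> \<phi> R < 0"
    then have pos: "\<phi> r > 0" if "0 < r" "r < R" for r
      using radial_ode_strict_antimono[OF ode, of r R] neg that by force
    have "R ^ n * q R < 0 ^ n * q 0"
    proof (rule DERIV_neg_imp_decreasing_open[OF R0, where f="\<lambda>r. r ^ n * q r"])
      show "continuous_on {0..R} (\<lambda>r. r ^ n * q r)"
        by (intro continuous_intros continuous_on_subset[OF radial_odeD(1)[OF ode]]) auto
      fix r assume r: "0 < r" "r < R"
      have "r ^ (n - 1) * (\<mu> * \<phi> r) > 0" using r pos[OF r] \<mu> by simp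
      then show "\<exists>y. ((\<lambda>r. r ^ n * q r) has_real_derivative y) (at r) \<and> y < 0"
        using radial_ode_flux[OF ode n r(1)] by (intro exI[of _ "- (r ^ (n - 1) * (\<mu> * \<phi> r))"]) simp
    qed
    then show False using R(3) n by (simp add: zero_power)
  qed
  then show ?thesis using that[of R] R0 R neg by blast
qed

lemma wronskian_deriv:
  assumes z: "radial_ode n z p g" and ode: "radial_ode n \<phi> q (\<lambda>r. \<mu> * \<phi> r)" and n: "n > 0" and r: "r > 0"
  shows "((\<lambda>r. (r ^ n * p r) * \<phi> r - (r ^ n * q r) * z r) has_real_derivative
      - (r ^ (n - 1) * ((g r - \<mu> * z r) * \<phi> r))) (at r)"
proof -
  have "((\<lambda>r. (r ^ n * p r) * \<phi> r - (r ^ n * q r) * z r) has_real_derivative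
     (- (r ^ (n - 1) * g r) * \<phi> r + r * q r * (r ^ n * p r))
      - (- (r ^ (n - 1) * (\<mu> * \<phi> r)) * z r + r * p r * (r ^ n * q r))) (at r)"
    by (intro DERIV_diff DERIV_mult radial_ode_flux[OF z n r] radial_ode_flux[OF ode n r]
        radial_odeD(6)[OF z r] radial_odeD(6)[OF ode r])
  then show ?thesis by (simp add: algebra_simps)
qed

text \<open>Sturm comparison: an increasing \<open>z\<close> that oscillates faster than the eigenfunction \<open>\<phi>\<close> would have
  its extremum before the first critical point \<open>R\<close> of \<open>\<phi>\<close>. The Wronskian
  \<open>r ^ (n - 1) (z' \<phi> - z \<phi>')\<close> is increasing on \<open>[0, \<rho>]\<close> or on \<open>[\<rho>, R]\<close>, where \<open>\<rho>\<close> is the zero of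
  \<open>\<phi>\<close>, and its boundary values have the wrong signs.\<close>

lemma sturm_contradiction:
  assumes z: "radial_ode n z p g" and ode: "radial_ode n \<phi> q (\<lambda>r. \<mu> * \<phi> r)" and n: "n > 0" and \<mu>: "\<mu> > 0"
    and \<phi>0: "\<phi> 0 = 1" and q1: "q 1 = 0"
    and p: "\<And>r. 0 \<le> r \<Longrightarrow> r \<le> 1 \<Longrightarrow> p r > 0"
    and le: "\<And>r. 0 \<le> r \<Longrightarrow> r \<le> 1 \<Longrightarrow> z r \<le> 0 \<Longrightarrow> g r \<le> \<mu> * z r"
    and ge: "\<And>r. 0 \<le> r \<Longrightarrow> r \<le> 1 \<Longrightarrow> z r \<ge> 0 \<Longrightarrow> g r \<ge> \<mu> * z r"
  shows False
proof -
  obtain R where R: "0 < R" "R \<le> 1" "q R = 0" "\<And>r. 0 \<le> r \<Longrightarrow> r < R \<Longrightarrow> q r < 0" "\<phi> R < 0"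
    using sturm_first_zero[OF ode n \<mu> \<phi>0 q1] by blast
  have "\<exists>x\<ge>0. x \<le> R \<and> \<phi> x = 0"
    using R \<phi>0 by (intro IVT2') (auto intro: continuous_on_subset[OF radial_odeD(7)[OF ode]])
  then obtain \<rho> where \<rho>: "0 \<le> \<rho>" "\<rho> \<le> R" "\<phi> \<rho> = 0" by blast
  have \<rho>0: "0 < \<rho>" using \<rho> \<phi>0 by (cases "\<rho> = 0") auto
  have \<rho>R: "\<rho> < R" using \<rho> R by (cases "\<rho> = R") auto
  have \<phi>pos: "\<phi> r \<ge> 0" if "0 \<le> r" "r \<le> \<rho>" for r
    using radial_ode_antimono[OF ode, of r \<rho>] R(4) \<rho> \<rho>R that by (force intro: less_imp_le)
  have \<phi>neg: "\<phi> r \<le> 0" if "\<rho> \<le> r" "r \<le> R" for r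
    using radial_ode_antimono[OF ode, of \<rho> r] R(4) \<rho> that by (force intro: less_imp_le)
  have zmono: "z r \<le> z s" if "0 \<le> r" "r \<le> s" "s \<le> 1" for r s
    using radial_ode_mono[OF z n, of r s] p that by (force intro: less_imp_le)
  define W where "W r = (r ^ n * p r) * \<phi> r - (r ^ n * q r) * z r" for r
  have Wc: "continuous_on S W" if "S \<subseteq> {0..}" for S
    unfolding W_def
    by (intro continuous_intros continuous_on_subset[OF radial_odeD(1)[OF z] that] continuous_on_subset[OF radial_odeD(7)[OF z] that]
      continuous_on_subset[OF radial_odeD(1)[OF ode] that] continuous_on_subset[OF radial_odeD(7)[OF ode] that])
  have Wmono: "W a \<le> W b" if ab: "0 \<le> a" "a \<le> b"
    and s: "\<And>r. a < r \<Longrightarrow> r < b \<Longrightarrow> (g r - \<mu> * z r) * \<phi> r \<le> 0" for a b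
  proof (rule DERIV_nonneg_imp_increasing_open[where f=W])
    show "continuous_on {a..b} W" using ab by (intro Wc) auto
    fix r assume r: "a < r" "r < b"
    then have "r ^ (n - 1) * ((g r - \<mu> * z r) * \<phi> r) \<le> 0"
      using s[OF r] ab by (intro mult_nonneg_nonpos[of "r ^ (n - 1)"]) auto
    then show "\<exists>y. (W has_real_derivative y) (at r) \<and> 0 \<le> y"
      using wronskian_deriv[OF z ode n, of r] r ab unfolding W_def
      by (intro exI[of _ "- (r ^ (n - 1) * ((g r - \<mu> * z r) * \<phi> r))"]) auto
  qed (use ab in auto)
  have q\<rho>: "q \<rho> < 0" using R(4) \<rho>0 \<rho>R by simp
  show False
  \<comment> \<open>As \<open>z\<close> increases, its sign at \<open>\<rho>\<close> persists on one
    side, where \<open>\<phi>\<close> has a fixed sign too. This selects the interval on which the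
    Wronskian is monotone.\<close>
  proof (cases "z \<rho> < 0")
    case True
    have "W 0 \<le> W \<rho>"
    proof (rule Wmono)
      fix r assume r: "0 < r" "r < \<rho>"
      then have "z r \<le> 0" using zmono[of r \<rho>] True \<rho>R R by simp
      then have "g r - \<mu> * z r \<le> 0" using le[of r] r \<rho>R R by simp
      then show "(g r - \<mu> * z r) * \<phi> r \<le> 0" using \<phi>pos[of r] r by (intro mult_nonpos_nonneg) auto
    qed (use \<rho>0 in auto)
    moreover have "W 0 = 0" using n by (simp add: W_def zero_power)
    moreover have "W \<rho> = - (\<rho> ^ n * (q \<rho> * z \<rho>))" using \<rho>(3) by (simp add: W_def)
    moreover have "\<rho> ^ n * (q \<rho> * z \<rho>) > 0" using \<rho>0 q\<rho> True by (intro mult_pos_pos mult_neg_neg) auto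
    ultimately show False by simp
  next
    case False
    have "W \<rho> \<le> W R"
    proof (rule Wmono)
      fix r assume r: "\<rho> < r" "r < R"
      then have "z r \<ge> 0" using zmono[of \<rho> r] False \<rho>0 R by simp
      then have "g r - \<mu> * z r \<ge> 0" using ge[of r] r \<rho>0 R by simp
      then show "(g r - \<mu> * z r) * \<phi> r \<le> 0" using \<phi>neg[of r] r by (intro mult_nonneg_nonpos) auto
    qed (use \<rho>0 \<rho>R in auto)
    moreover have "W \<rho> = - (\<rho> ^ n * q \<rho> * z \<rho>)" using \<rho>(3) by (simp add: W_def)
    moreover have "\<rho> ^ n * q \<rho> * z \<rho> \<le> 0"
      using \<rho>0 q\<rho> False by (intro mult_nonpos_nonneg mult_nonneg_nonpos) auto
    moreover have "W R = R ^ n * p R * \<phi> R" using R(3) by (simp add: W_def)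
    moreover have "R ^ n * p R * \<phi> R < 0" using R(1,2,5) p[of R] by (intro mult_pos_neg mult_pos_pos) auto
    ultimately show False by simp
  qed
qed

text \<open>The second estimate concerns \<open>q\<close> rather than \<open>r * q\<close> and is
  thus uniform down to \<open>r = 0\<close>; it uses the first one as a bound on the right-hand
  side.\<close>

lemma radial_ode_stability:
  assumes u: "radial_ode n u q (\<lambda>r. f (u r))" and v: "radial_ode n v p (\<lambda>r. f (v r))" and n: "n > 0"
    and lip: "\<And>x y. \<bar>f x - f y\<bar> \<le> L * \<bar>x - y\<bar>" and r: "0 \<le> r" "r \<le> 1"
  shows "\<bar>u r - v r\<bar> \<le> \<bar>u 0 - v 0\<bar> * exp (1 + L)"
    and "\<bar>q r - p r\<bar> \<le> L * (\<bar>u 0 - v 0\<bar> * exp (1 + L)) / real n"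
proof -
  have L: "L \<ge> 0" using lip[of 0 1] by (simp add: order_trans[OF abs_ge_zero])
  have ode: "radial_ode n (\<lambda>r. u r - v r) (\<lambda>r. q r - p r) (\<lambda>r. f (u r) - f (v r))"
    using radial_ode_add_scaled[OF u v, of "-1"] by simp
  have z: "\<bar>u t - v t\<bar> \<le> \<bar>u 0 - v 0\<bar> * exp (1 + L)" if t: "0 \<le> t" "t \<le> 1" for t
  proof -
    have "\<bar>u t - v t\<bar> \<le> \<bar>u 0 - v 0\<bar> * exp ((1 + L) * t)"
      by (rule radial_ode_growth[OF ode n lip t(1) L])
    also have "\<dots> \<le> \<bar>u 0 - v 0\<bar> * exp (1 + L)"
      using t L by (intro mult_left_mono) (auto simp: mult_left_le)
    finally show ?thesis .
  qed
  show "\<bar>u r - v r\<bar> \<le> \<bar>u 0 - v 0\<bar> * exp (1 + L)" by (rule z[OF r])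
  show "\<bar>q r - p r\<bar> \<le> L * (\<bar>u 0 - v 0\<bar> * exp (1 + L)) / real n"
  proof (rule radial_ode_abs_bound[OF ode n _ r(1)])
    fix t assume t: "0 \<le> t" "t \<le> r"
    show "\<bar>f (u t) - f (v t)\<bar> \<le> L * (\<bar>u 0 - v 0\<bar> * exp (1 + L))"
      using order_trans[OF lip mult_left_mono[OF z L]] t r by auto
  qed
qed

text \<open>An interior zero of \<open>q \<ge> 0\<close> is a minimum, so the derivative of
  \<open>q\<close> vanishes as well and the equation gives \<open>f (u r) = 0\<close>. Then
  \<open>u\<close> has the same data at \<open>r\<close> as the constant solution
  \<open>u r\<close>, and inward uniqueness applies.\<close>

lemma radial_ode_interior_critical:
  assumes ode: "radial_ode n u q (\<lambda>r. f (u r))" and n: "n > 0"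
    and lip: "\<And>x y. \<bar>f x - f y\<bar> \<le> L * \<bar>x - y\<bar>"
    and q: "\<And>r. 0 \<le> r \<Longrightarrow> r \<le> 1 \<Longrightarrow> q r \<ge> 0" and r: "0 < r" "r < 1" "q r = 0"
  shows "q 0 = 0"
proof -
  have L: "L \<ge> 0" using lip[of 0 1] by (simp add: order_trans[OF abs_ge_zero])
  have "(- f (u r) - real n * q r) / r = 0"
  proof (rule DERIV_local_min[OF radial_odeD(5)[OF ode r(1)]])
    show "0 < min r (1 - r)" using r by simp
    show "\<forall>y. \<bar>r - y\<bar> < min r (1 - r) \<longrightarrow> q r \<le> q y" using q r(3) by auto
  qed
  then have f0: "f (u r) = 0" using r by simp
  have ode': "radial_ode n (\<lambda>t. u t - u r) q (\<lambda>t. f (u t))"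
    using radial_ode_add_scaled[OF ode radial_ode_const[OF n, of "u r"], of "-1"] by simp
  show ?thesis
    by (rule radial_ode_backward_unique[OF ode' n _ L r(1)]) (use lip[of _ "u r"] f0 r in auto)
qed

text \<open>\<open>le\<close> and \<open>ge\<close> say that \<open>f\<close> is at least as steep
  at \<open>b\<close> as the line of slope \<open>\<mu>\<close>, as the Sturm comparison demands;
  \<open>fa\<close> is the shape of the truncated nonlinearity.\<close>

lemma increasing_shooting:
  fixes f :: "real \<Rightarrow> real"
  assumes n: "n > 0" and lip: "\<And>x y. \<bar>f x - f y\<bar> \<le> L * \<bar>x - y\<bar>"
    and ab: "a < b" and fb: "f b = 0" and fneg: "\<And>s. a < s \<Longrightarrow> s < b \<Longrightarrow> f s < 0" and fa: "\<And>s. s \<le> a \<Longrightarrow> f s = 0"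
    and ode: "radial_ode n \<phi> q (\<lambda>r. \<mu> * \<phi> r)" and \<mu>: "\<mu> > 0" and \<phi>0: "\<phi> 0 = 1" and q1: "q 1 = 0"
    and \<delta>: "\<delta> > 0" and le: "\<And>s. b - \<delta> < s \<Longrightarrow> s \<le> b \<Longrightarrow> f s \<le> \<mu> * (s - b)"
    and ge: "\<And>s. b \<le> s \<Longrightarrow> s < b + \<delta> \<Longrightarrow> f s \<ge> \<mu> * (s - b)"
  obtains u p where "radial_ode n u p (\<lambda>r. f (u r))" "a < u 0" "u 0 < b" "p 0 > 0" "p 1 = 0"
    "\<And>r. 0 \<le> r \<Longrightarrow> r \<le> 1 \<Longrightarrow> p r \<ge> 0"
proof -
  have L: "L \<ge> 0" using lip[of 0 1] by (simp add: order_trans[OF abs_ge_zero])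
  define E where "E = exp (1 + L)"
  have E: "E > 0" by (simp add: E_def)
  have "\<exists>u p. radial_ode n u p (\<lambda>r. f (u r)) \<and> u 0 = d" for d
    by (rule radial_ivp[OF lip n, of "\<lambda>_. 0" 0 d]) auto
  then obtain U P where UP: "\<And>d. radial_ode n (U d) (P d) (\<lambda>r. f (U d r))" "\<And>d. U d 0 = d"
    by metis
  have stab: "\<bar>P d r - P e r\<bar> \<le> L * (\<bar>d - e\<bar> * E) / real n" if "0 \<le> r" "r \<le> 1" for d e r
    using radial_ode_stability(2)[OF UP(1) UP(1) n lip that, of d e] by (simp add: UP(2) E_def)
  have stabc: "\<bar>U d r - c\<bar> \<le> \<bar>d - c\<bar> * E" if "0 \<le> r" "r \<le> 1" "f c = 0" for d c r
    using radial_ode_stability(1)[OF UP(1) _ n lip that(1,2), of "\<lambda>_. c" "\<lambda>_. 0" d] radial_ode_const[OF n, of c]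
    by (simp add: UP(2) E_def that(3))
  have P0: "P d 0 > 0" if "a < d" "d < b" for d
    using radial_odeD(3)[OF UP(1), of d] fneg[OF that] n by (simp add: UP(2) divide_neg_pos)
  \<comment> \<open>Positivity is asked on all of [0, 1], including 0, which makes it an open
    condition on \<open>d\<close>.\<close>
  define D where "D = {d. a < d \<and> d < b \<and> (\<forall>r. 0 \<le> r \<longrightarrow> r \<le> 1 \<longrightarrow> P d r > 0)}"
  have Dne: "D \<noteq> {}"
  proof -
    \<comment> \<open>So close to the equilibrium \<open>a\<close> that stability keeps the solution
      below \<open>b\<close> on [0, 1]; the first entry of the minimum keeps \<open>d\<close> itself
      below \<open>b\<close>.\<close>
    define d where "d = a + min ((b - a) / 2) ((b - a) / (2 * E))"
    have "0 < min ((b - a) / 2) ((b - a) / (2 * E))" using ab E by simp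
    moreover have "min ((b - a) / 2) ((b - a) / (2 * E)) \<le> (b - a) / 2" by (rule min.cobounded1)
    ultimately have d: "a < d" "d < b" using ab unfolding d_def by argo+
    have "(d - a) * E \<le> (b - a) / (2 * E) * E" using E by (intro mult_right_mono) (auto simp: d_def)
    also have "\<dots> < b - a" using E ab by simp
    finally have small: "\<bar>d - a\<bar> * E < b - a" using d by simp
    have ub: "U d r < b" if "0 \<le> r" "r \<le> 1" for r
      using stabc[OF that fa[of a], of d] small by simp
    \<comment> \<open>Bootstrap: \<open>f \<le> 0\<close> on the whole half-line below
      \<open>b\<close> gives \<open>P \<ge> 0\<close>, hence \<open>U \<ge> d > a\<close>, and there
      \<open>f < 0\<close> gives strictness.\<close>
    have fle: "f s \<le> 0" if "s < b" for s using fneg[of s] fa[of s] that by force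
    have Pnn: "P d r \<ge> 0" if r: "0 \<le> r" "r \<le> 1" for r
      using radial_ode_lower_bound[OF UP(1) n _ r(1), of d 0] fle[OF ub] r by simp
    have Ua: "U d r > a" if r: "0 \<le> r" "r \<le> 1" for r
      using radial_ode_mono[OF UP(1) n, of 0 r d] Pnn r d by (simp add: UP(2))
    have "P d r > 0" if r: "0 \<le> r" "r \<le> 1" for r
      using r by (intro radial_ode_pos[OF UP(1) n _ r(1)] fneg Ua ub) auto
    then have "d \<in> D" using d by (simp add: D_def)
    then show ?thesis by blast
  qed
  \<comment> \<open>Within \<open>\<delta> / E\<close> of the equilibrium \<open>b\<close> the
    solution stays within \<open>\<delta>\<close> of \<open>b\<close>, where \<open>le\<close> and
    \<open>ge\<close> apply and the Sturm comparison excludes it. The explicit gap also keeps the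
    supremum of \<open>D\<close> away from \<open>b\<close>.\<close>
  have Dbound: "d \<le> b - \<delta> / E" if d: "d \<in> D" for d
  proof (rule ccontr)
    assume "\<not> d \<le> b - \<delta> / E"
    then have "b - d < \<delta> / E" by simp
    then have small: "\<bar>d - b\<bar> * E < \<delta>" using d E by (simp add: D_def field_simps)
    have close: "\<bar>U d r - b\<bar> < \<delta>" if "0 \<le> r" "r \<le> 1" for r
      using stabc[OF that fb, of d] small by simp
    have z: "radial_ode n (\<lambda>r. U d r - b) (P d) (\<lambda>r. f (U d r))"
      using radial_ode_add_scaled[OF UP(1) radial_ode_const[OF n, of b], of d "-1"] by simp
    show False
    proof (rule sturm_contradiction[OF z ode n \<mu> \<phi>0 q1])
      fix r :: real assume r: "0 \<le> r" "r \<le> 1"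
      show "P d r > 0" using d r by (simp add: D_def)
      show "f (U d r) \<le> \<mu> * (U d r - b)" if "U d r - b \<le> 0" using close[OF r] that by (intro le) auto
      show "f (U d r) \<ge> \<mu> * (U d r - b)" if "U d r - b \<ge> 0" using close[OF r] that by (intro ge) auto
    qed
  qed
  define d where "d = Sup D"
  have bdd: "bdd_above D" by (rule bdd_aboveI[OF Dbound])
  have db: "d < b"
  proof -
    have "d \<le> b - \<delta> / E" unfolding d_def using Dne Dbound by (intro cSup_least) auto
    then show ?thesis using \<delta> E divide_pos_pos[of \<delta> E] by linarith
  qed
  have da: "a < d"
  proof -
    obtain e where "e \<in> D" using Dne by blast
    then show ?thesis using cSup_upper[OF _ bdd, of e] by (simp add: D_def d_def)
  qed
  \<comment> \<open>The summand 1 keeps \<open>C\<close> positive also for \<open>L = 0\<close>, so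
    that it can be divided by.\<close>
  define C where "C = L * E / real n + 1"
  have C: "C > 0" using L E n by (simp add: C_def add_nonneg_pos)
  have close: "\<bar>P x r - P y r\<bar> \<le> \<bar>x - y\<bar> * C" if "0 \<le> r" "r \<le> 1" for x y r
  proof -
    have "\<bar>P x r - P y r\<bar> \<le> \<bar>x - y\<bar> * (L * E / real n)" using stab[OF that, of x y] by (simp add: mult_ac)
    also have "\<dots> \<le> \<bar>x - y\<bar> * C" by (intro mult_left_mono) (auto simp: C_def)
    finally show ?thesis .
  qed
  \<comment> \<open>A negative value at the supremum would persist for nearby parameters, some of
    which belong to \<open>D\<close>.\<close>
  have Pnn: "P d r \<ge> 0" if r: "0 \<le> r" "r \<le> 1" for r
  proof (rule ccontr)
    assume neg: "\<not> P d r \<ge> 0"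
    then have "d - (- P d r) / C < Sup D" using C by (simp add: d_def divide_neg_pos)
    then obtain e where e: "e \<in> D" "d - (- P d r) / C < e" using less_cSup_iff[OF Dne bdd] by blast
    have "e \<le> d" using cSup_upper[OF e(1) bdd] by (simp add: d_def)
    then have "\<bar>e - d\<bar> * C < - P d r" using e(2) C by (simp add: field_simps)
    then have "P e r < 0" using close[OF r, of e d] by linarith
    then show False using e(1) r by (force simp: D_def)
  qed
  have "\<exists>r0. 0 \<le> r0 \<and> r0 \<le> 1 \<and> P d r0 \<le> 0"
  proof (rule ccontr)
    assume "\<not> ?thesis"
    then have pos: "P d r > 0" if "0 \<le> r" "r \<le> 1" for r using that by (meson not_le)
    have "continuous_on {0..1} (P d)" by (rule continuous_on_subset[OF radial_odeD(1)[OF UP(1)]]) auto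
    then obtain s where s: "s \<in> {0..1}" "\<And>r. r \<in> {0..1} \<Longrightarrow> P d s \<le> P d r"
      using continuous_attains_inf[of "{0..1}" "P d"] by auto
    define m where "m = P d s"
    have m: "m > 0" using pos s by (simp add: m_def)
    \<comment> \<open>If \<open>P d\<close> had a positive minimum \<open>m\<close> on [0, 1], this
      slightly larger parameter would still belong to \<open>D\<close>.\<close>
    define e where "e = d + min ((b - d) / 2) (m / (2 * C))"
    have "0 < min ((b - d) / 2) (m / (2 * C))" using db m C by simp
    moreover have "min ((b - d) / 2) (m / (2 * C)) \<le> (b - d) / 2" by (rule min.cobounded1)
    ultimately have e: "d < e" "e < b" using db unfolding e_def by argo+
    have "(e - d) * C \<le> m / (2 * C) * C" using C by (intro mult_right_mono) (auto simp: e_def)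
    also have "\<dots> < m" using C m by simp
    finally have "\<bar>e - d\<bar> * C < m" using e by simp
    then have "P e r > 0" if "0 \<le> r" "r \<le> 1" for r
      using close[OF that, of e d] s(2)[of r] that unfolding m_def by auto
    then have "e \<in> D" using e da by (simp add: D_def)
    then show False using cSup_upper[OF _ bdd, of e] e by (simp add: d_def)
  qed
  then obtain r0 where r0: "0 \<le> r0" "r0 \<le> 1" "P d r0 = 0" using Pnn by (meson order_antisym)
  have "r0 = 1"
  proof (rule ccontr)
    assume "r0 \<noteq> 1"
    moreover have "r0 \<noteq> 0" using P0[OF da db] r0(3) by auto
    ultimately have "P d 0 = 0"
      using r0 Pnn by (intro radial_ode_interior_critical[OF UP(1) n lip, of d r0]) auto
    then show False using P0[OF da db] by simp
  qed
  then show ?thesis using that[OF UP(1), of d] UP(2) da db P0[OF da db] r0(3) Pnn by simp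
qed

text \<open>The energy \<open>E\<close> has derivative \<open>- (n - 1) * t * (q t)\<^sup>2\<close>,
  and its kinetic part vanishes at \<open>t = 0\<close>. Differentiability of \<open>F\<close> is
  asked only above \<open>a\<close>, since \<open>F\<close> will be an integral starting at
  \<open>a\<close>.\<close>

lemma radial_energy_decreasing:
  assumes ode: "radial_ode n u q (\<lambda>r. f (u r))" and n: "n > 0" and r: "r \<ge> 0"
    and u: "\<And>t. 0 \<le> t \<Longrightarrow> t \<le> r \<Longrightarrow> u t > a"
    and F: "\<And>s. s > a \<Longrightarrow> (F has_real_derivative f s) (at s)"
  shows "F (u r) \<le> F (u 0)"
proof -
  define E where "E t = (t * q t)\<^sup>2 / 2 + F (u t)" for t
  have Fc: "continuous_on {a<..} F"
    using F by (auto intro!: continuous_at_imp_continuous_on DERIV_isCont)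
  have "E r \<le> E 0"
  proof (rule DERIV_nonpos_imp_decreasing_open[OF r, where f=E])
    have cF: "continuous_on {0..r} (\<lambda>t. F (u t))"
      by (rule continuous_on_compose2[OF Fc]) (auto intro: u continuous_on_subset[OF radial_odeD(7)[OF ode]])
    show "continuous_on {0..r} E" unfolding E_def
      by (intro continuous_intros cF continuous_on_subset[OF radial_odeD(1)[OF ode]]) auto
    fix t assume t: "0 < t" "t < r"
    have "((\<lambda>t. (t * q t)\<^sup>2) has_real_derivative 2 * (t * q t) * (- f (u t) - (real n - 1) * q t)) (at t)"
      using DERIV_power[OF radial_ode_flux_term_deriv[OF ode t(1)], of 2] by (simp add: mult_ac)
    then have "(E has_real_derivative (2 * (t * q t) * (- f (u t) - (real n - 1) * q t)) / 2 + f (u t) * (t * q t)) (at t)"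
      unfolding E_def
      by (intro DERIV_add DERIV_cdivide DERIV_chain2[OF F radial_odeD(6)[OF ode t(1)]] u) (use t in auto)
    moreover have "(2 * (t * q t) * (- f (u t) - (real n - 1) * q t)) / 2 + f (u t) * (t * q t)
       = - ((real n - 1) * (t * (q t)\<^sup>2))"
      by (simp add: power2_eq_square field_simps)
    moreover have "(real n - 1) * (t * (q t)\<^sup>2) \<ge> 0" using n t by (intro mult_nonneg_nonneg) auto
    ultimately show "\<exists>y. (E has_real_derivative y) (at t) \<and> y \<le> 0" by auto
  qed
  then have "(r * q r)\<^sup>2 / 2 + F (u r) \<le> F (u 0)" by (simp add: E_def)
  then show ?thesis using zero_le_power2[of "r * q r"] by linarith
qed


section \<open>From \<open>g\<close> to a truncated Lipschitz nonlinearity\<close>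

lemma largest_zero_below:
  fixes f :: "real \<Rightarrow> real"
  assumes c: "continuous_on {0..} f" and f0: "f 0 = 0" and \<delta>: "0 < \<delta>" "\<delta> < b"
    and neg: "\<And>s. b - \<delta> < s \<Longrightarrow> s < b \<Longrightarrow> f s < 0"
  obtains a where "0 \<le> a" "a < b" "f a = 0" "\<And>s. a < s \<Longrightarrow> s < b \<Longrightarrow> f s < 0"
proof -
  \<comment> \<open>The cut at \<open>b - \<delta> / 2\<close> keeps the supremum strictly below
    \<open>b\<close>, even when \<open>b\<close> is itself a zero; the remaining gap is covered by
    \<open>neg\<close>.\<close>
  define Z where "Z = {s \<in> {0..b - \<delta> / 2}. f s = 0}"
  have "closed Z" unfolding Z_def
    by (intro continuous_closed_preimage_constant continuous_on_subset[OF c]) auto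
  moreover have "0 \<in> Z" using \<delta> f0 by (simp add: Z_def)
  moreover have bdd: "bdd_above Z" by (auto simp: Z_def intro: bdd_aboveI[of _ "b - \<delta> / 2"])
  ultimately have aZ: "Sup Z \<in> Z" using closed_contains_Sup by blast
  define a where "a = Sup Z"
  have a: "0 \<le> a" "a \<le> b - \<delta> / 2" "f a = 0" using aZ by (auto simp: Z_def a_def)
  have nz: "f s \<noteq> 0" if s: "a < s" "s < b" for s
  proof
    assume z: "f s = 0"
    show False
    proof (cases "s \<le> b - \<delta> / 2")
      case True
      then have "s \<in> Z" using s a z by (simp add: Z_def)
      then show False using cSup_upper[OF _ bdd] s by (force simp: a_def)
    next
      case False
      then show False using neg[of s] \<delta> s z by auto
    qed
  qed
  have "f s < 0" if s: "a < s" "s < b" for s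
  proof (rule ccontr)
    assume ns: "\<not> f s < 0"
    \<comment> \<open>\<open>b - \<delta> / 4\<close> is a point to the right of \<open>s\<close>
      where \<open>f < 0\<close>, so \<open>f s \<ge> 0\<close> would force another zero between
      them.\<close>
    have le: "s \<le> b - \<delta> / 4"
    proof (rule ccontr)
      assume "\<not> s \<le> b - \<delta> / 4"
      then show False using neg[of s] \<delta> s ns by auto
    qed
    have "f (b - \<delta> / 4) < 0" using \<delta> by (intro neg) auto
    then have "\<exists>x\<ge>s. x \<le> b - \<delta> / 4 \<and> f x = 0"
      using ns le s a by (intro IVT2') (auto intro: continuous_on_subset[OF c])
    then obtain x where "s \<le> x" "x \<le> b - \<delta> / 4" "f x = 0" by blast
    then show False using nz[of x] s \<delta> by auto
  qed
  then show ?thesis using that[of a] a \<delta> by auto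
qed

text \<open>Beyond \<open>T\<close> the integral grows at rate at least \<open>\<kappa>\<close>, so
  the length \<open>\<bar>integral {a..T} f\<bar> / \<kappa>\<close> makes up for a negative start.
  The level \<open>M\<close> will be a barrier for the energy.\<close>

lemma antiderivative_eventually_nonneg:
  fixes f :: "real \<Rightarrow> real"
  assumes c: "continuous_on {a..} f" and \<kappa>: "\<kappa> > 0" and ev: "eventually (\<lambda>s. f s \<ge> \<kappa>) at_top"
  obtains M where "M > b" "M > a" "integral {a..M} f \<ge> 0"
proof -
  obtain S where S: "\<And>s. s \<ge> S \<Longrightarrow> f s \<ge> \<kappa>" using ev by (auto simp: eventually_at_top_linorder)
  define T where "T = max S (max (b + 1) (a + 1))"
  have T: "T \<ge> S" "T \<ge> b + 1" "T \<ge> a + 1" by (auto simp: T_def)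
  define M where "M = T + \<bar>integral {a..T} f\<bar> / \<kappa>"
  have M: "M \<ge> T" using \<kappa> by (simp add: M_def)
  have int: "f integrable_on {x..M}" if "x \<ge> a" for x
    using that by (intro integrable_continuous_interval continuous_on_subset[OF c]) auto
  have "integral {a..T} f + integral {T..M} f = integral {a..M} f"
    using T M int by (intro Henstock_Kurzweil_Integration.integral_combine) auto
  moreover have "integral {T..M} (\<lambda>_. \<kappa>) \<le> integral {T..M} f"
    using T S int by (intro integral_le) auto
  moreover have "integral {T..M} (\<lambda>_. \<kappa>) = \<bar>integral {a..T} f\<bar>"
    using M \<kappa> by (simp add: M_def)
  ultimately have "integral {a..M} f \<ge> 0" by linarith
  then show ?thesis using that[of M] T M by auto
qed

lemma clamp_lipschitz:
  fixes f f' :: "real \<Rightarrow> real"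
  assumes d: "\<And>s. s \<in> {a..M} \<Longrightarrow> (f has_real_derivative f' s) (at s within {a..M})"
    and c: "continuous_on {a..M} f'" and aM: "a \<le> M"
  obtains L where "\<And>x y. \<bar>f (max a (min M x)) - f (max a (min M y))\<bar> \<le> L * \<bar>x - y\<bar>"
proof -
  have "bounded (f' ` {a..M})" by (intro compact_imp_bounded compact_continuous_image c) auto
  then obtain L where L: "\<forall>y\<in>f' ` {a..M}. norm y \<le> L" by (auto simp only: bounded_iff)
  have "norm (f' a) \<le> L" using L aM by auto
  then have L0: "L \<ge> 0" by (rule order_trans[OF norm_ge_zero])
  have "\<bar>f (max a (min M x)) - f (max a (min M y))\<bar> \<le> L * \<bar>x - y\<bar>" for x y
  proof -
    have "norm (f (max a (min M x)) - f (max a (min M y))) \<le> L * norm (max a (min M x) - max a (min M y))"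
      by (rule field_differentiable_bound[where f'=f' and S="{a..M}"]) (use d L aM in auto)
    also have "\<dots> \<le> L * \<bar>x - y\<bar>" using L0 by (intro mult_left_mono) auto
    finally show ?thesis by simp
  qed
  then show ?thesis using that by blast
qed

lemma DERIV_eq_0_slope:
  fixes f :: "real \<Rightarrow> real"
  assumes "(f has_real_derivative D) (at b)" "f b = 0" "D > \<mu>" "b > 0"
  obtains \<delta> where "0 < \<delta>" "\<delta> < b" "\<And>s. b - \<delta> < s \<Longrightarrow> s < b \<Longrightarrow> f s < \<mu> * (s - b)"
    "\<And>s. b < s \<Longrightarrow> s < b + \<delta> \<Longrightarrow> f s > \<mu> * (s - b)"
proof -
  have "((\<lambda>s. (f s - f b) / (s - b)) \<longlongrightarrow> D) (at b)"
    using assms(1) by (simp add: has_field_derivative_iff)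
  then have "eventually (\<lambda>s. (f s - f b) / (s - b) > \<mu>) (at b)" by (rule order_tendstoD(1)) fact
  then obtain d where d: "d > 0" "\<And>s. s \<noteq> b \<Longrightarrow> dist s b < d \<Longrightarrow> f s / (s - b) > \<mu>"
    using assms(2) by (auto simp: eventually_at)
  show ?thesis
  proof (rule that[of "min d (b / 2)"])
    fix s :: real
    show "f s < \<mu> * (s - b)" if "b - min d (b / 2) < s" "s < b"
      using d(2)[of s] that by (auto simp: dist_real_def neg_less_divide_eq)
    show "f s > \<mu> * (s - b)" if "b < s" "s < b + min d (b / 2)"
      using d(2)[of s] that by (auto simp: dist_real_def pos_less_divide_eq)
  qed (use d(1) assms(4) in auto)
qed

text \<open>Besides a solution, the conclusion records an interval around \<open>u 0\<close> free of
  fixed points and the continuity of the profile, so that solutions for different \<open>b\<close>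
  can be told apart at the origin.\<close>

lemma increasing_solution_below:
  fixes g g' :: "real \<Rightarrow> real" and b :: real
  assumes C1: "\<forall>s\<ge>0. (g has_real_derivative g' s) (at s within {0..})"
      and C1': "continuous_on {0..} g'"
      and g1: "\<exists>L. ((\<lambda>s. g s / s) \<longlongrightarrow> L) (at_right 0) \<and> 0 \<le> L \<and> L < 1"
      and g2: "Liminf at_top (\<lambda>s. ereal (g s / s)) > 1"
      and b: "b > 0" "g b = b" "g' b > lambda2_rad TYPE('n::euclidean_space)"
  obtains a u where "a < u 0" "u 0 < b" "\<And>s. a < s \<Longrightarrow> s < b \<Longrightarrow> g s \<noteq> s"
    "continuous_on {0..} u" "incr_radial_sol g (\<lambda>x::'n. u (norm x))"
proof -
  have n: "DIM('n) > 0" by simp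
  obtain \<mu> \<phi> q where \<mu>: "\<mu> > 0" "\<mu> + 1 < g' b" and ode: "radial_ode DIM('n) \<phi> q (\<lambda>r. \<mu> * \<phi> r)"
    and \<phi>: "\<phi> 0 = 1" "q 1 = 0"
    using lambda2_rad_less[OF b(3)] by blast
  define f where "f s = g s - s" for s
  have gd: "(g has_real_derivative g' s) (at s within {0..})" if "s \<ge> 0" for s using C1 that by simp
  have fd: "(f has_real_derivative g' s - 1) (at s within {0..})" if "s \<ge> 0" for s
    unfolding f_def using gd[OF that] by (auto intro!: derivative_eq_intros)
  have gc: "continuous_on {0..} g"
    using gd by (auto simp: continuous_on_eq_continuous_within intro: DERIV_continuous)
  have fc: "continuous_on {0..} f" unfolding f_def by (intro continuous_intros gc)
  \<comment> \<open>The limit in \<open>g1\<close> is finite, so \<open>g s = g s / s * s\<close>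
    tends to 0. This guarantees a zero of \<open>f\<close> below \<open>b\<close>.\<close>
  have f0: "f 0 = 0"
  proof -
    obtain l where "((\<lambda>s. g s / s) \<longlongrightarrow> l) (at_right 0)" using g1 by blast
    then have "((\<lambda>s. g s / s * s) \<longlongrightarrow> l * 0) (at_right 0)"
      by (intro tendsto_mult) (auto intro: tendsto_ident_at)
    moreover have "\<forall>\<^sub>F s in at_right 0. g s / s * s = g s"
      by (auto simp: eventually_at_filter)
    ultimately have "(g \<longlongrightarrow> 0) (at_right 0)" by (simp add: tendsto_cong)
    moreover have "(g \<longlongrightarrow> g 0) (at_right 0)"
    proof (rule tendsto_within_subset)
      show "(g \<longlongrightarrow> g 0) (at 0 within {0..})" using gc by (simp add: continuous_on_def)
    qed auto
    ultimately have "g 0 = 0" using tendsto_unique[of "at_right (0::real)"] by force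
    then show ?thesis by (simp add: f_def)
  qed
  have "(f has_real_derivative g' b - 1) (at b)"
    using fd[of b] b(1) by (simp add: at_within_interior[of b "{0..}"])
  moreover have fb: "f b = 0" using b by (simp add: f_def)
  ultimately obtain \<delta>0 where \<delta>0: "0 < \<delta>0" "\<delta>0 < b" "\<And>s. b - \<delta>0 < s \<Longrightarrow> s < b \<Longrightarrow> f s < \<mu> * (s - b)"
    "\<And>s. b < s \<Longrightarrow> s < b + \<delta>0 \<Longrightarrow> f s > \<mu> * (s - b)"
    using DERIV_eq_0_slope[of f "g' b - 1" b \<mu>] \<mu> b(1) by auto
  have "f s < 0" if "b - \<delta>0 < s" "s < b" for s
    using \<delta>0(3)[OF that] mult_pos_neg[of \<mu> "s - b"] \<mu> that by simp
  then obtain a where a: "0 \<le> a" "a < b" "f a = 0" "\<And>s. a < s \<Longrightarrow> s < b \<Longrightarrow> f s < 0"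
    using largest_zero_below[OF fc f0 \<delta>0(1,2)] by blast
  have fca: "continuous_on {a..} f" using a by (intro continuous_on_subset[OF fc]) auto
  \<comment> \<open>A real \<open>k\<close> strictly between 1 and the lower limit turns
    \<open>g2\<close> into \<open>f s \<ge> k - 1\<close> for large \<open>s\<close>.\<close>
  obtain y where y: "1 < y" "y < Liminf at_top (\<lambda>s. ereal (g s / s))" using dense[OF g2] by blast
  then obtain k where k: "y = ereal k" by (cases y) auto
  have k1: "k > 1" using y(1) k by (simp add: one_ereal_def)
  have "eventually (\<lambda>s. k < g s / s) at_top" using less_LiminfD[OF y(2)] k by simp
  then have "eventually (\<lambda>s. f s \<ge> k - 1) at_top"
    using eventually_ge_at_top[of 1]
  proof eventually_elim
    case (elim s)
    have "(k - 1) * 1 \<le> (k - 1) * s" using elim k1 by (intro mult_left_mono) auto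
    moreover have "k * s < g s" using elim by (simp add: pos_less_divide_eq)
    ultimately show ?case by (simp add: f_def algebra_simps)
  qed
  then obtain M where M: "M > b" "M > a" "integral {a..M} f \<ge> 0"
    using antiderivative_eventually_nonneg[OF fca, of "k - 1" b] k1 by auto
  \<comment> \<open>Clamping to [a, M] makes \<open>f\<close> globally Lipschitz and extends it
    below \<open>a\<close> by \<open>f a = 0\<close>, as the shooting argument requires.\<close>
  define ft where "ft s = f (max a (min M s))" for s
  have ft_eq: "ft s = f s" if "a \<le> s" "s \<le> M" for s using that by (simp add: ft_def)
  obtain L where L: "\<And>x y. \<bar>ft x - ft y\<bar> \<le> L * \<bar>x - y\<bar>"
    unfolding ft_def
  proof (rule clamp_lipschitz[where f=f and f'="\<lambda>s. g' s - 1" and a=a and M=M])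
    show "(f has_real_derivative g' s - 1) (at s within {a..M})" if "s \<in> {a..M}" for s
      by (rule DERIV_subset[OF fd]) (use that a in auto)
    show "continuous_on {a..M} (\<lambda>s. g' s - 1)"
      using a by (intro continuous_intros continuous_on_subset[OF C1']) auto
  qed (use M in auto)
  \<comment> \<open>Small enough for \<open>(b - \<delta>, b + \<delta>)\<close> to lie between
    \<open>a\<close> and \<open>M\<close>, where \<open>ft\<close> agrees with
    \<open>f\<close>.\<close>
  define \<delta> where "\<delta> = min \<delta>0 (min (b - a) (M - b))"
  have \<delta>: "\<delta> > 0" "\<delta> \<le> \<delta>0" "\<delta> \<le> b - a" "\<delta> \<le> M - b" using \<delta>0 a M by (auto simp: \<delta>_def)
  obtain u p where u: "radial_ode DIM('n) u p (\<lambda>r. ft (u r))" "a < u 0" "u 0 < b" "p 0 > 0" "p 1 = 0"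
    "\<And>r. 0 \<le> r \<Longrightarrow> r \<le> 1 \<Longrightarrow> p r \<ge> 0"
  proof (rule increasing_shooting[OF n L a(2) _ _ _ ode \<mu>(1) \<phi> \<delta>(1)])
    show "ft b = 0" using fb a M by (simp add: ft_eq)
    show "ft s < 0" if "a < s" "s < b" for s using that a(4) M by (simp add: ft_eq)
    show "ft s = 0" if "s \<le> a" for s using that a M by (simp add: ft_def)
    show "ft s \<le> \<mu> * (s - b)" if s: "b - \<delta> < s" "s \<le> b" for s
    proof (cases "s = b")
      case False
      then have "f s < \<mu> * (s - b)" using s \<delta> by (intro \<delta>0) auto
      then show ?thesis using s \<delta> M by (simp add: ft_eq)
    qed (use fb a M in \<open>simp add: ft_eq\<close>)
    show "ft s \<ge> \<mu> * (s - b)" if s: "b \<le> s" "s < b + \<delta>" for s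
    proof (cases "s = b")
      case False
      then have "f s > \<mu> * (s - b)" using s \<delta> by (intro \<delta>0) auto
      then show ?thesis using s \<delta> a by (simp add: ft_eq)
    qed (use fb a M in \<open>simp add: ft_eq\<close>)
  qed blast
  have umono: "u r \<le> u s" if "0 \<le> r" "r \<le> s" "s \<le> 1" for r s
    using radial_ode_mono[OF u(1) n, of r s] u(6) that by simp
  have ua: "u r > a" if "0 \<le> r" "r \<le> 1" for r using umono[of 0 r] u(2) that by simp
  define F where "F s = integral {a..s} ft" for s
  have ftc: "continuous_on S ft" for S
    unfolding ft_def using a by (intro continuous_on_compose2[OF fca]) (auto intro!: continuous_intros)
  have Fd: "(F has_real_derivative ft s) (at s within {a..s + 1})" if "s \<ge> a" for s
    unfolding F_def has_real_derivative_iff_has_vector_derivative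
    using that by (intro integral_has_vector_derivative ftc) auto
  have Fd': "(F has_real_derivative ft s) (at s)" if "s > a" for s
    using Fd[of s] that by (simp add: at_within_interior[of s "{a..s + 1}"])
  \<comment> \<open>Since \<open>f < 0\<close> between \<open>a\<close> and \<open>u 0\<close>, the
    energy starts below \<open>F a = 0\<close>.\<close>
  have "F (u 0) < F a"
  proof (rule DERIV_neg_imp_decreasing_open[OF u(2)])
    show "\<exists>y. (F has_real_derivative y) (at s) \<and> y < 0" if "a < s" "s < u 0" for s
      using Fd'[of s] that a(4)[of s] u(3) M by (intro exI[of _ "ft s"]) (simp add: ft_eq)
    show "continuous_on {a..u 0} F"
      unfolding F_def by (intro indefinite_integral_continuous_1 integrable_continuous_interval ftc)
  qed
  then have Fu0: "F (u 0) < 0" by (simp add: F_def)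
  have FM: "F M \<ge> 0"
  proof -
    have "integral {a..M} ft = integral {a..M} f" by (intro integral_cong) (simp add: ft_eq)
    then show ?thesis using M by (simp add: F_def)
  qed
  \<comment> \<open>Reaching \<open>M\<close> would mean \<open>F M \<le> F (u 0) < 0\<close>,
    against the choice of \<open>M\<close>. Hence the truncation is never felt on [0, 1].\<close>
  have uM: "u r < M" if r: "0 \<le> r" "r \<le> 1" for r
  proof (rule ccontr)
    assume "\<not> u r < M"
    then have "\<exists>t\<ge>0. t \<le> r \<and> u t = M"
      using r u(3) M by (intro IVT') (auto intro: continuous_on_subset[OF radial_odeD(7)[OF u(1)]])
    then obtain t where t: "0 \<le> t" "t \<le> r" "u t = M" by blast
    have "F (u t) \<le> F (u 0)"
      by (rule radial_energy_decreasing[OF u(1) n t(1), of a F]) (use ua Fd' t r in auto)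
    then show False using t Fu0 FM by simp
  qed
  have cu: "continuous_on UNIV (\<lambda>x::'n. u (norm x))"
    by (intro continuous_norm_compose radial_odeD(7)[OF u(1)])
  have "incr_radial_sol g (\<lambda>x::'n. u (norm x))"
    unfolding incr_radial_sol_def
  proof (intro conjI)
    show "neumann_weak_sol (\<lambda>x::'n. g (u (norm x))) (\<lambda>x. u (norm x))"
    proof (rule neumann_weak_sol_radial[OF u(1,5)])
      fix x :: 'n assume "x \<in> unit_ball"
      then have "a < u (norm x)" "u (norm x) < M" by (auto intro!: ua uM)
      then show "g (u (norm x)) = ft (u (norm x)) + u (norm x)" by (simp add: ft_eq f_def)
    qed
    show "\<forall>x::'n\<in>unit_ball. u (norm x) > 0"
    proof
      fix x :: 'n assume "x \<in> unit_ball"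
      then show "u (norm x) > 0" using ua[of "norm x"] a(1) by simp
    qed
    show "\<exists>v. (\<forall>x::'n\<in>unit_ball. u (norm x) = v (norm x)) \<and> mono_on {0..<1} v"
      by (intro exI[of _ u] conjI mono_onI) (auto intro: umono)
    show "\<not> (\<exists>c. AE x::'n in lebesgue. x \<in> unit_ball \<longrightarrow> u (norm x) = c)"
    proof
      assume "\<exists>c. AE x::'n in lebesgue. x \<in> unit_ball \<longrightarrow> u (norm x) = c"
      then obtain c where c: "AE x::'n in lebesgue. x \<in> unit_ball \<longrightarrow> u (norm x) = c" by blast
      have const: "u r = c" if "0 \<le> r" "r < 1" for r
      proof -
        obtain x :: 'n where "norm x = r" using vector_choose_size[OF \<open>0 \<le> r\<close>] by blast
        then show ?thesis using AE_unit_ball_continuous[OF c cu continuous_on_const, of x] that by simp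
      qed
      \<comment> \<open>A constant profile contradicts \<open>p 0 > 0\<close>, which makes
        \<open>u\<close> strictly increasing near 0.\<close>
      have "(p \<longlongrightarrow> p 0) (at 0 within {0..})"
        using radial_odeD(1)[OF u(1)] by (simp add: continuous_on_def)
      then have "(p \<longlongrightarrow> p 0) (at_right 0)" by (rule tendsto_within_subset) auto
      then have "eventually (\<lambda>r. p r > 0) (at_right 0)" by (rule order_tendstoD(1)) fact
      then obtain e where e: "e > 0" "\<And>r. 0 < r \<Longrightarrow> r < e \<Longrightarrow> p r > 0"
        unfolding eventually_at_right_field by blast
      define s where "s = min (e / 2) (1 / 2)"
      have s: "0 < s" "s < e" "s < 1" using e by (auto simp: s_def)
      have "- u s < - u 0"
        using e s by (intro radial_ode_strict_antimono[OF radial_ode_uminus[OF u(1) n]]) auto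
      then show False using const[of 0] const[of s] s by simp
    qed
  qed
  moreover have "g s \<noteq> s" if "a < s" "s < b" for s using a(4)[OF that] by (simp add: f_def)
  ultimately show ?thesis using that[of a u] u(2,3) radial_odeD(7)[OF u(1)] by blast
qed

theorem theorem1p2:
  fixes g g' :: "real \<Rightarrow> real" and u0 :: real
  assumes C1: "\<forall>s\<ge>0. (g has_real_derivative g' s) (at s within {0..})"
      and C1': "continuous_on {0..} g'"
      and g1: "\<exists>L. ((\<lambda>s. g s / s) \<longlongrightarrow> L) (at_right 0) \<and> 0 \<le> L \<and> L < 1"
      and g2: "Liminf at_top (\<lambda>s. ereal (g s / s)) > 1"
      and g3: "u0 > 0" "g u0 = u0" "g' u0 > lambda2_rad TYPE('n::euclidean_space)"
  shows "(\<exists>u::'n \<Rightarrow> real. incr_radial_sol g u) \<and>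
         (\<forall>(n::nat) (c::nat \<Rightarrow> real).
            inj_on c {..<n} \<and> (\<forall>i<n. c i > 0 \<and> g (c i) = c i \<and> g' (c i) > lambda2_rad TYPE('n)) \<longrightarrow>
            (\<exists>us::nat \<Rightarrow> 'n \<Rightarrow> real. (\<forall>i<n. incr_radial_sol g (us i)) \<and>
               (\<forall>i<n. \<forall>j<n. i \<noteq> j \<longrightarrow>
                  \<not> (AE x in lebesgue. x \<in> unit_ball \<longrightarrow> us i x = us j x))))"
proof (intro conjI allI impI)
  show "\<exists>u::'n \<Rightarrow> real. incr_radial_sol g u"
    using increasing_solution_below[OF C1 C1' g1 g2 g3] by metis
  fix n :: nat and c :: "nat \<Rightarrow> real"
  assume *: "inj_on c {..<n} \<and> (\<forall>i<n. c i > 0 \<and> g (c i) = c i \<and> g' (c i) > lambda2_rad TYPE('n))"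
  have "\<exists>a u. a < u 0 \<and> u 0 < c i \<and> (\<forall>s. a < s \<longrightarrow> s < c i \<longrightarrow> g s \<noteq> s) \<and> continuous_on {0..} u \<and>
      incr_radial_sol g (\<lambda>x::'n. u (norm x))" if "i < n" for i
  proof -
    have ci: "c i > 0" "g (c i) = c i" "g' (c i) > lambda2_rad TYPE('n)" using * that by auto
    show ?thesis
      by (rule increasing_solution_below[OF C1 C1' g1 g2 ci]) blast
  qed
  then obtain a v where v: "\<And>i. i < n \<Longrightarrow> a i < v i 0 \<and> v i 0 < c i \<and> (\<forall>s. a i < s \<longrightarrow> s < c i \<longrightarrow> g s \<noteq> s) \<and>
      continuous_on {0..} (v i) \<and> incr_radial_sol g (\<lambda>x::'n. v i (norm x))"
    by metis
  \<comment> \<open>The fixed point \<open>c i\<close> cannot lie in \<open>(a j, c j)\<close>, so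
    \<open>v i 0 < c i \<le> a j < v j 0\<close>.\<close>
  have less: "v i 0 < v j 0" if "i < n" "j < n" "c i < c j" for i j
  proof -
    have "\<not> a j < c i" using v[OF that(2)] that * by blast
    then show ?thesis using v[OF that(1)] v[OF that(2)] by linarith
  qed
  have "\<not> (AE x::'n in lebesgue. x \<in> unit_ball \<longrightarrow> v i (norm x) = v j (norm x))"
    if ij: "i < n" "j < n" "i \<noteq> j" for i j
  proof
    assume ae: "AE x::'n in lebesgue. x \<in> unit_ball \<longrightarrow> v i (norm x) = v j (norm x)"
    have "v i (norm (0::'n)) = v j (norm (0::'n))"
      using v[OF ij(1)] v[OF ij(2)] by (intro AE_unit_ball_continuous[OF ae] continuous_norm_compose) auto
    moreover have "c i \<noteq> c j" using * ij by (auto dest: inj_onD)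
    ultimately show False using less[of i j] less[of j i] ij by (cases "c i < c j") auto
  qed
  then show "\<exists>us::nat \<Rightarrow> 'n \<Rightarrow> real. (\<forall>i<n. incr_radial_sol g (us i)) \<and>
       (\<forall>i<n. \<forall>j<n. i \<noteq> j \<longrightarrow> \<not> (AE x in lebesgue. x \<in> unit_ball \<longrightarrow> us i x = us j x))"
    using v by (intro exI[of _ "\<lambda>i x. v i (norm x)"]) auto
qed

end
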